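(* Let $n\ge1$, let $\mathcal{T},\mathcal{T}'\in\mathcal{PT}_n^B$ be permutation tableaux of type $B$ of length $n$, and let $\sigma=\zeta(\mathcal{T})$, $\sigma'=\zeta(\mathcal{T}')$ be the corresponding signed permutations. Then $\sigma'$ covers $\sigma$ in the weak Bruhat order on $\mathfrak{S}_n^B$ if and only if $\mathcal{T}'$ is obtained from $\mathcal{T}$ (up to the zero-column convention) by one of the following operations: (1) adding a new box filled with $1$ to $\mathcal{T}$ (and relabeling rows and columns); (2) applying the zero-row rule to $\mathcal{T}$; (3) replacing by $0$ a $1$ at which the two zigzag paths from two rows with consecutive labels $a$ and $a+1$ meet, or at which the two zigzag paths from two columns with consecutive labels $j$ and $j+1$ meet; (4) replacing a rectangular part in two rows with consecutive labels $a$ and $a+1$, or in two columns with consecutive labels $j$ and $j+1$, by another rectangle according to the rectangle replacement rule.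
   Context: Signed permutations. $[n]=\{1,\dots,n\}$, $[\pm n]=\{\pm1,\dots,\pm n\}$. $\mathfrak{S}_n^B$ is the group of permutations $\sigma$ of $[\pm n]$ with $\sigma(-i)=-\sigma(i)$. It is generated by $s_0$ (which sends $1\mapsto-1$ and fixes $2,\dots,n$) and $s_i$, $1\le i\le n-1$ (which exchanges $i$ and $i+1$). $\ell(\sigma)$ is the least number of generators in an expression of $\sigma$. $\sigma'$ covers $\sigma$ in weak Bruhat order if $\sigma'=\sigma s_i$ for some $i\in\{0,\dots,n-1\}$ and $\ell(\sigma')=\ell(\sigma)+1$; here $(\sigma s_i)(j)=\sigma(s_i(j))$. Diagrams. For $0\le k\le n$, a $(k,n)$-diagram is a left-justified diagram of boxes in a $k\times(n-k)$ rectangle with $\lambda_r$ boxes in row $r$, $\lambda_1\ge\dots\ge\lambda_k\ge0$. A shifted $(k,n)$-diagram is a $(k,n)$-diagram together with a staircase of boxes added above it, the $j$-th column from the left receiving $n-k-j+1$ additional boxes; the topmost box of each column is called a diagonal. Labels: follow the southeast border of the $(k,n)$-diagram from the northeast corner to the southwest corner of the rectangle, labeling its unit steps $1,\dots,n$; a vertical step gives its label to its row, a horizontal step gives its label to its column. Each added (staircase) row, whose diagonal (rightmost) box lies in the column labeled $i$, is labeled $-i$. Box $(r,c)$ is the box in the row labeled $r$ and the column labeled $c$. Permutation tableau of type $B$ of length $n$ (set $\mathcal{PT}_n^B$): a $(0,1)$-filling of a shifted $(k,n)$-diagram such that (i) every column contains a $1$; (ii) a box with a $1$ above it in its column and a $1$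 to its left in its row contains a $1$; (iii) if a diagonal contains $0$, its row contains no $1$. Zigzag paths and $\zeta$. The zigzag path from a row (column) starts at the left of that row (the top of that column) moving east (south), switches direction between east and south at each $1$ it meets, and stops when it reaches the right end of a row or the bottom of a column. $\zeta:\mathcal{PT}_n^B\to\mathfrak{S}_n^B$ is the bijection such that for $i\in[n]$: if $i$ labels a row, $\zeta(\mathcal{T})(i)$ is the label of the row or column where the path from row $i$ ends; if $-i$ labels a row with $0$ in its diagonal, $\zeta(\mathcal{T})(i)$ is the label where the path from column $i$ ends; if $-i$ labels a row with $1$ in its diagonal, $\zeta(\mathcal{T})(-i)$ is the label where the path from row $-i$ ends. Zero-row rule (operation (2)). Suppose $i$ and $i+1$ ($1\le i\le n-1$) both label rows of $\mathcal{T}$ and row $i$ is filled with $0$'s. Delete row $i$; insert a new column immediately to the right of the rightmost box of row $i+1$, whose bottommost box is in that row and contains $1$ and whose other boxes contain $0$; insert the corresponding new negatively labeled row, filled with $0$'s (its diagonal is the top box of the new column); relabel rows and columns. (The old row $i+1$ becomes row $i$, the new column has label $i+1$ and the new row has label $-(i+1)$.) Rectangle replacement rule (operation (4)). Rows: let rows $a$ (upper) and $a+1$ (lower) have consecutive labels of the same sign, and suppose the leftmost $1$ of the lower row is in a column strictly to the left of that of the leftmost $1$ of the upper row. Take the smallest two-row rectangle containing these two $1$'s. In each of its columns in which the lower entry is $1$, change the pair of entries to upper $=1$, lower $=0$; columns with both entries $0$ are unchanged. When $a=-(i+1)$, $a+1=-i$ with row $-(i+1)$ having $0$ in its diagonal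 and row $-i$ having $1$ in its diagonal, the rule is applied assuming an imaginary $1$ directly above the diagonal box of row $-i$ (playing the role of the leftmost $1$ of row $-(i+1)$). Columns: let columns $j$ (right) and $j+1$ (left) have consecutive labels, and suppose the topmost $1$ of column $j$ is in a row strictly above that of the topmost $1$ of column $j+1$. Take the smallest two-column rectangle containing these two $1$'s. In each of its rows in which the entry of column $j$ is $1$, change the pair of entries to (column $j+1$) $=1$, (column $j$) $=0$; rows with both entries $0$ are unchanged. Zero-column convention. If an operation produces a column $i$ with all entries $0$ and hence a row $-i$ with all entries $0$, then column $i$ and row $-i$ are deleted and a new row labeled $i$, filled with $0$'s, is inserted instead.
   Formalization: In (4), if row −(i+1) has diagonal 0, row −i diagonal 1 and box (−i,i+1) is 0, the rule with the imaginary 1 is applied to rows −(i+1), −i and then also to columns i, i+1; with the row rule alone "only if" fails, e.g. for (3,−1,2) covered by (3,2,−1). *)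

theory Defs
  imports "HOL-Combinatorics.Permutations"
begin

section \<open>Signed permutations and the weak Bruhat order\<close>

text \<open>A signed permutation is a permutation of the integers fixing everything outside
  the set of \<open>\<plusminus>1, \<dots>, \<plusminus>n\<close>.\<close>

definition pm_set :: "nat \<Rightarrow> int set" where
  "pm_set n = {j. 1 \<le> \<bar>j\<bar> \<and> \<bar>j\<bar> \<le> int n}"

definition signed_perms :: "nat \<Rightarrow> (int \<Rightarrow> int) set" where
  "signed_perms n = {\<sigma>. \<sigma> permutes pm_set n \<and> (\<forall>i. \<sigma> (- i) = - \<sigma> i)}"

definition gen :: "nat \<Rightarrow> int \<Rightarrow> int" where
  "gen i = (if i = 0 then transpose 1 (-1)
            else transpose (int i) (int i + 1) \<circ> transpose (- int i) (- (int i + 1)))"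

definition len :: "nat \<Rightarrow> (int \<Rightarrow> int) \<Rightarrow> nat" where
  "len n \<sigma> = (LEAST l. \<exists>w. length w = l \<and> set w \<subseteq> {..<n} \<and> \<sigma> = foldr (\<circ>) (map gen w) id)"

definition weak_covers :: "nat \<Rightarrow> (int \<Rightarrow> int) \<Rightarrow> (int \<Rightarrow> int) \<Rightarrow> bool" where
  "weak_covers n \<sigma>' \<sigma> \<longleftrightarrow> \<sigma> \<in> signed_perms n \<and>
     (\<exists>i<n. \<sigma>' = \<sigma> \<circ> gen i \<and> len n \<sigma>' = len n \<sigma> + 1)"


section \<open>Shifted diagrams and their labels\<close>

text \<open>A \<open>(k,n)\<close>-diagram is the list \<open>p\<close> of its row lengths, with \<open>k = length p\<close>; list positions
  start at 0, columns are counted from the left starting at 1.\<close>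

definition is_diagram :: "nat \<Rightarrow> nat list \<Rightarrow> bool" where
  "is_diagram n p \<longleftrightarrow> length p \<le> n \<and> sorted_wrt (\<ge>) p \<and> (\<forall>x\<in>set p. x \<le> n - length p)"

text \<open>On the southeast border, read from the northeast corner, the vertical step of a row is
  preceded by the vertical steps of the rows above it and by the horizontal steps of the columns
  that do not reach the row; the horizontal step of a column is preceded by those of the columns
  to its right and by the vertical steps of the rows that reach the column.\<close>

definition row_label :: "nat \<Rightarrow> nat list \<Rightarrow> nat \<Rightarrow> int" where
  "row_label n p r = int (r + (n - length p - p ! r) + 1)"

definition col_label :: "nat \<Rightarrow> nat list \<Rightarrow> nat \<Rightarrow> int" where
  "col_label n p q = int ((n - length p - q) + card {r. r < length p \<and> q \<le> p ! r} + 1)"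

text \<open>Boxes are named by their labels. A staircase row with its diagonal in column \<open>d\<close>
  consists of one box in each of the columns \<open>1, \<dots>, d\<close>. Row labels (negative ones included)
  increase from top to bottom and column labels increase from right to left, so that
  ``above'' means a smaller row label and ``to the left'' means a larger column label.\<close>

definition boxes :: "nat \<Rightarrow> nat list \<Rightarrow> (int \<times> int) set" where
  "boxes n p =
     {(row_label n p r, col_label n p q) | r q. r < length p \<and> 1 \<le> q \<and> q \<le> p ! r} \<union>
     {(- col_label n p d, col_label n p q) | d q. 1 \<le> q \<and> q \<le> d \<and> d \<le> n - length p}"

text \<open>The filling is given by the set \<open>ones\<close> of boxes containing 1.\<close>

record tableau =
  part :: "nat list"
  ones :: "(int \<times> int) set"

definition cols :: "nat \<Rightarrow> tableau \<Rightarrow> int set" where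
  "cols n T = col_label n (part T) ` {1..n - length (part T)}"

definition rows :: "nat \<Rightarrow> tableau \<Rightarrow> int set" where
  "rows n T = row_label n (part T) ` {..<length (part T)} \<union> uminus ` cols n T"

definition PT :: "nat \<Rightarrow> tableau set" where
  "PT n = {T. is_diagram n (part T) \<and> ones T \<subseteq> boxes n (part T) \<and>
     (\<forall>c\<in>cols n T. \<exists>r. (r, c) \<in> ones T) \<and>
     (\<forall>r c r' c'. (r, c) \<in> boxes n (part T) \<and> r' < r \<and> (r', c) \<in> ones T
        \<and> c' > c \<and> (r, c') \<in> ones T \<longrightarrow> (r, c) \<in> ones T) \<and>
     (\<forall>i\<in>cols n T. (- i, i) \<notin> ones T \<longrightarrow> (\<forall>c. (- i, c) \<notin> ones T))}"


section \<open>Zigzag paths and the bijection\<close>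

text \<open>\<open>East r c\<close>: travelling east in row \<open>r\<close>, just past column \<open>c\<close>;
  \<open>South r c\<close>: travelling south in column \<open>c\<close>, just past row \<open>r\<close>.
  \<open>zigzag F h bs e\<close>: with \<open>F\<close> the set of boxes containing 1, the path continuing from \<open>h\<close>
  meets exactly the 1's in the boxes \<open>bs\<close>, in this order, and stops at the end of the row or
  column labeled \<open>e\<close>.\<close>

datatype heading = East int int | South int int

inductive zigzag :: "(int \<times> int) set \<Rightarrow> heading \<Rightarrow> (int \<times> int) list \<Rightarrow> int \<Rightarrow> bool"
  for F :: "(int \<times> int) set" where
  row_end: "(\<And>c'. c' < c \<Longrightarrow> (r, c') \<notin> F) \<Longrightarrow> zigzag F (East r c) [] r"
| row_turn: "c' < c \<Longrightarrow> (r, c') \<in> F \<Longrightarrow> (\<And>x. c' < x \<Longrightarrow> x < c \<Longrightarrow> (r, x) \<notin> F) \<Longrightarrow>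
    zigzag F (South r c') bs e \<Longrightarrow> zigzag F (East r c) ((r, c') # bs) e"
| col_end: "(\<And>r'. r' > r \<Longrightarrow> (r', c) \<notin> F) \<Longrightarrow> zigzag F (South r c) [] c"
| col_turn: "r' > r \<Longrightarrow> (r', c) \<in> F \<Longrightarrow> (\<And>x. r < x \<Longrightarrow> x < r' \<Longrightarrow> (x, c) \<notin> F) \<Longrightarrow>
    zigzag F (East r' c) bs e \<Longrightarrow> zigzag F (South r c) ((r', c) # bs) e"

text \<open>Labels lie between \<open>-n\<close> and \<open>n\<close>, so these start outside the diagram.\<close>

definition row_start :: "nat \<Rightarrow> int \<Rightarrow> heading" where
  "row_start n r = East r (int n + 1)"

definition col_start :: "nat \<Rightarrow> int \<Rightarrow> heading" where
  "col_start n c = South (- (int n + 1)) c"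

definition path_end :: "tableau \<Rightarrow> heading \<Rightarrow> int" where
  "path_end T h = (THE e. \<exists>bs. zigzag (ones T) h bs e)"

definition meets_one :: "tableau \<Rightarrow> heading \<Rightarrow> int \<times> int \<Rightarrow> bool" where
  "meets_one T h b \<longleftrightarrow> (\<exists>bs e. zigzag (ones T) h bs e \<and> b \<in> set bs)"

definition zeta_pos :: "nat \<Rightarrow> tableau \<Rightarrow> int \<Rightarrow> int" where
  "zeta_pos n T i =
     (if i \<in> rows n T then path_end T (row_start n i)
      else if (- i, i) \<notin> ones T then path_end T (col_start n i)
      else - path_end T (row_start n (- i)))"

definition zeta :: "nat \<Rightarrow> tableau \<Rightarrow> int \<Rightarrow> int" where
  "zeta n T j =
     (if j \<notin> pm_set n then j
      else if j > 0 then zeta_pos n T j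
      else - zeta_pos n T (- j))"


section \<open>The operations\<close>

definition leftmost_one :: "(int \<times> int) set \<Rightarrow> int \<Rightarrow> int \<Rightarrow> bool" where
  "leftmost_one F r c \<longleftrightarrow> (r, c) \<in> F \<and> (\<forall>c'. (r, c') \<in> F \<longrightarrow> c' \<le> c)"

definition topmost_one :: "(int \<times> int) set \<Rightarrow> int \<Rightarrow> int \<Rightarrow> bool" where
  "topmost_one F c r \<longleftrightarrow> (r, c) \<in> F \<and> (\<forall>r'. (r', c) \<in> F \<longrightarrow> r \<le> r')"

text \<open>The replacement in rows \<open>a\<close> (upper), \<open>a + 1\<close> (lower) and columns with labels from \<open>x\<close>
  to \<open>y\<close>, and in columns \<open>j + 1\<close> (left), \<open>j\<close> (right) and rows with labels from \<open>x\<close> to \<open>y\<close>.\<close>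

definition replace_rows :: "int \<Rightarrow> int \<Rightarrow> int \<Rightarrow> (int \<times> int) set \<Rightarrow> (int \<times> int) set" where
  "replace_rows a x y F =
     (F - {a + 1} \<times> {x..y}) \<union> {(a, c) | c. x \<le> c \<and> c \<le> y \<and> (a + 1, c) \<in> F}"

definition replace_cols :: "int \<Rightarrow> int \<Rightarrow> int \<Rightarrow> (int \<times> int) set \<Rightarrow> (int \<times> int) set" where
  "replace_cols j x y F =
     (F - {x..y} \<times> {j}) \<union> {(r, j + 1) | r. x \<le> r \<and> r \<le> y \<and> (r, j) \<in> F}"

text \<open>\<open>operation n T C F\<close>: an operation turns \<open>T\<close> into the filling with set of 1's \<open>F\<close> of the
  shifted diagram with column labels \<open>C\<close>. The column labels are the numbers of the horizontal
  border steps and so determine a diagram of length \<open>n\<close>.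

  Adding a box: either row 1, which has no free space in the rectangle, gets a box \<open>(-1,1)\<close> and
  thereby becomes a staircase row and creates a new column; or the border steps \<open>i\<close>
  (horizontal) and \<open>i + 1\<close> (vertical) are exchanged around the new box. In both cases, and
  also for the zero-row rule, the relabeling is the action of \<open>gen\<close>.

  In the imaginary cases \<open>(- (i + 1), i)\<close> is the imaginary 1, directly above the diagonal box
  of row \<open>-i\<close>. It has to end up in the diagonal box of row \<open>- (i + 1)\<close>, or be
  dropped when that box has received a 1 from row \<open>-i\<close>. If the box to the left of the diagonal
  of row \<open>-i\<close> contains 0, the row replacement (whose rectangle may then be a single column) gives
  no such 1, and the rule is applied to the columns \<open>i\<close> and \<open>i + 1\<close> as well, the imaginary 1
  being the topmost 1 of column \<open>i\<close>. Without this case the characterization fails, for instance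
  for the signed permutations \<open>(3,-1,2)\<close> and \<open>(3,2,-1)\<close>.\<close>

inductive operation :: "nat \<Rightarrow> tableau \<Rightarrow> int set \<Rightarrow> (int \<times> int) set \<Rightarrow> bool"
  for n :: nat and T :: tableau where
  add_staircase_box:
    "1 \<in> rows n T \<Longrightarrow>
     operation n T (insert 1 (cols n T))
       (insert (-1, 1) (map_prod (gen 0) (gen 0) ` ones T))"
| add_box:
    "i \<ge> 1 \<Longrightarrow> int i \<in> cols n T \<Longrightarrow> int i + 1 \<in> rows n T \<Longrightarrow>
     operation n T (gen i ` cols n T)
       (insert (int i, int i + 1) (map_prod (gen i) (gen i) ` ones T))"
| zero_row:
    "i \<ge> 1 \<Longrightarrow> int i \<in> rows n T \<Longrightarrow> int i + 1 \<in> rows n T \<Longrightarrow> (\<forall>c. (int i, c) \<notin> ones T) \<Longrightarrow>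
     operation n T (insert (int i + 1) (cols n T))
       (insert (int i, int i + 1) (map_prod (gen i) (gen i) ` ones T))"
| meeting_rows:
    "a \<in> rows n T \<Longrightarrow> a + 1 \<in> rows n T \<Longrightarrow>
     meets_one T (row_start n a) b \<Longrightarrow> meets_one T (row_start n (a + 1)) b \<Longrightarrow>
     operation n T (cols n T) (ones T - {b})"
| meeting_cols:
    "j \<in> cols n T \<Longrightarrow> j + 1 \<in> cols n T \<Longrightarrow>
     meets_one T (col_start n j) b \<Longrightarrow> meets_one T (col_start n (j + 1)) b \<Longrightarrow>
     operation n T (cols n T) (ones T - {b})"
| rectangle_rows:
    "a \<in> rows n T \<Longrightarrow> a + 1 \<in> rows n T \<Longrightarrow>
     leftmost_one (ones T) a x \<Longrightarrow> leftmost_one (ones T) (a + 1) y \<Longrightarrow> x < y \<Longrightarrow>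
     operation n T (cols n T) (replace_rows a x y (ones T))"
| rectangle_cols:
    "j \<in> cols n T \<Longrightarrow> j + 1 \<in> cols n T \<Longrightarrow>
     topmost_one (ones T) j x \<Longrightarrow> topmost_one (ones T) (j + 1) y \<Longrightarrow> x < y \<Longrightarrow>
     operation n T (cols n T) (replace_cols j x y (ones T))"
| rectangle_imaginary:
    "i \<in> cols n T \<Longrightarrow> i + 1 \<in> cols n T \<Longrightarrow>
     (- (i + 1), i + 1) \<notin> ones T \<Longrightarrow> (- i, i) \<in> ones T \<Longrightarrow>
     leftmost_one (ones T) (- i) y \<Longrightarrow> i < y \<Longrightarrow>
     operation n T (cols n T)
       (replace_rows (- (i + 1)) i y (insert (- (i + 1), i) (ones T)) - {(- (i + 1), i)})"
| rectangle_imaginary_cols: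
    "i \<in> cols n T \<Longrightarrow> i + 1 \<in> cols n T \<Longrightarrow>
     (- (i + 1), i + 1) \<notin> ones T \<Longrightarrow> (- i, i) \<in> ones T \<Longrightarrow> (- i, i + 1) \<notin> ones T \<Longrightarrow>
     leftmost_one (ones T) (- i) y \<Longrightarrow> topmost_one (ones T) (i + 1) z \<Longrightarrow>
     operation n T (cols n T)
       (replace_cols i (- (i + 1)) z
         (replace_rows (- (i + 1)) i y (insert (- (i + 1), i) (ones T))))"

text \<open>The second alternative is the zero-column convention: the border step \<open>i\<close> becomes
  vertical, and the new row \<open>i\<close> contains no 1.\<close>

definition obtained :: "nat \<Rightarrow> tableau \<Rightarrow> tableau \<Rightarrow> bool" where
  "obtained n T T' \<longleftrightarrow> (\<exists>C F. operation n T C F \<and> ones T' = F \<and>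
     (cols n T' = C \<or>
      (\<exists>i\<in>C. (\<forall>r. (r, i) \<notin> F) \<and> (\<forall>c. (- i, c) \<notin> F) \<and> cols n T' = C - {i})))"

end

theory Submission
  imports Defs
begin

text \<open>All rows and columns are extended to the whole plane \<open>\<int> \<times> \<int>\<close>, where a box without a 1 lets the
  two paths entering it cross and a 1 makes them touch. Moving all paths at once, one box per unit
  of time, they form a wiring diagram: at time \<open>t\<close> they enter the boxes \<open>(r, c)\<close> with \<open>r - c = t\<close>, and
  in each of these boxes the two entering paths swap or not. By the rule for 1's in a permutation
  tableau two paths can only cross when they meet for the first time, so their ends determine the
  filling and \<open>zeta\<close> is injective. Each operation is a local change of the diagram which exchanges
  the ends of two paths that touch in the old tableau and cross in the new one. Conversely,
  an ascent of \<open>zeta n T\<close> at \<open>k\<close> forces one of the configurations in which an operation applies.\<close>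

section \<open>Paths as a synchronous dynamics\<close>

text \<open>The common clock makes whole families of paths comparable. Every \<open>step\<close> is
  a bijection of the states, so from the start on each state is occupied by exactly one path, and
  the effect of an operation can be described by a bijection between the states of the old and the
  new filling that is carried along in time (\<open>trail_intertwine\<close>). Columns are reduced
  to rows by the reflection \<open>mirror\<close>. Injectivity is what settles the converse: at an
  ascent \<open>k\<close> some operation produces a filling with the values of
  \<open>zeta n T \<circ> gen k\<close>, and a given \<open>T'\<close> with these values must be
  that filling. Three obstacles shape the rest. \<open>zeta\<close> reads only some of the starting
  states, so the ends of the remaining paths have to be known before all ends are. An operation may
  empty a column, so its result is only a \<open>pre_filling\<close> until that column is dropped.
  Some instances of \<open>operation\<close> do not yield a tableau at all; they are excluded by
  \<open>T' \<in> PT n\<close>. Lengths enter through inversions only: a cover by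
  \<open>gen k\<close> is an ascent at \<open>k\<close>.\<close>

text \<open>At time \<open>t\<close>, a path entering the box \<open>(r, r - t)\<close> is in state \<open>2 * r + 1\<close> if it comes from the
  left and in state \<open>2 * r\<close> if it comes from above. States increase from northeast to southwest.\<close>

definition step :: "(int \<times> int) set \<Rightarrow> int \<Rightarrow> int \<Rightarrow> int" where
  "step F t p = (if (p div 2, p div 2 - t) \<in> F then p + 1 else if even p then p + 2 else p)"

lemma step_odd: "step F t (2 * r + 1) = (if (r, r - t) \<in> F then 2 * r + 2 else 2 * r + 1)"
  by (simp add: step_def)

lemma step_even: "step F t (2 * r) = (if (r, r - t) \<in> F then 2 * r + 1 else 2 * r + 2)"
  by (simp add: step_def)

lemma even_odd_cases [case_names even odd]:
  fixes p :: int
  obtains r where "p = 2 * r" | r where "p = 2 * r + 1"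
  by (metis evenE oddE)

text \<open>The two exits of a box in row r have the states 2r + 1 (east) and 2r + 2 (south).
  Subtracting 1 before halving therefore recovers the row of the box just left, so that paths in
  different boxes never interact.\<close>

lemma step_div: "(step F t p - 1) div 2 = p div 2"
  by (cases p rule: even_odd_cases) (auto simp: step_odd step_even)

lemma step_inj: "step F t p = step F t q \<Longrightarrow> p = q"
proof -
  assume e: "step F t p = step F t q"
  then have "p div 2 = q div 2" by (metis step_div)
  then show ?thesis using e
    by (cases p rule: even_odd_cases; cases q rule: even_odd_cases)
       (auto simp: step_odd step_even split: if_splits)
qed

lemma step_surj: "\<exists>p. step F t p = q"
proof (cases q rule: even_odd_cases)
  case (even r)
  then show ?thesis
    using step_odd[of F t "r - 1"] step_even[of F t "r - 1"]
    by (cases "(r - 1, r - 1 - t) \<in> F") (fastforce simp: algebra_simps)+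
next
  case (odd r)
  then show ?thesis
    using step_odd[of F t r] step_even[of F t r] by (cases "(r, r - t) \<in> F") fastforce+
qed

lemma step_ge: "p \<le> step F t p"
  by (simp add: step_def)

text \<open>Paths leaving different boxes keep their order, because the exits of row r are 2r + 1
  and 2r + 2. Inside one box only a 0 reverses the order.\<close>

lemma step_mono:
  assumes "p < q" and "\<not> (p div 2 = q div 2 \<and> (p div 2, p div 2 - t) \<notin> F)"
  shows "step F t p < step F t q"
proof (cases "p div 2 = q div 2")
  case True
  then show ?thesis using assms
    by (cases p rule: even_odd_cases; cases q rule: even_odd_cases)
       (auto simp: step_odd step_even)
next
  case False
  then have "p div 2 < q div 2" using assms(1) by linarith
  then show ?thesis using step_div[of F t p] step_div[of F t q] by linarith
qed

text \<open>The clock starts at time -m, and the state x at that time names the path. Time 0 is the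
  line r = c, which lies beyond all 1's of a tableau; there the state 2r + 1 or 2r tells that the
  path ends in row r or in column r.\<close>

definition trail :: "(int \<times> int) set \<Rightarrow> int \<Rightarrow> int \<Rightarrow> int \<Rightarrow> int" where
  "trail F m x t = rec_nat x (\<lambda>k. step F (int k - m)) (nat (t + m))"

lemma trail_start [simp]: "trail F m x (- m) = x"
  by (simp add: trail_def)

lemma trail_step: "- m \<le> t \<Longrightarrow> trail F m x (t + 1) = step F t (trail F m x t)"
proof -
  assume "- m \<le> t"
  then have "nat (t + 1 + m) = Suc (nat (t + m))" "int (nat (t + m)) - m = t" by auto
  then show ?thesis by (simp add: trail_def)
qed

lemma trail_inj: "- m \<le> t \<Longrightarrow> trail F m x t = trail F m y t \<longleftrightarrow> x = y"
  by (induction t rule: int_ge_induct) (auto simp: trail_step dest: step_inj)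

lemma trail_surj: "- m \<le> t \<Longrightarrow> \<exists>x. trail F m x t = p"
proof (induction t arbitrary: p rule: int_ge_induct)
  case base
  then show ?case using trail_start by blast
next
  case (step t)
  then show ?case by (metis step_surj trail_step)
qed

lemma trail_mono:
  assumes "- m \<le> s" "s \<le> t"
  shows "trail F m x s \<le> trail F m x t"
  using assms(2)
proof (induction t rule: int_ge_induct)
  case base
  then show ?case by simp
next
  case (step t)
  then show ?case using assms(1) step_ge[of "trail F m x t" F t] by (simp add: trail_step)
qed

lemma trail_cong:
  assumes "- m \<le> s" "s \<le> t" and "trail F m x s = trail F' m y s"
    and "\<And>r c. s \<le> r - c \<Longrightarrow> r - c < t \<Longrightarrow> (r, c) \<in> F \<longleftrightarrow> (r, c) \<in> F'"
  shows "trail F m x t = trail F' m y t"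
  using assms(2,4)
proof (induction t rule: int_ge_induct)
  case base
  then show ?case using assms by simp
next
  case (step t)
  then have "trail F m x t = trail F' m y t" by simp
  moreover have "step F t p = step F' t p" for p
    using step(1) step.prems[of "p div 2" "p div 2 - t"] by (simp add: step_def)
  ultimately show ?case using step(1) assms(1) by (simp add: trail_step)
qed

text \<open>Forwards, 0's let the path run straight. The converse uses that some path occupies the
  state at time s and that two paths never merge.\<close>

lemma trail_row:
  assumes "- m \<le> s" "s \<le> t" "\<And>u. s \<le> u \<Longrightarrow> u < t \<Longrightarrow> (r, r - u) \<notin> F"
  shows "trail F m x t = 2 * r + 1 \<longleftrightarrow> trail F m x s = 2 * r + 1"
proof -
  have fw: "trail F m y t = 2 * r + 1" if "trail F m y s = 2 * r + 1" for y
    using assms(2,3)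
  proof (induction t rule: int_ge_induct)
    case base
    then show ?case using that by simp
  next
    case (step t)
    then show ?case using assms(1) by (simp add: trail_step step_odd)
  qed
  obtain y where "trail F m y s = 2 * r + 1" using trail_surj assms(1) by blast
  then show ?thesis using fw trail_inj assms(1,2) by (metis order_trans)
qed

lemma trail_col:
  assumes "- m \<le> s" "s \<le> t" "\<And>u. s \<le> u \<Longrightarrow> u < t \<Longrightarrow> (c + u, c) \<notin> F"
  shows "trail F m x t = 2 * (c + t) \<longleftrightarrow> trail F m x s = 2 * (c + s)"
proof -
  have fw: "trail F m y t = 2 * (c + t)" if "trail F m y s = 2 * (c + s)" for y
    using assms(2,3)
  proof (induction t rule: int_ge_induct)
    case base
    then show ?case using that by simp
  next
    case (step t)
    then show ?case using assms(1) step_even[of F t "c + t"] by (simp add: trail_step)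
  qed
  obtain y where "trail F m y s = 2 * (c + s)" using trail_surj assms(1) by blast
  then show ?thesis using fw trail_inj assms(1,2) by (metis order_trans)
qed

text \<open>The device for comparing two fillings: a time-dependent map that commutes with single
  steps relates starts to ends through its values at the times -m and 0.\<close>

lemma trail_intertwine:
  assumes "\<And>t p. - m \<le> t \<Longrightarrow> t < 0 \<Longrightarrow> step F' t (\<phi> t p) = \<phi> (t + 1) (step F t p)"
    and "- m \<le> t" "t \<le> 0"
  shows "trail F' m (\<phi> (- m) x) t = \<phi> t (trail F m x t)"
  using assms(2,3) by (induction t rule: int_ge_induct) (auto simp: trail_step assms(1))

text \<open>This reflection keeps r - c, hence the time at which a box is entered, and exchanges
  \<open>from the left'' with\<close>from above''. A state p at time t becomes 2t + 1 - p, so the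
  order of the states is reversed, while the rule for 1's is carried to itself.\<close>

definition mirror :: "(int \<times> int) set \<Rightarrow> (int \<times> int) set" where
  "mirror F = {(r, c). (- c, - r) \<in> F}"

lemma mem_mirror [simp]: "(r, c) \<in> mirror F \<longleftrightarrow> (- c, - r) \<in> F"
  by (simp add: mirror_def)

lemma mirror_mirror [simp]: "mirror (mirror F) = F"
  by (auto simp: mirror_def)

lemma step_mirror: "step (mirror F) t (2 * t + 1 - p) = 2 * (t + 1) + 1 - step F t p"
proof (cases p rule: even_odd_cases)
  case (even r)
  have "2 * t + 1 - p = 2 * (t - r) + 1" using even by simp
  then have "step (mirror F) t (2 * t + 1 - p) =
      (if (r, r - t) \<in> F then 2 * (t - r) + 2 else 2 * (t - r) + 1)"
    by (simp only: step_odd) simp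
  then show ?thesis by (simp add: even step_even)
next
  case (odd r)
  have "2 * t + 1 - p = 2 * (t - r)" using odd by simp
  then have "step (mirror F) t (2 * t + 1 - p) =
      (if (r, r - t) \<in> F then 2 * (t - r) + 1 else 2 * (t - r) + 2)"
    by (simp only: step_even) simp
  then show ?thesis by (simp add: odd step_odd)
qed

lemma trail_mirror:
  assumes "- m \<le> t" "t \<le> 0"
  shows "trail (mirror F) m (1 - 2 * m - x) t = 2 * t + 1 - trail F m x t"
  using trail_intertwine[of m "mirror F" "\<lambda>t p. 2 * t + 1 - p" F, OF step_mirror assms]
  by (simp add: algebra_simps)

section \<open>Local changes of a filling: flipping one box, shifting the 1's of a row\<close>

lemma trail_toggle:
  assumes "\<And>b. b \<noteq> (r, c) \<Longrightarrow> b \<in> F' \<longleftrightarrow> b \<in> F" "(r, c) \<in> F' \<longleftrightarrow> (r, c) \<notin> F"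
    and m: "- m \<le> r - c" and PQ: "trail F m P (r - c) = 2 * r + 1" "trail F m Q (r - c) = 2 * r"
    and t: "r - c < t"
  shows "trail F' m x t = trail F m (transpose P Q x) t"
proof -
  have same: "trail F' m x (r - c) = trail F m x (r - c)"
    by (rule trail_cong[of m "- m"]) (use assms(1) m in auto)
  \<comment> \<open>One unit after the flipped box the two paths have taken each other's exit and
    all others are where they were; from then on the fillings agree.\<close>
  have s1: "trail F' m x (r - c + 1) = trail F m (transpose P Q x) (r - c + 1)"
  proof -
    have "step F' (r - c) p = step F (r - c) p" if "p \<noteq> 2 * r" "p \<noteq> 2 * r + 1" for p
    proof -
      have "p div 2 \<noteq> r" using that by (cases p rule: even_odd_cases) auto
      then show ?thesis using assms(1)[of "(p div 2, p div 2 - (r - c))"] by (simp add: step_def)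
    qed
    moreover have "step F' (r - c) (2 * r) = step F (r - c) (2 * r + 1)"
        "step F' (r - c) (2 * r + 1) = step F (r - c) (2 * r)"
      using assms(2) by (simp_all add: step_odd step_even)
    moreover have "trail F m x (r - c) \<noteq> 2 * r + 1" if "x \<noteq> P" using that PQ m trail_inj by metis
    moreover have "trail F m x (r - c) \<noteq> 2 * r" if "x \<noteq> Q" using that PQ m trail_inj by metis
    ultimately show ?thesis
      using PQ m same by (cases "x = P"; cases "x = Q") (auto simp: trail_step transpose_def)
  qed
  show ?thesis
    by (rule trail_cong[OF _ _ s1]) (use assms t in auto)
qed

text \<open>The correspondence between the states in two fillings that differ by moving the 1's of row
  \<open>a + 1\<close> to the empty row \<open>a\<close>. Paths that meet a moved 1 have passed it in row \<open>a\<close> before their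
  counterparts reach it in row \<open>a + 1\<close>, whence the 3-cycle.\<close>

definition slip :: "(int \<times> int) set \<Rightarrow> int \<Rightarrow> int \<Rightarrow> int \<Rightarrow> int" where
  "slip F a k p =
     (if (a + 1, k) \<in> F then
        (if p = 2 * a + 1 then 2 * a + 3 else if p = 2 * a + 3 then 2 * a + 2
         else if p = 2 * a + 2 then 2 * a + 1 else p)
      else transpose (2 * a + 1) (2 * a + 3) p)"

lemma row_state_cases:
  fixes p a :: int
  obtains "p = 2 * a" | "p = 2 * a + 1" | "p = 2 * a + 2" | "p = 2 * a + 3"
    | "p div 2 \<noteq> a" "p div 2 \<noteq> a + 1" "p \<noteq> 2 * a + 1" "p \<noteq> 2 * a + 2" "p \<noteq> 2 * a + 3"
proof -
  consider "p div 2 = a" | "p div 2 = a + 1" | "p div 2 \<noteq> a \<and> p div 2 \<noteq> a + 1" by blast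
  then show ?thesis
    by cases (use that in \<open>(cases p rule: even_odd_cases; auto)\<close>)+
qed

lemma step_other:
  assumes "p div 2 \<noteq> a" "p div 2 \<noteq> a + 1"
  shows "step F t p \<noteq> 2 * a + 1" "step F t p \<noteq> 2 * a + 2" "step F t p \<noteq> 2 * a + 3"
    "step F t p \<noteq> 2 * a + 4"
proof -
  have "(step F t p - 1) div 2 \<noteq> a" "(step F t p - 1) div 2 \<noteq> a + 1" using assms by (auto simp: step_div)
  then show "step F t p \<noteq> 2 * a + 1" "step F t p \<noteq> 2 * a + 2" "step F t p \<noteq> 2 * a + 3"
    "step F t p \<noteq> 2 * a + 4" by auto
qed

lemma step_rows:
  "step F t (2 * a) = (if (a, a - t) \<in> F then 2 * a + 1 else 2 * a + 2)"
  "step F t (2 * a + 1) = (if (a, a - t) \<in> F then 2 * a + 2 else 2 * a + 1)"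
  "step F t (2 * a + 2) = (if (a + 1, a + 1 - t) \<in> F then 2 * a + 3 else 2 * a + 4)"
  "step F t (2 * a + 3) = (if (a + 1, a + 1 - t) \<in> F then 2 * a + 4 else 2 * a + 3)"
  using step_odd[of F t a] step_even[of F t a] step_odd[of F t "a + 1"] step_even[of F t "a + 1"]
  by (simp_all add: algebra_simps)

lemma step_slip:
  assumes other: "\<And>r c. r \<noteq> a \<Longrightarrow> r \<noteq> a + 1 \<Longrightarrow> (r, c) \<in> F' \<longleftrightarrow> (r, c) \<in> F"
    and "(a, a - t) \<notin> F" "(a, a - t) \<in> F' \<longleftrightarrow> (a + 1, a - t) \<in> F" "(a + 1, a + 1 - t) \<notin> F'"
  shows "step F' t (slip F a (a + 1 - t) p) = slip F a (a - t) (step F t p)"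
proof (cases p a rule: row_state_cases)
  case 5
  then have "step F' t p = step F t p" using other by (simp add: step_def)
  then show ?thesis using 5 step_other[of p a F t] by (simp add: slip_def transpose_def)
qed (use assms(2-) in \<open>auto simp: slip_def transpose_def step_rows\<close>)

text \<open>Left of column x the 1's of row a + 1 slide up into row a, which is empty there; in
  column x a pair of 1's loses its lower member; to the right nothing changes. The sliding costs an
  exchange of the two starting states, and the lost 1 in column x prevents an exchange of the
  ends.\<close>

lemma trail_row_exchange:
  assumes other: "\<And>r c. r \<noteq> a \<Longrightarrow> r \<noteq> a + 1 \<Longrightarrow> (r, c) \<in> F' \<longleftrightarrow> (r, c) \<in> F"
    and left: "\<And>c. x < c \<Longrightarrow> (a, c) \<notin> F" "\<And>c. x < c \<Longrightarrow> (a, c) \<in> F' \<longleftrightarrow> (a + 1, c) \<in> F"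
      "\<And>c. x < c \<Longrightarrow> (a + 1, c) \<notin> F'"
    and right: "\<And>c. c < x \<Longrightarrow> (a, c) \<in> F' \<longleftrightarrow> (a, c) \<in> F"
      "\<And>c. c < x \<Longrightarrow> (a + 1, c) \<in> F' \<longleftrightarrow> (a + 1, c) \<in> F"
    and at: "(a, x) \<in> F" "(a + 1, x) \<in> F" "(a, x) \<in> F'" "(a + 1, x) \<notin> F'"
    and bound: "a + 1 < x" "x < a + 1 + m" "(a + 1, a + 1 + m) \<notin> F"
  shows "trail F' m (transpose (2 * a + 1) (2 * a + 3) s) 0 = trail F m s 0"
proof -
  \<comment> \<open>At time t row a + 1 is about to be entered in column a + 1 - t, whereas row a
    has passed this column one unit earlier. In the intermediate case the box (a, x) lies behind and
    (a + 1, x) ahead, and the two inputs of the latter are exchanged, which makes up for its missing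
    1.\<close>
  define \<phi> where "\<phi> = (\<lambda>t p. if x < a + 1 - t then slip F a (a + 1 - t) p
      else if x = a + 1 - t then transpose (2 * a + 2) (2 * a + 3) p else p)"
  have "step F' t (\<phi> t p) = \<phi> (t + 1) (step F t p)" for t p
  proof -
    consider "x < a - t" | "x = a - t" | "x = a + 1 - t" | "a + 1 - t < x" by linarith
    then show ?thesis
    proof cases
      case 1
      then show ?thesis using step_slip[of a F' F t p] other left by (simp add: \<phi>_def)
    next
      case 2
      then have "(a, a - t) \<in> F" "(a, a - t) \<in> F'" "(a + 1, a + 1 - t) \<notin> F'" using at left by auto
      then show ?thesis
      proof (cases p a rule: row_state_cases)
        case 5
        then have "step F' t p = step F t p" using other by (simp add: step_def)
        then show ?thesis using 2 5 step_other[of p a F t] by (simp add: \<phi>_def slip_def transpose_def)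
      qed (use 2 in \<open>auto simp: \<phi>_def slip_def transpose_def step_rows\<close>)
    next
      case 3
      then have "(a, a - t) \<in> F' \<longleftrightarrow> (a, a - t) \<in> F" "(a + 1, a + 1 - t) \<notin> F'" "(a + 1, a + 1 - t) \<in> F"
        using at right by auto
      then show ?thesis
      proof (cases p a rule: row_state_cases)
        case 5
        then have "step F' t p = step F t p" using other by (simp add: step_def)
        then show ?thesis using 3 5 by (simp add: \<phi>_def transpose_def)
      qed (use 3 in \<open>auto simp: \<phi>_def transpose_def step_rows\<close>)
    next
      case 4
      then have "(a, a - t) \<in> F' \<longleftrightarrow> (a, a - t) \<in> F" "(a + 1, a + 1 - t) \<in> F' \<longleftrightarrow> (a + 1, a + 1 - t) \<in> F"
        using right by auto
      then have "step F' t p = step F t p"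
      proof (cases p a rule: row_state_cases)
        case 5
        then show ?thesis using other by (simp add: step_def)
      qed (auto simp: step_rows)
      then show ?thesis using 4 by (simp add: \<phi>_def)
    qed
  qed
  moreover have "\<phi> (- m) s = transpose (2 * a + 1) (2 * a + 3) s" for s
    using bound by (simp add: \<phi>_def slip_def)
  moreover have "\<phi> 0 p = p" for p using bound by (simp add: \<phi>_def)
  moreover have "0 \<le> m" using bound by linarith
  ultimately show ?thesis using trail_intertwine[of m F' \<phi> F 0 s] by simp
qed

text \<open>The same sliding without a column where it stops: the correspondence lasts until time 0,
  where it is a transposition since the box (a + 1, a + 1) contains no 1. Starts and ends of the two
  rows are both exchanged, as in a mere relabeling.\<close>

lemma trail_empty_row_exchange:
  assumes other: "\<And>r c. r \<noteq> a \<Longrightarrow> r \<noteq> a + 1 \<Longrightarrow> (r, c) \<in> F' \<longleftrightarrow> (r, c) \<in> F"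
    and "\<And>c. (a, c) \<notin> F" "\<And>c. (a, c) \<in> F' \<longleftrightarrow> (a + 1, c) \<in> F" "\<And>c. (a + 1, c) \<notin> F'"
    and "(a + 1, a + 1) \<notin> F" "(a + 1, a + 1 + m) \<notin> F" "0 \<le> m"
  shows "trail F' m (transpose (2 * a + 1) (2 * a + 3) s) 0
    = transpose (2 * a + 1) (2 * a + 3) (trail F m s 0)"
proof -
  have "step F' t (slip F a (a + 1 - t) p) = slip F a (a + 1 - (t + 1)) (step F t p)" for t p
    using step_slip[of a F' F t p] assms by simp
  then have "trail F' m (slip F a (a + 1 - - m) s) 0 = slip F a (a + 1 - 0) (trail F m s 0)"
    using trail_intertwine[of m F' "\<lambda>t. slip F a (a + 1 - t)" F 0 s] assms(7) by simp
  then show ?thesis using assms(5,6) by (simp add: slip_def)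
qed

section \<open>Crossing paths\<close>

text \<open>A 1 in (r, c) is entered at time r - c, so the bounds say that all 1's lie strictly
  between the times -m and 0. Which positions are boxes of a diagram does not matter to the paths,
  so the shape is left out.\<close>

definition filling :: "int \<Rightarrow> (int \<times> int) set \<Rightarrow> bool" where
  "filling m F \<longleftrightarrow> (\<forall>r c. (r, c) \<in> F \<longrightarrow> r < c \<and> c - r < m) \<and>
     (\<forall>r c r' c'. r < c \<longrightarrow> (r', c) \<in> F \<longrightarrow> r' < r \<longrightarrow> (r, c') \<in> F \<longrightarrow> c < c' \<longrightarrow> (r, c) \<in> F)"

lemma filling_bounds: "filling m F \<Longrightarrow> (r, c) \<in> F \<Longrightarrow> r < c \<and> c - r < m"
  by (auto simp: filling_def)

lemma filling_corner:
  "filling m F \<Longrightarrow> r < c \<Longrightarrow> (r', c) \<in> F \<Longrightarrow> r' < r \<Longrightarrow> (r, c') \<in> F \<Longrightarrow> c < c' \<Longrightarrow> (r, c) \<in> F"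
  unfolding filling_def by blast

lemma fillingI:
  assumes "\<And>r c. (r, c) \<in> F \<Longrightarrow> r < c" "\<And>r c. (r, c) \<in> F \<Longrightarrow> c - r < m"
    and "\<And>r c r' c'. r < c \<Longrightarrow> (r', c) \<in> F \<Longrightarrow> r' < r \<Longrightarrow> (r, c') \<in> F \<Longrightarrow> c < c' \<Longrightarrow> (r, c) \<in> F"
  shows "filling m F"
  unfolding filling_def using assms by blast

lemma filling_mirror:
  assumes "filling m F"
  shows "filling m (mirror F)"
proof (rule fillingI)
  fix r c r' c'
  assume "r < c" "(r', c) \<in> mirror F" "r' < r" "(r, c') \<in> mirror F" "c < c'"
  then show "(r, c) \<in> mirror F"
    using filling_corner[OF assms, of "- c" "- r" "- c'" "- r'"] by simp
qed (use filling_bounds[OF assms] in force)+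

lemma trail_growth:
  assumes "- m \<le> s" "s \<le> t"
  shows "trail F m x t \<le> trail F m x s + 2 * (t - s)"
  using assms(2)
proof (induction t rule: int_ge_induct)
  case base
  then show ?case by simp
next
  case (step t)
  moreover have "step F t p \<le> p + 2" for p by (simp add: step_def)
  ultimately show ?case using assms(1) by (simp add: trail_step) (smt (verit))
qed

context
  fixes m :: int and F :: "(int \<times> int) set"
  assumes F: "filling m F"
begin

text \<open>A box containing 0 has no 1 to its left or no 1 above it, so that one of the two paths
  crossing there has been straight so far.\<close>

lemma cross_straight:
  assumes t: "- m \<le> t" "t < 0" and "trail F m P t = 2 * r + 1" "trail F m Q t = 2 * r"
    and zero: "(r, r - t) \<notin> F"
  shows "(\<forall>u. - m \<le> u \<longrightarrow> u \<le> t \<longrightarrow> trail F m P u = 2 * r + 1) \<or>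
    (\<forall>u. - m \<le> u \<longrightarrow> u \<le> t \<longrightarrow> trail F m Q u = 2 * (r - t + u))"
proof (cases "\<exists>c'>r - t. (r, c') \<in> F")
  case False
  then have "(r, r - v) \<notin> F" if "v < t" for v using that by auto
  then show ?thesis using assms trail_row[of m _ t r F P] by blast
next
  case True
  then have "(r', r - t) \<notin> F" if "r' < r" for r'
    using that zero filling_corner[OF F, of r "r - t"] t(2) by auto
  then have "(r - t + v, r - t) \<notin> F" if "v < t" for v using that by auto
  then show ?thesis using assms trail_col[of m _ t "r - t" F Q] by force
qed

text \<open>By \<open>cross_straight\<close> one of the two paths has not turned so far. At an
  earlier meeting it would already have crossed the other. If the row path is straight, the other is
  then too far down, and states never decrease; if the column path is straight, the other is too far
  up, and states grow by at most 2 per unit of time.\<close>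

lemma cross_first:
  assumes t: "- m \<le> t" "t < 0" and PQ: "trail F m P t = 2 * r + 1" "trail F m Q t = 2 * r"
    and zero: "(r, r - t) \<notin> F" and u: "- m \<le> u" "u < t"
  shows "trail F m P u div 2 \<noteq> trail F m Q u div 2"
proof
  assume meet: "trail F m P u div 2 = trail F m Q u div 2"
  have "P \<noteq> Q" using PQ by auto
  then have ne: "trail F m P u \<noteq> trail F m Q u" using u trail_inj by simp
  from cross_straight[OF t PQ zero] show False
  proof
    assume *: "\<forall>u. - m \<le> u \<longrightarrow> u \<le> t \<longrightarrow> trail F m P u = 2 * r + 1"
    then have P: "trail F m P u = 2 * r + 1" "trail F m P (u + 1) = 2 * r + 1" using u by auto
    then have "(r, r - u) \<notin> F" using u by (auto simp: trail_step step_odd split: if_splits)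
    moreover have "trail F m Q u = 2 * r" using meet ne P(1) by presburger
    ultimately have "trail F m Q (u + 1) = 2 * r + 2" using u by (simp add: trail_step step_even)
    then show False using trail_mono[of m "u + 1" t F Q] u PQ by simp
  next
    assume *: "\<forall>u. - m \<le> u \<longrightarrow> u \<le> t \<longrightarrow> trail F m Q u = 2 * (r - t + u)"
    define s where "s = r - t + u"
    have Q: "trail F m Q u = 2 * s" "trail F m Q (u + 1) = 2 * s + 2" using u * by (auto simp: s_def)
    then have "(s, s - u) \<notin> F" using u by (auto simp: trail_step step_even split: if_splits)
    moreover have "trail F m P u = 2 * s + 1" using meet ne Q(1) by presburger
    ultimately have "trail F m P (u + 1) = 2 * s + 1" using u by (simp add: trail_step step_odd)
    then show False using trail_growth[of m "u + 1" t F P] u PQ by (simp add: s_def)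
  qed
qed

text \<open>A later reversal would be a crossing, which \<open>cross_first\<close> forbids after a
  meeting.\<close>

lemma order_after_meeting:
  assumes u: "- m \<le> u" and meet: "trail F m P u div 2 = trail F m Q u div 2"
    and less: "trail F m P (u + 1) < trail F m Q (u + 1)" and t: "u < t" "t \<le> 0"
  shows "trail F m P t < trail F m Q t"
proof -
  have "u + 1 \<le> t" using t by simp
  then show ?thesis using \<open>t \<le> 0\<close>
  proof (induction t rule: int_ge_induct)
    case base
    then show ?case using less by simp
  next
    case (step t)
    then have lt: "trail F m P t < trail F m Q t" by simp
    have "\<not> (trail F m P t div 2 = trail F m Q t div 2 \<and> (trail F m P t div 2, trail F m P t div 2 - t) \<notin> F)"
    proof
      assume *: "trail F m P t div 2 = trail F m Q t div 2 \<and> (trail F m P t div 2, trail F m P t div 2 - t) \<notin> F"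
      define r where "r = trail F m P t div 2"
      have "trail F m Q t = 2 * r + 1" "trail F m P t = 2 * r" using lt conjunct1[OF *] unfolding r_def by presburger+
      then show False using cross_first[of t Q r P u] * step u meet unfolding r_def by simp
    qed
    then show ?case using step u by (simp add: trail_step step_mono)
  qed
qed

text \<open>A crossing is the only change in the order of two paths, so their starts and ends are
  ordered oppositely. This is how a 0 can be detected from the ends.\<close>

lemma cross_order:
  assumes t: "- m \<le> t" "t < 0" and PQ: "trail F m P t = 2 * r + 1" "trail F m Q t = 2 * r"
    and zero: "(r, r - t) \<notin> F"
  shows "Q < P" "trail F m P 0 < trail F m Q 0"
proof -
  have "trail F m P (t + 1) < trail F m Q (t + 1)" using assms by (simp add: trail_step step_odd step_even)
  then show "trail F m P 0 < trail F m Q 0" using order_after_meeting[of t P Q 0] PQ t by simp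
  have "P \<noteq> Q" using PQ by auto
  moreover have "\<not> P < Q"
  proof
    assume "P < Q"
    have "trail F m P u < trail F m Q u" if "- m \<le> u" "u \<le> t" for u
      using that
    proof (induction u rule: int_ge_induct)
      case base
      then show ?case using \<open>P < Q\<close> by simp
    next
      case (step u)
      then have "trail F m P u div 2 \<noteq> trail F m Q u div 2" using cross_first[OF assms] by simp
      then show ?case using step by (simp add: trail_step step_mono)
    qed
    then show False using t PQ by force
  qed
  ultimately show "Q < P" by simp
qed

end

text \<open>Since the fillings agree before time t, the same two paths enter the box in both of
  them. A 1 makes them touch and a 0 makes them cross, and each outcome fixes the order of the ends,
  in opposite ways.\<close>

lemma filling_le_if_same_ends:
  assumes F: "filling m F" and F': "filling m F'" and t: "- m \<le> t" "t < 0"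
    and ends: "\<And>x. trail F m x 0 = trail F' m x 0"
    and same: "\<And>r c. r - c < t \<Longrightarrow> (r, c) \<in> F \<longleftrightarrow> (r, c) \<in> F'"
    and "(r, r - t) \<in> F"
  shows "(r, r - t) \<in> F'"
proof (rule ccontr)
  assume zero: "(r, r - t) \<notin> F'"
  obtain P Q where PQ: "trail F m P t = 2 * r + 1" "trail F m Q t = 2 * r"
    using trail_surj t by metis
  have "trail F m x t = trail F' m x t" for x
    by (rule trail_cong[of m "- m"]) (use same t in auto)
  then have "trail F' m P 0 < trail F' m Q 0"
    using cross_order(2)[OF F' t, of P r Q] zero PQ by simp
  moreover have "trail F m Q 0 < trail F m P 0"
    using order_after_meeting[OF F, of t Q P 0] PQ t assms(7) by (simp add: trail_step step_odd step_even)
  ultimately show False using ends by force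
qed

text \<open>The ends of all paths determine a filling: in the order of time, a pair of paths crosses at
  its first meeting if its ends require this, and does not cross later.\<close>

lemma filling_eqI:
  assumes F: "filling m F" and F': "filling m F'"
    and ends: "\<And>x. trail F m x 0 = trail F' m x 0"
  shows "F = F'"
proof -
  have agree: "t \<le> 0 \<longrightarrow> (\<forall>r c. r - c < t \<longrightarrow> ((r, c) \<in> F \<longleftrightarrow> (r, c) \<in> F'))" if "- m \<le> t" for t
    using that
  proof (induction t rule: int_ge_induct)
    case base
    then show ?case using filling_bounds[OF F] filling_bounds[OF F'] by force
  next
    case (step t)
    show ?case
    proof (intro impI allI)
      fix r c assume *: "t + 1 \<le> 0" "r - c < t + 1"
      show "(r, c) \<in> F \<longleftrightarrow> (r, c) \<in> F'"
      proof (cases "r - c = t")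
        case True
        then have "c = r - t" by simp
        then show ?thesis
          using filling_le_if_same_ends[OF F F', of t r] filling_le_if_same_ends[OF F' F, of t r]
            step * ends by auto
      next
        case False
        then show ?thesis using step * by simp
      qed
    qed
  qed
  have "(r, c) \<in> F \<longleftrightarrow> (r, c) \<in> F'" for r c
  proof (cases "0 \<le> m \<and> r < c")
    case True
    then show ?thesis using agree[of 0] by simp
  next
    case False
    then show ?thesis using filling_bounds[OF F] filling_bounds[OF F'] by force
  qed
  then show ?thesis by auto
qed

section \<open>Starts of rows and columns; the replacement rules as exchanges of two starts\<close>

definition row_in :: "int \<Rightarrow> int" where
  "row_in r = 2 * r + 1"

text \<open>At time -m a path in column c is in row c - m. A path running along row r keeps the
  state 2r + 1, so only the start of a column depends on m.\<close>

definition col_start_state :: "int \<Rightarrow> int \<Rightarrow> int" where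
  "col_start_state m c = 2 * (c - m)"

lemma first_meeting_rows:
  assumes F: "filling m F" and "(a, x) \<in> F" "\<And>c. x < c \<Longrightarrow> (a, c) \<notin> F" "\<And>c. x < c \<Longrightarrow> (a + 1, c) \<notin> F"
  shows "trail F m (row_in a) (a + 1 - x) = 2 * (a + 1)"
    and "trail F m (row_in (a + 1)) (a + 1 - x) = 2 * (a + 1) + 1"
proof -
  have b: "x - a < m" using filling_bounds[OF F assms(2)] by simp
  show "trail F m (row_in (a + 1)) (a + 1 - x) = 2 * (a + 1) + 1"
    using trail_row[of m "- m" "a + 1 - x" "a + 1" F "row_in (a + 1)"] assms(4) b
    by (simp add: row_in_def)
  have "trail F m (row_in a) (a - x) = 2 * a + 1"
    using trail_row[of m "- m" "a - x" a F "row_in a"] assms(3) b by (simp add: row_in_def)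
  then have "trail F m (row_in a) (a - x + 1) = 2 * a + 2"
    using b assms(2) by (simp add: trail_step step_odd)
  then show "trail F m (row_in a) (a + 1 - x) = 2 * (a + 1)" by (simp add: algebra_simps)
qed

text \<open>The path from row a turns into column x at its first 1 and meets the path from row a +
  1, which is still straight, in (a + 1, x). The 0 there is a crossing.\<close>

lemma rows_cross:
  assumes F: "filling m F" and x: "(a, x) \<in> F" "\<And>c. x < c \<Longrightarrow> (a, c) \<notin> F" "\<And>c. x \<le> c \<Longrightarrow> (a + 1, c) \<notin> F"
    and "a + 1 < x"
  shows "trail F m (row_in (a + 1)) 0 < trail F m (row_in a) 0"
proof -
  have "\<And>c. x < c \<Longrightarrow> (a + 1, c) \<notin> F" using x(3) by simp
  note meet = first_meeting_rows[OF F x(1,2) this]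
  show ?thesis
    using cross_order(2)[OF F _ _ meet(2,1)] filling_bounds[OF F x(1)] x(3)[of x] assms(5) by simp
qed

lemma mem_replace_rows:
  "(r, c) \<in> replace_rows a x y F \<longleftrightarrow>
    (if r = a \<and> x \<le> c \<and> c \<le> y then (a, c) \<in> F \<or> (a + 1, c) \<in> F
     else (r, c) \<in> F \<and> \<not> (r = a + 1 \<and> x \<le> c \<and> c \<le> y))"
  by (auto simp: replace_rows_def)

lemma mem_replace_cols:
  "(r, c) \<in> replace_cols j x y F \<longleftrightarrow>
    (if c = j + 1 \<and> x \<le> r \<and> r \<le> y then (r, j + 1) \<in> F \<or> (r, j) \<in> F
     else (r, c) \<in> F \<and> \<not> (c = j \<and> x \<le> r \<and> r \<le> y))"
  by (auto simp: replace_cols_def)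

text \<open>For x < y this is the rectangle rule, for x = y the deletion of a 1 at which two paths
  meet. The lower 1 in column x is absorbed by the upper one and those further left move up, which
  is the situation of \<open>trail_row_exchange\<close>.\<close>

lemma replace_rows_exchange:
  assumes F: "filling m F" and "x \<le> y" "(a, x) \<in> F" "(a + 1, x) \<in> F" "(a + 1, y) \<in> F"
    and upper: "\<And>c. x < c \<Longrightarrow> (a, c) \<notin> F" and lower: "\<And>c. y < c \<Longrightarrow> (a + 1, c) \<notin> F"
    and bound: "y - a < m"
  shows "trail (replace_rows a x y F) m
      (transpose (row_in a) (row_in (a + 1)) s) 0 = trail F m s 0" (is ?ends)
    and "filling m (replace_rows a x y F)" (is ?fill)
proof -
  define F' where "F' = replace_rows a x y F"
  note mem = mem_replace_rows[of _ _ a x y F, folded F'_def]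
  have x: "a + 1 < x" "x - a < m"
    using filling_bounds[OF F assms(3)] filling_bounds[OF F assms(4)] by auto
  have "trail F' m (transpose (2 * a + 1) (2 * a + 3) s) 0 = trail F m s 0"
  proof (rule trail_row_exchange[where x = x])
    show "(a + 1, a + 1 + m) \<notin> F" using filling_bounds[OF F, of "a + 1" "a + 1 + m"] by auto
    show "(a, c) \<in> F' \<longleftrightarrow> (a + 1, c) \<in> F" if "x < c" for c
      using that upper lower[of c] by (auto simp: mem not_le)
    show "(a + 1, c) \<notin> F'" if "x < c" for c
      using that lower[of c] by (auto simp: mem not_le)
  qed (use assms x in \<open>auto simp: mem\<close>)
  moreover have upper_state: "row_in (a + 1) = 2 * a + 3" by (simp add: row_in_def)
  ultimately show ?ends unfolding F'_def upper_state row_in_def[of a] by blast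
  have "filling m F'"
  proof (rule fillingI)
    fix r c r' c'
    assume *: "r < c" "(r', c) \<in> F'" "r' < r" "(r, c') \<in> F'" "c < c'"
    show "(r, c) \<in> F'"
    proof (cases "r = a \<or> r = a + 1")
      case False
      then have "(r, c') \<in> F" using * mem by auto
      moreover have "\<exists>s<r. (s, c) \<in> F"
      proof (cases "(r', c) \<in> F")
        case False
        then have "(a + 1, c) \<in> F" "r' = a" using *(2) by (auto simp: mem split: if_splits)
        moreover have "a + 1 < r" using \<open>r' = a\<close> *(3) \<open>\<not> (r = a \<or> r = a + 1)\<close> by simp
        ultimately show ?thesis by blast
      qed (use *(3) in blast)
      ultimately show ?thesis using filling_corner[OF F *(1)] *(5) False by (auto simp: mem)
    next
      case True
      then show ?thesis
      proof
        assume r: "r = a"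
        then have rc: "(r', c) \<in> F" using * by (simp add: mem)
        have c': "c' \<le> y"
        proof (rule ccontr)
          assume "\<not> c' \<le> y"
          then show False using *(4) r upper[of c'] \<open>x \<le> y\<close> by (simp add: mem)
        qed
        show ?thesis
        proof (cases "x \<le> c")
          case True
          then have "c < y" using c' * by simp
          \<comment> \<open>In the old filling the corner rule applies to row a + 1, with the 1 in
            column y to the left; the replacement lifts the resulting 1 to row a.\<close>
          then have "(a + 1, c) \<in> F"
            using filling_corner[OF F, of "a + 1" c r' y] rc * r True x assms(5) by simp
          then show ?thesis using True \<open>c < y\<close> r by (simp add: mem)
        next
          case False
          then have "(a, c) \<in> F" using filling_corner[OF F, of a c r' x] rc * r assms(3) by simp
          then show ?thesis using r by (simp add: mem)
        qed
      next
        assume r: "r = a + 1"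
        then have "c' < x" using *(4) lower[of c'] by (cases "y < c'") (auto simp: mem)
        then have "(r', c) \<in> F" "(a + 1, c') \<in> F" using * r by (auto simp: mem split: if_splits)
        then have "(a + 1, c) \<in> F" using filling_corner[OF F, of "a + 1" c r' c'] * r by simp
        then show ?thesis using \<open>c' < x\<close> * r by (simp add: mem)
      qed
    qed
  next
    fix r c
    assume *: "(r, c) \<in> F'"
    have "r < c \<and> c - r < m"
    proof (cases "(r, c) \<in> F")
      case False
      then have "r = a" "x \<le> c" "c \<le> y" using * by (auto simp: mem split: if_splits)
      then show ?thesis using x bound by simp
    qed (rule filling_bounds[OF F])
    then show "r < c" "c - r < m" by auto
  qed
  then show ?fill by (simp add: F'_def)
qed

text \<open>The left column j + 1 becomes the upper row -(j + 1) and the right column j the lower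
  row -j; the rows from x to y become the columns from -y to -x. All statements on pairs of columns
  are obtained in this way.\<close>

lemma replace_cols_mirror:
  "replace_cols j x y F = mirror (replace_rows (- (j + 1)) (- y) (- x) (mirror F))"
proof -
  have "(r, c) \<in> replace_cols j x y F \<longleftrightarrow>
      (r, c) \<in> mirror (replace_rows (- (j + 1)) (- y) (- x) (mirror F))" for r c
    by (auto simp: mem_replace_rows mem_replace_cols add.commute)
  then show ?thesis by auto
qed

lemma trail_mirror_end:
  assumes "0 \<le> m"
  shows "trail (mirror F) m (row_in (- c)) 0 = 1 - trail F m (col_start_state m c) 0"
    and "trail (mirror F) m (col_start_state m (- r)) 0 = 1 - trail F m (row_in r) 0"
proof -
  have "1 - 2 * m - col_start_state m c = row_in (- c)"
    "1 - 2 * m - row_in r = col_start_state m (- r)"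
    by (simp_all add: row_in_def col_start_state_def)
  then show "trail (mirror F) m (row_in (- c)) 0 = 1 - trail F m (col_start_state m c) 0"
    "trail (mirror F) m (col_start_state m (- r)) 0 = 1 - trail F m (row_in r) 0"
    using trail_mirror[of m 0 F "col_start_state m c"] trail_mirror[of m 0 F "row_in r"] assms
    by simp_all
qed

lemma replace_cols_exchange:
  assumes F: "filling m F" and "x \<le> y" "(x, j) \<in> F" "(y, j) \<in> F" "(y, j + 1) \<in> F"
    and right: "\<And>r. r < x \<Longrightarrow> (r, j) \<notin> F" and left: "\<And>r. r < y \<Longrightarrow> (r, j + 1) \<notin> F"
    and bound: "j + 1 - x < m"
  shows "trail (replace_cols j x y F) m
      (transpose (col_start_state m j) (col_start_state m (j + 1)) s) 0 = trail F m s 0" (is ?ends)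
    and "filling m (replace_cols j x y F)" (is ?fill)
proof -
  have m: "0 \<le> m" using filling_bounds[OF F assms(3)] by simp
  define F' where "F' = replace_rows (- (j + 1)) (- y) (- x) (mirror F)"
  note ex = replace_rows_exchange[OF filling_mirror[OF F], of "- y" "- x" "- (j + 1)"]
  have *: "trail F' m (transpose (row_in (- (j + 1))) (row_in (- (j + 1) + 1)) s') 0
      = trail (mirror F) m s' 0" for s'
    unfolding F'_def by (rule ex(1)) (use assms in \<open>auto simp: add.commute\<close>)
  have fill: "filling m F'"
    unfolding F'_def by (rule ex(2)) (use assms in \<open>auto simp: add.commute\<close>)
  have eq: "1 - 2 * m - transpose (col_start_state m j) (col_start_state m (j + 1)) s =
      transpose (row_in (- (j + 1))) (row_in (- (j + 1) + 1)) (1 - 2 * m - s)"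
    by (auto simp: transpose_def row_in_def col_start_state_def)
  have "trail (mirror F') m (transpose (col_start_state m j) (col_start_state m (j + 1)) s) 0
      = 1 - trail F' m (1 - 2 * m - transpose (col_start_state m j) (col_start_state m (j + 1)) s) 0"
    using trail_mirror[of m 0 "mirror F'" "transpose (col_start_state m j) (col_start_state m (j + 1)) s"] m by simp
  also have "\<dots> = 1 - trail (mirror F) m (1 - 2 * m - s) 0" by (simp only: eq *)
  also have "\<dots> = trail F m s 0" using trail_mirror[of m 0 F s] m by simp
  finally show ?ends by (simp add: F'_def replace_cols_mirror)
  show ?fill using filling_mirror[OF fill] by (simp add: F'_def replace_cols_mirror)
qed

lemma cols_cross:
  assumes F: "filling m F" and "(y, j + 1) \<in> F" "\<And>r. r < y \<Longrightarrow> (r, j + 1) \<notin> F" "\<And>r. r \<le> y \<Longrightarrow> (r, j) \<notin> F"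
    and "y < j"
  shows "trail F m (col_start_state m (j + 1)) 0 < trail F m (col_start_state m j) 0"
proof -
  have m: "0 \<le> m" using filling_bounds[OF F assms(2)] by simp
  have "trail (mirror F) m (row_in (- (j + 1) + 1)) 0 < trail (mirror F) m (row_in (- (j + 1))) 0"
    by (rule rows_cross[OF filling_mirror[OF F], of _ "- y"]) (use assms in \<open>auto simp: add.commute\<close>)
  then show ?thesis using trail_mirror_end(1)[OF m, of F j] trail_mirror_end(1)[OF m, of F "j + 1"] by simp
qed

section \<open>Zigzag paths\<close>

text \<open>A heading names the box just left; the time and the state belong to the box entered
  next, whence the shifts by one.\<close>

fun heading_time :: "heading \<Rightarrow> int" where
  "heading_time (East r c) = r - c + 1"
| "heading_time (South r c) = r + 1 - c"

fun heading_state :: "heading \<Rightarrow> int" where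
  "heading_state (East r c) = 2 * r + 1"
| "heading_state (South r c) = 2 * (r + 1)"

text \<open>Between two turns the trail is straight by \<open>trail_row\<close> and
  \<open>trail_col\<close>, which gives its position at every time, so the 1's it visits are exactly
  the turns of the zigzag path. The end can be read off at time 0 because every 1 satisfies r <
  c.\<close>

lemma zigzag_trail:
  assumes "zigzag F h bs e" and F: "\<And>r c. (r, c) \<in> F \<Longrightarrow> r < c"
    and "- m \<le> heading_time h" "heading_time h \<le> 0" "trail F m x (heading_time h) = heading_state h"
  shows "e = trail F m x 0 div 2 \<and>
    (\<forall>r c. (r, c) \<in> set bs \<longleftrightarrow>
       (r, c) \<in> F \<and> heading_time h \<le> r - c \<and> trail F m x (r - c) div 2 = r)"
  using assms(1,3-)
proof (induction rule: zigzag.induct)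
  case (row_end c r)
  have *: "trail F m x t = 2 * r + 1" if "r - c + 1 \<le> t" for t
    using trail_row[of m "r - c + 1" t r F x] row_end that by simp
  have "False" if "(r', c') \<in> F" "r - c + 1 \<le> r' - c'" "trail F m x (r' - c') div 2 = r'" for r' c'
    using *[OF that(2)] that row_end(1)[of c'] by simp
  then show ?case using *[of 0] row_end by auto
next
  case (row_turn c' c r bs e)
  have *: "trail F m x t = 2 * r + 1" if "r - c + 1 \<le> t" "t \<le> r - c'" for t
    using trail_row[of m "r - c + 1" t r F x] row_turn that by simp
  have turn: "trail F m x (r + 1 - c') = 2 * (r + 1)"
  proof -
    have "trail F m x (r - c' + 1) = 2 * r + 2"
      using *[of "r - c'"] trail_step[of m "r - c'" F x] row_turn by (simp add: step_odd)
    moreover have "r - c' + 1 = r + 1 - c'" by simp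
    ultimately show ?thesis by simp
  qed
  have IH: "e = trail F m x 0 div 2 \<and>
    (\<forall>p q. (p, q) \<in> set bs \<longleftrightarrow> (p, q) \<in> F \<and> r + 1 - c' \<le> p - q \<and> trail F m x (p - q) div 2 = p)"
    using row_turn.IH row_turn.prems row_turn.hyps F[of r c'] turn by simp
  have "(p, q) = (r, c') \<or> r + 1 - c' \<le> p - q"
    if "(p, q) \<in> F" "r - c + 1 \<le> p - q" "trail F m x (p - q) div 2 = p" for p q
    using *[OF that(2)] that row_turn.hyps(3)[of q] by fastforce
  moreover have "trail F m x (r - c') div 2 = r" using *[of "r - c'"] row_turn.hyps by simp
  ultimately show ?case using IH row_turn.hyps by auto
next
  case (col_end r c)
  have *: "trail F m x t = 2 * (c + t)" if "r + 1 - c \<le> t" for t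
    using trail_col[of m "r + 1 - c" t c F x] col_end that by simp
  have "False" if "(r', c') \<in> F" "r + 1 - c \<le> r' - c'" "trail F m x (r' - c') div 2 = r'" for r' c'
    using *[OF that(2)] that col_end(1)[of r'] by simp
  then show ?case using *[of 0] col_end by auto
next
  case (col_turn r' r c bs e)
  have *: "trail F m x t = 2 * (c + t)" if "r + 1 - c \<le> t" "t \<le> r' - c" for t
    using trail_col[of m "r + 1 - c" t c F x] col_turn that by simp
  have turn: "trail F m x (r' - c + 1) = 2 * r' + 1"
    using *[of "r' - c"] trail_step[of m "r' - c" F x] col_turn
    by (simp add: step_even)
  have IH: "e = trail F m x 0 div 2 \<and>
    (\<forall>p q. (p, q) \<in> set bs \<longleftrightarrow> (p, q) \<in> F \<and> r' - c + 1 \<le> p - q \<and> trail F m x (p - q) div 2 = p)"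
    using col_turn.IH col_turn.prems col_turn.hyps F[of r' c] turn by simp
  have "(p, q) = (r', c) \<or> r' - c + 1 \<le> p - q"
    if "(p, q) \<in> F" "r + 1 - c \<le> p - q" "trail F m x (p - q) div 2 = p" for p q
  proof (cases "p - q < r' - c")
    case True
    then have "q = c" using *[OF that(2)] that(3) by simp
    then show ?thesis using that True col_turn.hyps(3)[of p] by simp
  next
    case False
    then show ?thesis using *[OF that(2)] that by fastforce
  qed
  moreover have "trail F m x (r' - c) div 2 = r'" using *[of "r' - c"] col_turn.hyps by simp
  ultimately show ?case using IH col_turn.hyps by auto
qed

lemma first_in_row:
  fixes F :: "(int \<times> int) set"
  assumes "\<And>r c. (r, c) \<in> F \<Longrightarrow> r < c" "c' < c" "(r, c') \<in> F"
  obtains c'' where "c'' < c" "(r, c'') \<in> F" "\<And>x. c'' < x \<Longrightarrow> x < c \<Longrightarrow> (r, x) \<notin> F"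
proof -
  let ?S = "{x. x < c \<and> (r, x) \<in> F}"
  have "?S \<subseteq> {r<..<c}" using assms(1) by auto
  then have S: "finite ?S" "?S \<noteq> {}" using assms finite_subset[of ?S "{r<..<c}"] by auto
  obtain M where M: "M = Max ?S" by simp
  have "M \<in> ?S" using Max_in[OF S] unfolding M .
  moreover have "x \<notin> ?S" if "M < x" for x
    using Max_ge[OF S(1), of x] that unfolding M by linarith
  ultimately show ?thesis by (intro that[of M]) auto
qed

lemma first_in_col:
  fixes F :: "(int \<times> int) set"
  assumes "\<And>r c. (r, c) \<in> F \<Longrightarrow> r < c" "r < r'" "(r', c) \<in> F"
  obtains r'' where "r < r''" "(r'', c) \<in> F" "\<And>x. r < x \<Longrightarrow> x < r'' \<Longrightarrow> (x, c) \<notin> F"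
proof -
  let ?S = "{x. r < x \<and> (x, c) \<in> F}"
  have "?S \<subseteq> {r<..<c}" using assms(1) by auto
  then have S: "finite ?S" "?S \<noteq> {}" using assms finite_subset[of ?S "{r<..<c}"] by auto
  obtain M where M: "M = Min ?S" by simp
  have "M \<in> ?S" using Min_in[OF S] unfolding M .
  moreover have "x \<notin> ?S" if "x < M" for x
    using Min_le[OF S(1), of x] that unfolding M by linarith
  ultimately show ?thesis by (intro that[of M]) auto
qed

text \<open>Turns happen at 1's, where r < c. So the time of the heading increases with every turn
  but never exceeds 0, and its distance from 0 is the measure of the induction.\<close>

lemma zigzag_exists:
  assumes F: "\<And>r c. (r, c) \<in> F \<Longrightarrow> r < c"
  shows "heading_time h \<le> 0 \<Longrightarrow> \<exists>bs e. zigzag F h bs e"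
proof (induction "nat (- heading_time h)" arbitrary: h rule: less_induct)
  case less
  show ?case
  proof (cases h)
    case h: (East r c)
    show ?thesis
    proof (cases "\<exists>c'<c. (r, c') \<in> F")
      case False
      then show ?thesis using zigzag.row_end[of c r F] h by blast
    next
      case True
      then obtain c' where c': "c' < c" "(r, c') \<in> F" "\<And>x. c' < x \<Longrightarrow> x < c \<Longrightarrow> (r, x) \<notin> F"
        using first_in_row[of F] F by metis
      moreover have "\<exists>bs e. zigzag F (South r c') bs e"
        using less.hyps[of "South r c'"] F[OF c'(2)] c'(1) h by simp
      ultimately show ?thesis using zigzag.row_turn[of c' c r F] h by blast
    qed
  next
    case h: (South r c)
    show ?thesis
    proof (cases "\<exists>r'>r. (r', c) \<in> F")
      case False
      then show ?thesis using zigzag.col_end[of r c F] h by blast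
    next
      case True
      then obtain r' where r': "r' > r" "(r', c) \<in> F" "\<And>x. r < x \<Longrightarrow> x < r' \<Longrightarrow> (x, c) \<notin> F"
        using first_in_col[of F] F by metis
      moreover have "\<exists>bs e. zigzag F (East r' c) bs e"
        using less.hyps[of "East r' c"] F[OF r'(2)] r'(1) h by simp
      ultimately show ?thesis using zigzag.col_turn[of r r' c F] h by blast
    qed
  qed
qed

text \<open>The trail starts at time -m, the zigzag path later. The assumption \<open>before\<close>
  says that no 1 is met in between, so both meet the same 1's.\<close>

lemma heading_trail:
  assumes "\<And>r c. (r, c) \<in> ones T \<Longrightarrow> r < c \<and> c - r \<le> m"
    and h: "- m \<le> heading_time h" "heading_time h \<le> 0" "trail (ones T) m x (heading_time h) = heading_state h"
    and before: "\<And>r c. (r, c) \<in> ones T \<Longrightarrow> r - c < heading_time h \<Longrightarrow> trail (ones T) m x (r - c) div 2 \<noteq> r"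
  shows "path_end T h = trail (ones T) m x 0 div 2"
    and "meets_one T h (r, c) \<longleftrightarrow> (r, c) \<in> ones T \<and> trail (ones T) m x (r - c) div 2 = r"
proof -
  have F: "\<And>r c. (r, c) \<in> ones T \<Longrightarrow> r < c" using assms(1) by blast
  obtain bs e where z: "zigzag (ones T) h bs e" using zigzag_exists[OF F h(2)] by blast
  note * = zigzag_trail[OF _ F h]
  show "path_end T h = trail (ones T) m x 0 div 2"
    unfolding path_end_def
  proof (rule the_equality)
    show "\<exists>bs. zigzag (ones T) h bs (trail (ones T) m x 0 div 2)"
      using z *[OF z] by metis
    show "e' = trail (ones T) m x 0 div 2" if "\<exists>bs. zigzag (ones T) h bs e'" for e'
      using that * by metis
  qed
  have "meets_one T h (r, c) \<longleftrightarrow> (r, c) \<in> ones T \<and> heading_time h \<le> r - c \<and>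
      trail (ones T) m x (r - c) div 2 = r"
    unfolding meets_one_def using z * by metis
  then show "meets_one T h (r, c) \<longleftrightarrow> (r, c) \<in> ones T \<and> trail (ones T) m x (r - c) div 2 = r"
    using before not_less by blast
qed

section \<open>Paths of a tableau read off from trails\<close>

definition in_frame :: "nat \<Rightarrow> (int \<times> int) set \<Rightarrow> bool" where
  "in_frame n F \<longleftrightarrow> (\<forall>r c. (r, c) \<in> F \<longrightarrow> - int n \<le> r \<and> r < c \<and> c \<le> int n)"

lemma in_frameD: "in_frame n F \<Longrightarrow> (r, c) \<in> F \<Longrightarrow> - int n \<le> r \<and> r < c \<and> c \<le> int n"
  by (simp add: in_frame_def)

context
  fixes n :: nat and m :: int and T :: tableau
  assumes frame: "in_frame n (ones T)" and m: "2 * int n < m"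
begin

private lemma frame_bounds: "(r, c) \<in> ones T \<Longrightarrow> r < c \<and> c - r \<le> m"
  using in_frameD[OF frame, of r c] m by simp

text \<open>All 1's lie in columns up to n, so the trail is still straight at time r - n, at which
  \<open>row_start n r\<close> enters the picture.\<close>

lemma row_start_trail:
  assumes r: "- int n \<le> r" "r \<le> int n"
  shows "path_end T (row_start n r) = trail (ones T) m (row_in r) 0 div 2"
    and "meets_one T (row_start n r) (r', c') \<longleftrightarrow>
      (r', c') \<in> ones T \<and> trail (ones T) m (row_in r) (r' - c') div 2 = r'"
proof -
  have *: "trail (ones T) m (row_in r) t = 2 * r + 1" if "- m \<le> t" "t \<le> r - int n" for t
  proof -
    have "(r, r - u) \<notin> ones T" if "u < t" for u
      using in_frameD[OF frame, of r "r - u"] that \<open>t \<le> r - int n\<close> by auto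
    then show ?thesis
      using trail_row[of m "- m" t r "ones T" "row_in r"] that by (simp add: row_in_def)
  qed
  have before: "trail (ones T) m (row_in r) (r' - c') div 2 \<noteq> r'"
    if "(r', c') \<in> ones T" "r' - c' < heading_time (row_start n r)" for r' c'
    using *[of "r' - c'"] frame_bounds[OF that(1)] in_frameD[OF frame that(1)] that(2)
    by (auto simp: row_start_def)
  note h = heading_trail[of T m "row_start n r" "row_in r", OF frame_bounds _ _ _ before]
  show "path_end T (row_start n r) = trail (ones T) m (row_in r) 0 div 2"
    "meets_one T (row_start n r) (r', c') \<longleftrightarrow>
      (r', c') \<in> ones T \<and> trail (ones T) m (row_in r) (r' - c') div 2 = r'"
    by (rule h; use r m *[of "r - int n"] in \<open>simp add: row_start_def\<close>)+
qed

lemma col_start_trail: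
  assumes c: "- int n \<le> c" "c \<le> int n"
  shows "path_end T (col_start n c) = trail (ones T) m (col_start_state m c) 0 div 2"
    and "meets_one T (col_start n c) (r', c') \<longleftrightarrow>
      (r', c') \<in> ones T \<and> trail (ones T) m (col_start_state m c) (r' - c') div 2 = r'"
proof -
  have *: "trail (ones T) m (col_start_state m c) t = 2 * (c + t)" if "- m \<le> t" "t \<le> - int n - c" for t
  proof -
    have "(c + u, c) \<notin> ones T" if "u < t" for u
      using in_frameD[OF frame, of "c + u" c] that \<open>t \<le> - int n - c\<close> by auto
    then show ?thesis
      using trail_col[of m "- m" t c "ones T" "col_start_state m c"] that by (simp add: col_start_state_def)
  qed
  have before: "trail (ones T) m (col_start_state m c) (r' - c') div 2 \<noteq> r'"
    if "(r', c') \<in> ones T" "r' - c' < heading_time (col_start n c)" for r' c'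
    using *[of "r' - c'"] frame_bounds[OF that(1)] in_frameD[OF frame that(1)] that(2)
    by (auto simp: col_start_def)
  note h = heading_trail[of T m "col_start n c" "col_start_state m c", OF frame_bounds _ _ _ before]
  show "path_end T (col_start n c) = trail (ones T) m (col_start_state m c) 0 div 2"
    "meets_one T (col_start n c) (r', c') \<longleftrightarrow>
      (r', c') \<in> ones T \<and> trail (ones T) m (col_start_state m c) (r' - c') div 2 = r'"
    by (rule h; use c m *[of "- int n - c"] in \<open>simp add: col_start_def\<close>)+
qed

end

section \<open>Diagrams and fillings\<close>

lemma diagram_antimono: "is_diagram n p \<Longrightarrow> i \<le> j \<Longrightarrow> j < length p \<Longrightarrow> p ! j \<le> p ! i"
  by (cases "i = j") (auto simp: is_diagram_def sorted_wrt_iff_nth_less)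

lemma diagram_bound: "is_diagram n p \<Longrightarrow> i < length p \<Longrightarrow> p ! i \<le> n - length p"
  by (auto simp: is_diagram_def)

definition col_height :: "nat list \<Rightarrow> nat \<Rightarrow> nat" where
  "col_height p q = card {r. r < length p \<and> q \<le> p ! r}"

text \<open>As row lengths decrease, the rows that reach column q are the topmost
  \<open>col_height p q\<close> ones: this is the conjugate partition.\<close>

lemma less_col_height:
  assumes "is_diagram n p" "r < length p"
  shows "r < col_height p q \<longleftrightarrow> q \<le> p ! r"
proof
  assume "q \<le> p ! r"
  then have "{..r} \<subseteq> {r. r < length p \<and> q \<le> p ! r}"
    using diagram_antimono[OF assms(1) _ assms(2)] assms(2) by (auto intro: order_trans)
  then have "card {..r} \<le> col_height p q" unfolding col_height_def by (intro card_mono) auto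
  then show "r < col_height p q" by simp
next
  assume "r < col_height p q"
  show "q \<le> p ! r"
  proof (rule ccontr)
    assume "\<not> q \<le> p ! r"
    then have "{r. r < length p \<and> q \<le> p ! r} \<subseteq> {..<r}"
      using diagram_antimono[OF assms(1)] by (force simp: not_le)
    then have "col_height p q \<le> card {..<r}" unfolding col_height_def by (intro card_mono) auto
    then show False using \<open>r < col_height p q\<close> by simp
  qed
qed

lemma col_height_le: "col_height p q \<le> length p"
proof -
  have "col_height p q \<le> card {..<length p}" unfolding col_height_def by (intro card_mono) auto
  then show ?thesis by simp
qed

lemma col_height_antimono: "q \<le> q' \<Longrightarrow> col_height p q' \<le> col_height p q"
  unfolding col_height_def by (intro card_mono) auto

lemma col_label_alt: "col_label n p q = int (n - length p - q + col_height p q + 1)"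
  by (simp add: col_label_def col_height_def)

context
  fixes n :: nat and p :: "nat list"
  assumes p: "is_diagram n p"
begin

lemma length_diagram: "length p \<le> n"
  using p by (simp add: is_diagram_def)

lemma row_label_strict_mono:
  assumes "r < r'" "r' < length p"
  shows "row_label n p r < row_label n p r'"
  using diagram_antimono[OF p, of r r'] assms by (simp add: row_label_def)

lemma col_label_strict_antimono:
  assumes "q < q'" "q' \<le> n - length p"
  shows "col_label n p q' < col_label n p q"
  using col_height_antimono[of q q' p] assms by (simp add: col_label_alt)

text \<open>This allows the shape to be forgotten: whether a row and a column share a box is visible
  from their labels.\<close>

lemma row_label_less_col_label:
  assumes "r < length p" "1 \<le> q" "q \<le> n - length p"
  shows "row_label n p r < col_label n p q \<longleftrightarrow> q \<le> p ! r"
    and "row_label n p r \<noteq> col_label n p q"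
  using less_col_height[OF p assms(1), of q] diagram_bound[OF p assms(1)] assms
  by (cases "q \<le> p ! r"; simp add: col_label_alt row_label_def)+

lemma row_label_inj: "inj_on (row_label n p) {..<length p}"
  by (rule linorder_inj_onI) (use row_label_strict_mono in force)+

lemma col_label_inj: "inj_on (col_label n p) {1..n - length p}"
  by (rule linorder_inj_onI) (use col_label_strict_antimono in force)+

text \<open>Row and column labels are distinct by \<open>row_label_less_col_label\<close>. They
  exhaust the range by counting: there are k + (n - k) of them between 1 and n.\<close>

lemma labels_partition:
  "row_label n p ` {..<length p} \<inter> col_label n p ` {1..n - length p} = {}"
  "row_label n p ` {..<length p} \<union> col_label n p ` {1..n - length p} = {1..int n}"
proof -
  show disj: "row_label n p ` {..<length p} \<inter> col_label n p ` {1..n - length p} = {}"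
    using row_label_less_col_label(2) by force
  show "row_label n p ` {..<length p} \<union> col_label n p ` {1..n - length p} = {1..int n}"
  proof (rule card_subset_eq)
    show "row_label n p ` {..<length p} \<union> col_label n p ` {1..n - length p} \<subseteq> {1..int n}"
    proof -
      have "1 \<le> row_label n p r \<and> row_label n p r \<le> int n" if "r < length p" for r
        using that length_diagram by (simp add: row_label_def)
      moreover have "1 \<le> col_label n p q \<and> col_label n p q \<le> int n" if "1 \<le> q" "q \<le> n - length p" for q
        using that col_height_le[of p q] by (simp add: col_label_alt)
      ultimately show ?thesis by auto
    qed
    show "card (row_label n p ` {..<length p} \<union> col_label n p ` {1..n - length p}) = card {1..int n}"
      using card_Un_disjoint[OF _ _ disj] length_diagram
        card_image[OF row_label_inj] card_image[OF col_label_inj] by simp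
  qed simp
qed

lemma row_labels_eq:
  "row_label n p ` {..<length p} = {1..int n} - col_label n p ` {1..n - length p}"
proof -
  have "A = U - B" if "A \<inter> B = {}" "A \<union> B = U" for A B U :: "int set" using that by blast
  then show ?thesis using labels_partition by this
qed

lemma boxes_eq:
  "boxes n p = {(r, c). c \<in> col_label n p ` {1..n - length p} \<and>
     r \<in> row_label n p ` {..<length p} \<union> uminus ` col_label n p ` {1..n - length p} \<and> \<bar>r\<bar> \<le> c}"
  (is "_ = ?R")
proof -
  have pos: "0 < row_label n p r" "0 < col_label n p q" for r q
    by (simp_all add: row_label_def col_label_def)
  have le: "col_label n p d \<le> col_label n p q \<longleftrightarrow> q \<le> d" if "q \<in> {1..n - length p}" "d \<in> {1..n - length p}" for q d
    using col_label_strict_antimono[of q d] col_label_strict_antimono[of d q] that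
    by (cases q d rule: linorder_cases) auto
  show ?thesis
  proof (intro equalityI subsetI)
    fix b assume "b \<in> boxes n p"
    then consider r q where "b = (row_label n p r, col_label n p q)" "r < length p" "1 \<le> q" "q \<le> p ! r"
      | d q where "b = (- col_label n p d, col_label n p q)" "1 \<le> q" "q \<le> d" "d \<le> n - length p"
      by (auto simp: boxes_def)
    then show "b \<in> ?R"
    proof cases
      case 1
      then have "q \<le> n - length p" using diagram_bound[OF p, of r] by simp
      then show ?thesis using 1 row_label_less_col_label(1)[of r q] pos(1)[of r] by simp
    next
      case 2
      then show ?thesis using le[of q d] pos(2)[of d] by simp
    qed
  next
    fix b assume "b \<in> ?R"
    then obtain x c where b: "b = (x, c)" and c: "c \<in> col_label n p ` {1..n - length p}" and "\<bar>x\<bar> \<le> c"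
      and "x \<in> row_label n p ` {..<length p} \<union> uminus ` col_label n p ` {1..n - length p}" by auto
    then obtain q where q: "q \<in> {1..n - length p}" "c = col_label n p q" by auto
    from \<open>x \<in> _\<close> show "b \<in> boxes n p"
    proof
      assume "x \<in> row_label n p ` {..<length p}"
      then obtain r where r: "r < length p" "x = row_label n p r" by auto
      then have "row_label n p r < col_label n p q"
        using \<open>\<bar>x\<bar> \<le> c\<close> q row_label_less_col_label(2)[of r q] by simp
      then have "q \<le> p ! r" using row_label_less_col_label(1)[of r q] r q by simp
      then show ?thesis using b q r unfolding boxes_def by auto
    next
      assume "x \<in> uminus ` col_label n p ` {1..n - length p}"
      then obtain d where d: "d \<in> {1..n - length p}" "x = - col_label n p d" by auto
      then have "q \<le> d" using le[of q d] q \<open>\<bar>x\<bar> \<le> c\<close> pos(2)[of d] by simp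
      then show ?thesis using b q d unfolding boxes_def by auto
    qed
  qed
qed

end

text \<open>The boxes are \<open>(r, c)\<close> with \<open>\<bar>r\<bar> \<le> c\<close>; a row label \<open>r > 0\<close> is not a column label,
  and a row label \<open>r < 0\<close> is the negative of a column label.\<close>

definition pt_filling :: "nat \<Rightarrow> int set \<Rightarrow> (int \<times> int) set \<Rightarrow> bool" where
  "pt_filling n C F \<longleftrightarrow> C \<subseteq> {1..int n} \<and>
     (\<forall>r c. (r, c) \<in> F \<longrightarrow> c \<in> C \<and> \<bar>r\<bar> \<le> c \<and> r \<noteq> 0 \<and> r \<notin> C \<and> (r < 0 \<longrightarrow> - r \<in> C)) \<and>
     (\<forall>c\<in>C. \<exists>r. (r, c) \<in> F) \<and>
     (\<forall>r c r' c'. r < c \<longrightarrow> (r', c) \<in> F \<longrightarrow> r' < r \<longrightarrow> (r, c') \<in> F \<longrightarrow> c < c' \<longrightarrow> (r, c) \<in> F) \<and>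
     (\<forall>i\<in>C. (- i, i) \<notin> F \<longrightarrow> (\<forall>c. (- i, c) \<notin> F))"

lemma cols_subset: "is_diagram n (part T) \<Longrightarrow> cols n T \<subseteq> {1..int n}"
  using labels_partition(2)[of n "part T"] unfolding cols_def by blast

lemma rows_eq: "is_diagram n (part T) \<Longrightarrow> rows n T = ({1..int n} - cols n T) \<union> uminus ` cols n T"
  by (simp only: rows_def cols_def row_labels_eq)

lemma boxes_cols:
  "is_diagram n (part T) \<Longrightarrow> boxes n (part T) = {(r, c). c \<in> cols n T \<and> r \<in> rows n T \<and> \<bar>r\<bar> \<le> c}"
  by (simp only: boxes_eq cols_def rows_def)

text \<open>The corner rule of \<open>PT\<close> concerns boxes, that of \<open>pt_filling\<close>
  all positions with r < c. They agree because the 1's in (r', c) and (r, c') make c a column label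
  and r a row label, and r' < r < c together with \<bar>r'\<bar> \<le> c gives \<bar>r\<bar> \<le>
  c.\<close>

lemma PT_iff: "T \<in> PT n \<longleftrightarrow> is_diagram n (part T) \<and> pt_filling n (cols n T) (ones T)"
proof (cases "is_diagram n (part T)")
  case True
  define C F where "C = cols n T" and "F = ones T"
  have C: "C \<subseteq> {1..int n}" using cols_subset[OF True] by (simp add: C_def)
  have B: "(r, c) \<in> boxes n (part T) \<longleftrightarrow> c \<in> C \<and> \<bar>r\<bar> \<le> c \<and> r \<noteq> 0 \<and> r \<notin> C \<and> (r < 0 \<longrightarrow> - r \<in> C)" for r c
  proof -
    have "r \<in> uminus ` C \<longleftrightarrow> - r \<in> C" by (metis add.inverse_inverse image_iff)
    moreover have "c \<in> C \<Longrightarrow> 1 \<le> c \<and> c \<le> int n" "r \<in> C \<Longrightarrow> 1 \<le> r" "- r \<in> C \<Longrightarrow> 1 \<le> - r"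
      using C by force+
    ultimately show ?thesis
      unfolding boxes_cols[OF True] rows_eq[OF True] C_def[symmetric] by auto
  qed
  have corner: "(r, c) \<in> boxes n (part T)"
    if "F \<subseteq> boxes n (part T)" "r < c" "(r', c) \<in> F" "r' < r" "(r, c') \<in> F" for r c r' c'
  proof -
    have "(r', c) \<in> boxes n (part T)" "(r, c') \<in> boxes n (part T)" using that by auto
    then show ?thesis using that unfolding B by auto
  qed
  have lt: "r < c" if "(r, c) \<in> boxes n (part T)" for r c
    using that unfolding B by (cases "r = c") auto
  have sub: "F \<subseteq> boxes n (part T) \<longleftrightarrow>
      (\<forall>r c. (r, c) \<in> F \<longrightarrow> c \<in> C \<and> \<bar>r\<bar> \<le> c \<and> r \<noteq> 0 \<and> r \<notin> C \<and> (r < 0 \<longrightarrow> - r \<in> C))"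
    unfolding subset_iff split_paired_All B ..
  have "(\<forall>r c r' c'. (r, c) \<in> boxes n (part T) \<and> r' < r \<and> (r', c) \<in> F \<and> c' > c \<and> (r, c') \<in> F \<longrightarrow> (r, c) \<in> F)
      \<longleftrightarrow> (\<forall>r c r' c'. r < c \<longrightarrow> (r', c) \<in> F \<longrightarrow> r' < r \<longrightarrow> (r, c') \<in> F \<longrightarrow> c < c' \<longrightarrow> (r, c) \<in> F)"
    (is "?in_boxes \<longleftrightarrow> ?in_plane") if "F \<subseteq> boxes n (part T)"
  proof
    assume in_boxes: ?in_boxes
    show ?in_plane
    proof (intro allI impI)
      fix r c r' c' assume "r < c" "(r', c) \<in> F" "r' < r" "(r, c') \<in> F" "c < c'"
      then show "(r, c) \<in> F" using in_boxes corner[OF that, of r c r' c'] by blast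
    qed
  next
    assume in_plane: ?in_plane
    show ?in_boxes
    proof (intro allI impI, elim conjE)
      fix r c r' c' assume "(r, c) \<in> boxes n (part T)" "(r', c) \<in> F" "r' < r" "(r, c') \<in> F" "c < c'"
      then show "(r, c) \<in> F" using in_plane lt[of r c] by blast
    qed
  qed
  note plane = this
  show ?thesis
  proof (cases "F \<subseteq> boxes n (part T)")
    case in_boxes: True
    show ?thesis
      unfolding PT_def pt_filling_def C_def[symmetric] F_def[symmetric] sub[symmetric] mem_Collect_eq
      by (simp only: True C in_boxes plane[OF in_boxes] simp_thms)
  next
    case False
    show ?thesis
      unfolding PT_def pt_filling_def C_def[symmetric] F_def[symmetric] sub[symmetric] mem_Collect_eq
      by (simp only: False simp_thms)
  qed
qed (simp add: PT_def)

section \<open>Length of signed permutations\<close>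

lemma gen_apply:
  "gen k x = (if k = 0 then (if x = 1 then - 1 else if x = - 1 then 1 else x)
     else if x = int k then int k + 1 else if x = int k + 1 then int k
     else if x = - int k then - (int k + 1) else if x = - (int k + 1) then - int k else x)"
  by (auto simp: gen_def transpose_def)

lemma gen_gen [simp]: "gen k (gen k x) = x"
  by (simp add: gen_apply)

lemma gen_comp_gen [simp]: "gen k \<circ> gen k = id"
  by (simp add: fun_eq_iff)

lemma gen_minus: "gen k (- x) = - gen k x"
  by (simp add: gen_apply)

lemma gen_eq_iff [simp]: "gen k x = gen k y \<longleftrightarrow> x = y"
  by (metis gen_gen)

lemma gen_mem_pm_set [simp]: "k < n \<Longrightarrow> gen k x \<in> pm_set n \<longleftrightarrow> x \<in> pm_set n"
  by (auto simp: gen_apply pm_set_def)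

lemma finite_pm_set [simp]: "finite (pm_set n)"
  by (rule finite_subset[of _ "{- int n..int n}"]) (auto simp: pm_set_def)

lemma pm_set_nonzero: "i \<in> pm_set n \<Longrightarrow> i \<noteq> 0"
  by (auto simp: pm_set_def)

lemma signed_perms_minus: "\<sigma> \<in> signed_perms n \<Longrightarrow> \<sigma> (- i) = - \<sigma> i"
  by (simp add: signed_perms_def)

lemma signed_perms_eq_iff: "\<sigma> \<in> signed_perms n \<Longrightarrow> \<sigma> i = \<sigma> j \<longleftrightarrow> i = j"
  by (auto simp: signed_perms_def dest: permutes_inj injD)

lemma signed_perms_mem: "\<sigma> \<in> signed_perms n \<Longrightarrow> \<sigma> i \<in> pm_set n \<longleftrightarrow> i \<in> pm_set n"
  by (simp add: signed_perms_def permutes_in_image)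

lemma signed_perms_comp_gen:
  assumes "\<sigma> \<in> signed_perms n" "k < n"
  shows "\<sigma> \<circ> gen k \<in> signed_perms n"
proof -
  have "gen k x = x" if "x \<notin> pm_set n" for x
    using that assms(2) by (auto simp: gen_apply pm_set_def)
  moreover have "bij_betw (gen k) (pm_set n) (pm_set n)"
    by (rule bij_betwI[of _ _ _ "gen k"]) (use assms(2) in auto)
  ultimately have "gen k permutes pm_set n" by (rule bij_imp_permutes[rotated])
  then show ?thesis
    using assms(1) by (auto simp: signed_perms_def gen_minus intro: permutes_compose)
qed

text \<open>For a signed permutation \<open>0 < \<sigma> 1\<close> means
  \<open>\<sigma> (- 1) < \<sigma> 1\<close>, the comparison of the two values that
  \<open>gen 0\<close> exchanges.\<close>

definition ascent :: "(int \<Rightarrow> int) \<Rightarrow> nat \<Rightarrow> bool" where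
  "ascent \<sigma> k \<longleftrightarrow> (if k = 0 then 0 < \<sigma> 1 else \<sigma> (int k) < \<sigma> (int k + 1))"

lemma ascent_comp_gen:
  assumes "\<sigma> \<in> signed_perms n" "k < n"
  shows "ascent (\<sigma> \<circ> gen k) k \<longleftrightarrow> \<not> ascent \<sigma> k"
proof (cases "k = 0")
  case True
  have "\<sigma> 1 \<in> pm_set n" using assms by (simp add: signed_perms_mem) (simp add: pm_set_def)
  then have "\<sigma> 1 \<noteq> 0" by (auto simp: pm_set_def)
  then show ?thesis using True signed_perms_minus[OF assms(1), of 1]
    by (auto simp: ascent_def gen_apply)
next
  case False
  have "\<sigma> (int k) \<noteq> \<sigma> (int k + 1)" by (simp add: signed_perms_eq_iff[OF assms(1)])
  then show ?thesis using False by (auto simp: ascent_def gen_apply)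
qed

definition inversions :: "nat \<Rightarrow> (int \<Rightarrow> int) \<Rightarrow> (int \<times> int) set" where
  "inversions n \<sigma> = {(i, j). i \<in> pm_set n \<and> j \<in> pm_set n \<and> i < j \<and> \<sigma> j < \<sigma> i}"

lemma inversions_id: "inversions n id = {}"
  by (auto simp: inversions_def)

text \<open>Every inversion \<open>(i, j)\<close> is counted together with \<open>(- j, - i)\<close>; the pairs \<open>(- i, i)\<close> count
  twice, so that each generator changes the total by 2.\<close>

definition inv_weight :: "nat \<Rightarrow> (int \<Rightarrow> int) \<Rightarrow> nat" where
  "inv_weight n \<sigma> = (\<Sum>(i, j)\<in>inversions n \<sigma>. if i = - j then 2 else 1)"

lemma finite_inversions [simp]: "finite (inversions n \<sigma>)"
  by (rule finite_subset[of _ "pm_set n \<times> pm_set n"]) (auto simp: inversions_def)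

text \<open>On nonzero entries \<open>gen k\<close> preserves the order of every pair except those
  it exchanges itself, collected in \<open>E\<close>. So the old inversions are relabeled, and
  \<open>E\<close> is added: one pair of weight 2 for k = 0, two pairs of weight 1
  otherwise.\<close>

lemma inv_weight_ascent:
  assumes \<sigma>: "\<sigma> \<in> signed_perms n" and k: "k < n" and "ascent \<sigma> k"
  shows "inv_weight n (\<sigma> \<circ> gen k) = inv_weight n \<sigma> + 2"
proof -
  define E where "E = (if k = 0 then {(- 1, 1)} else {(int k, int k + 1), (- (int k + 1), - int k)})"
  define f where "f = map_prod (gen k) (gen k)"
  define w where "w = (\<lambda>(i :: int, j). if i = - j then 2 else 1 :: nat)"
  have mono: "gen k i < gen k j" if "i < j" "(i, j) \<notin> E" "i \<noteq> 0" "j \<noteq> 0" for i j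
    using that by (auto simp: gen_apply E_def split: if_splits)
  have E: "\<sigma> i < \<sigma> j" "i < j" "i \<in> pm_set n" "j \<in> pm_set n" "gen k i = j" "gen k j = i"
    if mem: "(i, j) \<in> E" for i j
  proof -
    consider "k = 0" "i = - 1" "j = 1" | "k \<noteq> 0" "i = int k" "j = int k + 1"
      | "k \<noteq> 0" "i = - (int k + 1)" "j = - int k"
      using mem by (auto simp: E_def split: if_splits)
    then have "\<sigma> i < \<sigma> j \<and> i < j \<and> i \<in> pm_set n \<and> j \<in> pm_set n \<and> gen k i = j \<and> gen k j = i"
    proof cases
      case 1
      then show ?thesis using k \<open>ascent \<sigma> k\<close> signed_perms_minus[OF \<sigma>, of 1]
        by (simp add: ascent_def pm_set_def gen_apply)
    next
      case 2
      then show ?thesis using k \<open>ascent \<sigma> k\<close> by (simp add: ascent_def pm_set_def gen_apply)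
    next
      case 3
      have "\<sigma> i = - \<sigma> (int k + 1)" "\<sigma> j = - \<sigma> (int k)" unfolding 3 by (rule signed_perms_minus[OF \<sigma>])+
      then show ?thesis using 3 k \<open>ascent \<sigma> k\<close> by (simp add: ascent_def pm_set_def gen_apply)
    qed
    then show "\<sigma> i < \<sigma> j" "i < j" "i \<in> pm_set n" "j \<in> pm_set n" "gen k i = j" "gen k j = i" by blast+
  qed
  have "inversions n (\<sigma> \<circ> gen k) = E \<union> f ` inversions n \<sigma>"
  proof (intro equalityI subsetI)
    fix b assume "b \<in> inversions n (\<sigma> \<circ> gen k)"
    then obtain i j where b: "b = (i, j)" and "i \<in> pm_set n" "j \<in> pm_set n" "i < j" "\<sigma> (gen k j) < \<sigma> (gen k i)"
      by (auto simp: inversions_def)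
    then have "(gen k i, gen k j) \<in> inversions n \<sigma>" if "b \<notin> E"
      using mono[of i j] k that by (auto simp: inversions_def dest: pm_set_nonzero)
    moreover have "b = f (gen k i, gen k j)" using b by (simp add: f_def)
    ultimately show "b \<in> E \<union> f ` inversions n \<sigma>" by blast
  next
    fix b assume "b \<in> E \<union> f ` inversions n \<sigma>"
    then show "b \<in> inversions n (\<sigma> \<circ> gen k)"
    proof
      assume "b \<in> E"
      then show ?thesis using E[of "fst b" "snd b"] by (auto simp: inversions_def)
    next
      assume "b \<in> f ` inversions n \<sigma>"
      then obtain i j where b: "b = (gen k i, gen k j)" and ij: "i \<in> pm_set n" "j \<in> pm_set n" "i < j" "\<sigma> j < \<sigma> i"
        by (auto simp: inversions_def f_def)
      then have "(i, j) \<notin> E" using E(1)[of i j] by auto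
      then have "gen k i < gen k j" using mono[of i j] ij by (auto dest: pm_set_nonzero)
      then show ?thesis using b ij k by (simp add: inversions_def)
    qed
  qed
  moreover have "E \<inter> f ` inversions n \<sigma> = {}"
  proof -
    have False if "(gen k i, gen k j) \<in> E" "i < j" for i j
      using E(2,5,6)[OF that(1)] that(2) by simp
    then show ?thesis by (fastforce simp: f_def inversions_def)
  qed
  moreover have "finite E" by (simp add: E_def)
  ultimately have "inv_weight n (\<sigma> \<circ> gen k) = sum w E + sum w (f ` inversions n \<sigma>)"
    unfolding inv_weight_def w_def by (simp add: sum.union_disjoint)
  moreover have "sum w (f ` inversions n \<sigma>) = sum w (inversions n \<sigma>)"
  proof -
    have "inj_on f (inversions n \<sigma>)" by (auto simp: inj_on_def f_def)
    moreover have "w (f b) = w b" for b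
      by (cases b) (simp add: w_def f_def flip: gen_minus)
    ultimately show ?thesis by (simp add: sum.reindex)
  qed
  moreover have "sum w E = 2" by (simp add: E_def w_def)
  ultimately show ?thesis by (simp add: inv_weight_def w_def)
qed

text \<open>The values are increasing. Counting up from a positive first value gives
  \<open>j \<le> \<sigma> j\<close>, counting down from a last value at most n gives the reverse
  inequality.\<close>

lemma signed_perm_no_descent:
  assumes \<sigma>: "\<sigma> \<in> signed_perms n" and asc: "\<And>k. k < n \<Longrightarrow> ascent \<sigma> k"
  shows "\<sigma> = id"
proof -
  have low: "j \<le> int n \<longrightarrow> j \<le> \<sigma> j" if "1 \<le> j" for j
    using that
  proof (induction j rule: int_ge_induct)
    case base
    then show ?case using asc[of 0] by (auto simp: ascent_def)
  next
    case (step j)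
    show ?case
    proof
      assume "j + 1 \<le> int n"
      then have "\<sigma> j < \<sigma> (j + 1)" using asc[of "nat j"] step(1) by (simp add: ascent_def split: if_splits)
      then show "j + 1 \<le> \<sigma> (j + 1)" using step \<open>j + 1 \<le> int n\<close> by simp
    qed
  qed
  have up: "d < n \<longrightarrow> \<sigma> (int n - int d) \<le> int n - int d" for d
  proof (induction d)
    case 0
    have "0 < n \<Longrightarrow> \<sigma> (int n) \<in> pm_set n" using signed_perms_mem[OF \<sigma>] by (simp add: pm_set_def)
    then show ?case by (auto simp: pm_set_def)
  next
    case (Suc d)
    have "\<sigma> (int n - int (Suc d)) < \<sigma> (int n - int d)" if "Suc d < n"
    proof -
      have "int (n - Suc d) = int n - int (Suc d)" "int (n - Suc d) + 1 = int n - int d" using that by auto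
      moreover have "\<sigma> (int (n - Suc d)) < \<sigma> (int (n - Suc d) + 1)"
        using asc[of "n - Suc d"] that by (auto simp: ascent_def split: if_splits)
      ultimately show ?thesis by metis
    qed
    then show ?case using Suc by auto
  qed
  have pos: "\<sigma> j = j" if "1 \<le> j" "j \<le> int n" for j
    using low[of j] up[of "nat (int n - j)"] that by auto
  have "\<sigma> j = j" for j
  proof (cases "j \<in> pm_set n")
    case True
    then show ?thesis
      using pos[of j] pos[of "- j"] signed_perms_minus[OF \<sigma>, of j] by (auto simp: pm_set_def abs_if split: if_splits)
  next
    case False
    then show ?thesis using \<sigma> by (simp add: signed_perms_def permutes_def)
  qed
  then show ?thesis by auto
qed

lemma foldr_comp_snoc: "foldr (\<circ>) (fs @ [f]) id = foldr (\<circ>) fs id \<circ> f"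
  by (induction fs) (auto simp: comp_assoc)

lemma word_signed_perm:
  "set w \<subseteq> {..<n} \<Longrightarrow> foldr (\<circ>) (map gen w) id \<in> signed_perms n \<and>
     inv_weight n (foldr (\<circ>) (map gen w) id) \<le> 2 * length w"
proof (induction w rule: rev_induct)
  case Nil
  have "foldr (\<circ>) (map gen []) id = id" by simp
  moreover have "id \<in> signed_perms n" unfolding signed_perms_def by auto
  moreover have "inv_weight n id = 0" by (simp add: inv_weight_def inversions_id)
  ultimately show ?case by (metis le0)
next
  case (snoc k w)
  define \<sigma> where "\<sigma> = foldr (\<circ>) (map gen w) id"
  have k: "k < n" and "set w \<subseteq> {..<n}" using snoc.prems by auto
  then have \<sigma>: "\<sigma> \<in> signed_perms n" "inv_weight n \<sigma> \<le> 2 * length w"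
    using snoc.IH unfolding \<sigma>_def by blast+
  have eq: "foldr (\<circ>) (map gen (w @ [k])) id = \<sigma> \<circ> gen k"
    using foldr_comp_snoc[of "map gen w" "gen k"] by (simp add: \<sigma>_def)
  have "inv_weight n (\<sigma> \<circ> gen k) \<le> inv_weight n \<sigma> + 2"
  proof (cases "ascent \<sigma> k")
    case True
    then show ?thesis using inv_weight_ascent[OF \<sigma>(1) k] by simp
  next
    case False
    then show ?thesis
      using inv_weight_ascent[OF signed_perms_comp_gen[OF \<sigma>(1) k] k] ascent_comp_gen[OF \<sigma>(1) k]
      by (simp add: comp_assoc)
  qed
  then have "inv_weight n (\<sigma> \<circ> gen k) \<le> 2 * length (w @ [k])" using \<sigma>(2) by simp
  then show ?case unfolding eq using signed_perms_comp_gen[OF \<sigma>(1) k] by blast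
qed

lemma reduced_word_exists:
  "\<sigma> \<in> signed_perms n \<Longrightarrow>
    \<exists>w. set w \<subseteq> {..<n} \<and> \<sigma> = foldr (\<circ>) (map gen w) id \<and> 2 * length w = inv_weight n \<sigma>"
proof (induction "inv_weight n \<sigma>" arbitrary: \<sigma> rule: less_induct)
  case less
  show ?case
  proof (cases "\<exists>k<n. \<not> ascent \<sigma> k")
    case False
    then have "\<sigma> = id" using signed_perm_no_descent less.prems by blast
    moreover have "inv_weight n id = 0" by (simp add: inv_weight_def inversions_id)
    ultimately show ?thesis by (intro exI[of _ "[]"]) simp
  next
    case True
    then obtain k where k: "k < n" "\<not> ascent \<sigma> k" by blast
    define \<tau> where "\<tau> = \<sigma> \<circ> gen k"
    have \<tau>: "\<tau> \<in> signed_perms n" "ascent \<tau> k" "\<sigma> = \<tau> \<circ> gen k"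
      using signed_perms_comp_gen[OF less.prems k(1)] ascent_comp_gen[OF less.prems k(1)] k
      by (auto simp: \<tau>_def comp_assoc)
    then have weight: "inv_weight n \<sigma> = inv_weight n \<tau> + 2" using inv_weight_ascent k by simp
    then obtain w where w: "set w \<subseteq> {..<n}" "\<tau> = foldr (\<circ>) (map gen w) id" "2 * length w = inv_weight n \<tau>"
      using less.hyps[of \<tau>] \<tau>(1) by auto
    have "\<sigma> = foldr (\<circ>) (map gen (w @ [k])) id"
      using foldr_comp_snoc[of "map gen w" "gen k"] w(2) \<tau>(3) by simp
    then show ?thesis using w weight k by (intro exI[of _ "w @ [k]"]) auto
  qed
qed

text \<open>A generator raises the weight by at most 2, so no word is shorter than half the weight;
  removing descents one at a time attains this bound.\<close>

lemma len_eq_inv_weight: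
  assumes "\<sigma> \<in> signed_perms n"
  shows "2 * len n \<sigma> = inv_weight n \<sigma>"
proof -
  let ?P = "\<lambda>l. \<exists>w. length w = l \<and> set w \<subseteq> {..<n} \<and> \<sigma> = foldr (\<circ>) (map gen w) id"
  obtain w where w: "set w \<subseteq> {..<n}" "\<sigma> = foldr (\<circ>) (map gen w) id" "2 * length w = inv_weight n \<sigma>"
    using reduced_word_exists[OF assms] by blast
  then have P: "?P (length w)" by blast
  have "len n \<sigma> \<le> length w" unfolding len_def by (rule Least_le) (rule P)
  moreover have "?P (len n \<sigma>)" unfolding len_def by (rule LeastI) (rule P)
  ultimately show ?thesis using word_signed_perm[of _ n] w(3) by fastforce
qed

lemma weak_covers_iff_ascent:
  "weak_covers n \<sigma>' \<sigma> \<longleftrightarrow> \<sigma> \<in> signed_perms n \<and> (\<exists>k<n. \<sigma>' = \<sigma> \<circ> gen k \<and> ascent \<sigma> k)"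
proof -
  have "len n (\<sigma> \<circ> gen k) = len n \<sigma> + 1 \<longleftrightarrow> ascent \<sigma> k" if \<sigma>: "\<sigma> \<in> signed_perms n" and k: "k < n" for k
  proof -
    note \<tau> = signed_perms_comp_gen[OF \<sigma> k]
    show ?thesis
    proof (cases "ascent \<sigma> k")
      case True
      then show ?thesis
        using inv_weight_ascent[OF \<sigma> k] len_eq_inv_weight[OF \<sigma>] len_eq_inv_weight[OF \<tau>] by simp
    next
      case False
      then have "inv_weight n \<sigma> = inv_weight n (\<sigma> \<circ> gen k) + 2"
        using inv_weight_ascent[OF \<tau> k] ascent_comp_gen[OF \<sigma> k] by (simp add: comp_assoc)
      then show ?thesis
        using False len_eq_inv_weight[OF \<sigma>] len_eq_inv_weight[OF \<tau>] by simp
    qed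
  qed
  then show ?thesis by (auto simp: weak_covers_def)
qed

section \<open>The map \<open>zeta\<close>\<close>

text \<open>Rows have labels from -n on and columns labels up to n, so a 1 in (r, c) satisfies c - r
  \<le> 2n. Starting at time \<open>- horizon n\<close>, every path is still ahead of all
  1's.\<close>

definition horizon :: "nat \<Rightarrow> int" where
  "horizon n = 2 * int n + 2"

lemma horizon_gt: "2 * int n < horizon n" "0 \<le> horizon n" "- horizon n \<le> 0"
  by (simp_all add: horizon_def)

definition out_state :: "nat \<Rightarrow> (int \<times> int) set \<Rightarrow> int \<Rightarrow> int" where
  "out_state n F s = trail F (horizon n) s 0"

abbreviation col_in :: "nat \<Rightarrow> int \<Rightarrow> int" where
  "col_in n \<equiv> col_start_state (horizon n)"

lemma row_in_eq_iff [simp]: "row_in r = row_in r' \<longleftrightarrow> r = r'"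
  by (simp add: row_in_def)

lemma col_in_eq_iff [simp]: "col_in n c = col_in n c' \<longleftrightarrow> c = c'"
  by (simp add: col_start_state_def)

lemma row_in_neq_col_in [simp]: "row_in r \<noteq> col_in n c" "col_in n c \<noteq> row_in r"
  unfolding row_in_def col_start_state_def by presburger+

lemma start_state_cases:
  obtains r where "s = row_in r" | c where "s = col_in n c"
proof (cases s rule: even_odd_cases)
  case (even r)
  then show ?thesis using that(2)[of "r + horizon n"] by (simp add: col_start_state_def)
next
  case (odd r)
  then show ?thesis using that(1)[of r] by (simp add: row_in_def)
qed

lemma out_state_eq_iff: "out_state n F s = out_state n F s' \<longleftrightarrow> s = s'"
  unfolding out_state_def by (rule trail_inj) (rule horizon_gt)

lemma out_empty_row:
  assumes "\<And>c. (r, c) \<notin> F"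
  shows "out_state n F (row_in r) = 2 * r + 1"
  using trail_row[of "horizon n" "- horizon n" 0 r F "row_in r"] assms horizon_gt[of n]
  by (simp add: out_state_def row_in_def)

lemma out_empty_col:
  assumes "\<And>r. (r, c) \<notin> F"
  shows "out_state n F (col_in n c) = 2 * c"
  using trail_col[of "horizon n" "- horizon n" 0 c F "col_in n c"] assms horizon_gt[of n]
  by (simp add: out_state_def col_start_state_def)

lemma out_row_ge: "row_in r \<le> out_state n F (row_in r)"
  using trail_mono[of "horizon n" "- horizon n" 0 F "row_in r"] horizon_gt[of n] by (simp add: out_state_def)

text \<open>States never decrease, so a path that ends in row r has been there all the time; but
  then the 1 would have turned it south.\<close>

lemma out_row_gt:
  assumes F: "filling (horizon n) F" and "(r, c) \<in> F"
  shows "row_in r < out_state n F (row_in r)"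
proof (rule ccontr)
  assume "\<not> row_in r < out_state n F (row_in r)"
  then have end': "trail F (horizon n) (row_in r) 0 = 2 * r + 1"
    using out_row_ge[of r n F] by (simp add: out_state_def row_in_def)
  note b = filling_bounds[OF assms]
  have "trail F (horizon n) (row_in r) (r - c) = 2 * r + 1"
    using trail_mono[of "horizon n" "- horizon n" "r - c" F "row_in r"]
      trail_mono[of "horizon n" "r - c" 0 F "row_in r"] b end' by (simp add: row_in_def)
  then have "trail F (horizon n) (row_in r) (r - c + 1) = 2 * r + 2"
    using trail_step[of "horizon n" "r - c" F "row_in r"] b assms(2) by (simp add: step_odd)
  then show False using trail_mono[of "horizon n" "r - c + 1" 0 F "row_in r"] b end' by simp
qed

lemma out_state_mirror:
  "out_state n (mirror F) (row_in (- c)) = 1 - out_state n F (col_in n c)"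
  "out_state n (mirror F) (col_in n (- r)) = 1 - out_state n F (row_in r)"
  unfolding out_state_def by (rule trail_mirror_end[OF horizon_gt(2)])+

lemma out_col_less:
  assumes F: "filling (horizon n) F" and "(r, c) \<in> F"
  shows "out_state n F (col_in n c) < 2 * c"
  using out_row_gt[OF filling_mirror[OF F], of "- c" "- r"] assms(2) out_state_mirror(1)[of n F c]
  by (simp add: row_in_def)

text \<open>Columns without a 1 are allowed because of the zero-column convention.\<close>

definition pre_filling :: "nat \<Rightarrow> int set \<Rightarrow> (int \<times> int) set \<Rightarrow> bool" where
  "pre_filling n C F \<longleftrightarrow> C \<subseteq> {1..int n} \<and>
     (\<forall>r c. (r, c) \<in> F \<longrightarrow> c \<in> C \<and> \<bar>r\<bar> \<le> c \<and> r \<noteq> 0 \<and> r \<notin> C \<and> (r < 0 \<longrightarrow> - r \<in> C)) \<and>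
     filling (horizon n) F \<and> (\<forall>i\<in>C. (- i, i) \<notin> F \<longrightarrow> (\<forall>c. (- i, c) \<notin> F))"

lemma pt_filling_iff: "pt_filling n C F \<longleftrightarrow> pre_filling n C F \<and> (\<forall>c\<in>C. \<exists>r. (r, c) \<in> F)"
proof -
  have "r < c \<and> c - r < horizon n"
    if "C \<subseteq> {1..int n}" "c \<in> C" "\<bar>r\<bar> \<le> c" "r \<notin> C" for r c
  proof -
    have "r \<noteq> c" "c \<le> int n" "r \<le> c" using that by auto
    then show ?thesis using that horizon_gt(1)[of n] by auto
  qed
  then show ?thesis unfolding pt_filling_def pre_filling_def filling_def by (safe; blast)
qed

lemma pre_fillingD:
  assumes "pre_filling n C F" "(r, c) \<in> F"
  shows "c \<in> C" "\<bar>r\<bar> \<le> c" "r \<noteq> 0" "r \<notin> C" "r < 0 \<Longrightarrow> - r \<in> C" "r < c" "c \<le> int n" "1 \<le> c"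
proof -
  show "c \<in> C" "\<bar>r\<bar> \<le> c" "r \<noteq> 0" "r \<notin> C" "r < 0 \<Longrightarrow> - r \<in> C"
    using assms unfolding pre_filling_def by blast+
  show "r < c" using filling_bounds[of "horizon n" F r c] assms unfolding pre_filling_def by blast
  have "C \<subseteq> {1..int n}" using assms(1) unfolding pre_filling_def by blast
  then show "c \<le> int n" "1 \<le> c" using \<open>c \<in> C\<close> by auto
qed

lemma pre_filling_filling: "pre_filling n C F \<Longrightarrow> filling (horizon n) F"
  by (simp add: pre_filling_def)

lemma pre_filling_cols: "pre_filling n C F \<Longrightarrow> i \<in> C \<Longrightarrow> 1 \<le> i \<and> i \<le> int n"
  by (auto simp: pre_filling_def)

lemma pre_filling_diagonal: "pre_filling n C F \<Longrightarrow> (- i, c) \<in> F \<Longrightarrow> 0 < i \<Longrightarrow> (- i, i) \<in> F"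
  using pre_fillingD(5)[of n C F "- i" c] unfolding pre_filling_def by force

lemma pre_filling_in_frame:
  assumes "pre_filling n C F"
  shows "in_frame n F"
  unfolding in_frame_def
proof (intro allI impI)
  fix r c assume "(r, c) \<in> F"
  then show "- int n \<le> r \<and> r < c \<and> c \<le> int n" using pre_fillingD[OF assms, of r c] by auto
qed

text \<open>The start that \<open>zeta\<close> reads for the label i. Of column d and row -d exactly
  one is live, depending on the diagonal; the path from the other one ends in row -d in both cases
  (\<open>out_dead_col\<close>, \<open>out_dead_row\<close>).\<close>

definition live_in :: "nat \<Rightarrow> int set \<Rightarrow> (int \<times> int) set \<Rightarrow> int \<Rightarrow> int" where
  "live_in n C F i = (if i \<notin> C then row_in i else if (- i, i) \<notin> F then col_in n i else row_in (- i))"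

definition label_out :: "int set \<Rightarrow> int \<Rightarrow> int" where
  "label_out C j = (if j \<in> C then 2 * j else 2 * j + 1)"

definition zeta_val :: "nat \<Rightarrow> int set \<Rightarrow> (int \<times> int) set \<Rightarrow> int \<Rightarrow> int" where
  "zeta_val n C F i = (if i \<in> C \<and> (- i, i) \<in> F then - 1 else 1) * (out_state n F (live_in n C F i) div 2)"

lemma label_out_div [simp]: "label_out C j div 2 = j"
  by (simp add: label_out_def)

lemma label_out_less_iff: "label_out C i < label_out C j \<longleftrightarrow> i < j"
  by (cases "i = j") (auto simp: label_out_def)

context
  fixes n :: nat and C :: "int set" and F :: "(int \<times> int) set"
  assumes P: "pre_filling n C F"
begin

lemma live_in_eq_iff:
  assumes "1 \<le> i" "1 \<le> j"
  shows "live_in n C F i = live_in n C F j \<longleftrightarrow> i = j"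
  using assms by (auto simp: live_in_def)

text \<open>Nothing lies above a diagonal box in its column or to its right in its row: the path
  turns east at the diagonal 1 and leaves at once.\<close>

lemma out_dead_col:
  assumes "(- d, d) \<in> F"
  shows "out_state n F (col_in n d) = - 2 * d + 1"
proof -
  note b = pre_fillingD[OF P assms] horizon_gt[of n]
  let ?m = "horizon n"
  have "(d + u, d) \<notin> F" if "u < - 2 * d" for u
    using pre_fillingD(2)[OF P, of "d + u" d] that by auto
  then have "trail F ?m (col_in n d) (- 2 * d) = 2 * (- d)"
    using trail_col[of ?m "- ?m" "- 2 * d" d F "col_in n d"] b by (simp add: col_start_state_def)
  then have "trail F ?m (col_in n d) (- 2 * d + 1) = 2 * (- d) + 1"
    using trail_step[of ?m "- 2 * d" F "col_in n d"] step_even[of F "- 2 * d" "- d"] b assms by simp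
  moreover have "(- d, - d - u) \<notin> F" if "- 2 * d + 1 \<le> u" for u
    using pre_fillingD(2)[OF P, of "- d" "- d - u"] that by auto
  ultimately have "trail F ?m (col_in n d) 0 = 2 * (- d) + 1"
    using trail_row[of ?m "- 2 * d + 1" 0 "- d" F "col_in n d"] b by simp
  then show ?thesis by (simp add: out_state_def)
qed

text \<open>The starting states that are not used by \<open>zeta\<close> occupy all final states other than
  \<open>label_out C j\<close> with \<open>1 \<le> j \<le> n\<close>.\<close>

lemma out_dead_row:
  assumes "\<not> (1 \<le> r \<and> r \<le> int n \<and> r \<notin> C)" "\<not> (- r \<in> C \<and> (r, - r) \<in> F)"
  shows "out_state n F (row_in r) = 2 * r + 1"
proof (rule out_empty_row)
  fix c
  show "(r, c) \<notin> F"
  proof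
    assume rc: "(r, c) \<in> F"
    note b = pre_fillingD[OF P rc]
    show False
    proof (cases "r < 0")
      case True
      then show ?thesis using assms(2) b pre_filling_diagonal[OF P, of "- r" c] rc by simp
    next
      case False
      then show ?thesis using assms(1) b by auto
    qed
  qed
qed

lemma out_unused_col: "c \<notin> C \<Longrightarrow> out_state n F (col_in n c) = 2 * c"
  by (rule out_empty_col) (use pre_fillingD(1)[OF P] in blast)

lemma out_state_live:
  assumes i: "1 \<le> i" "i \<le> int n"
  obtains j where "1 \<le> j" "j \<le> int n" "out_state n F (live_in n C F i) = label_out C j"
proof -
  define s where "s = live_in n C F i"
  have s_row: "(1 \<le> r \<and> r \<le> int n \<and> r \<notin> C) \<or> (- r \<in> C \<and> (r, - r) \<in> F)" if "s = row_in r" for r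
    using that i by (auto simp: s_def live_in_def split: if_splits)
  have s_col: "c \<in> C \<and> (- c, c) \<notin> F" if "s = col_in n c" for c
    using that by (auto simp: s_def live_in_def split: if_splits)
  show ?thesis
  proof (cases "out_state n F s" rule: even_odd_cases)
    case (even j)
    have "j \<in> C"
    proof (rule ccontr)
      assume "j \<notin> C"
      then have "s = col_in n j" using out_unused_col[of j] even by (metis out_state_eq_iff)
      then show False using s_col \<open>j \<notin> C\<close> by blast
    qed
    then show ?thesis using that[of j] even pre_filling_cols[OF P, of j] by (simp add: label_out_def s_def)
  next
    case (odd j)
    have "1 \<le> j \<and> j \<le> int n \<and> j \<notin> C"
    proof (rule ccontr)
      assume nj: "\<not> (1 \<le> j \<and> j \<le> int n \<and> j \<notin> C)"
      show False
      proof (cases "- j \<in> C \<and> (j, - j) \<in> F")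
        case True
        then have "s = col_in n (- j)"
          using out_dead_col[of "- j"] odd out_state_eq_iff[of n F s "col_in n (- j)"] by simp
        then show False using s_col[of "- j"] True by simp
      next
        case False
        then have "s = row_in j" using out_dead_row[OF nj False] odd by (metis out_state_eq_iff)
        then show False using s_row[of j] nj False by blast
      qed
    qed
    then show ?thesis using that[of j] odd by (simp add: label_out_def s_def)
  qed
qed

lemma out_state_zeta_val:
  assumes i: "1 \<le> i" "i \<le> int n"
  shows "out_state n F (live_in n C F i) = label_out C \<bar>zeta_val n C F i\<bar>"
    and "1 \<le> \<bar>zeta_val n C F i\<bar>" "\<bar>zeta_val n C F i\<bar> \<le> int n"
    and "zeta_val n C F i < 0 \<longleftrightarrow> i \<in> C \<and> (- i, i) \<in> F"
proof -
  obtain j where j: "1 \<le> j" "j \<le> int n" "out_state n F (live_in n C F i) = label_out C j"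
    using out_state_live[OF i] .
  then have "zeta_val n C F i = (if i \<in> C \<and> (- i, i) \<in> F then - 1 else 1) * j"
    by (simp add: zeta_val_def)
  then show "out_state n F (live_in n C F i) = label_out C \<bar>zeta_val n C F i\<bar>"
    "1 \<le> \<bar>zeta_val n C F i\<bar>" "\<bar>zeta_val n C F i\<bar> \<le> int n"
    "zeta_val n C F i < 0 \<longleftrightarrow> i \<in> C \<and> (- i, i) \<in> F"
    using j by auto
qed

lemma zeta_val_abs_eq_iff:
  assumes "1 \<le> i" "i \<le> int n" "1 \<le> j" "j \<le> int n"
  shows "\<bar>zeta_val n C F i\<bar> = \<bar>zeta_val n C F j\<bar> \<longleftrightarrow> i = j"
  using out_state_zeta_val(1)[OF assms(1,2)] out_state_zeta_val(1)[OF assms(3,4)]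
    live_in_eq_iff[OF assms(1,3)] out_state_eq_iff by metis

lemma zeta_val_row_ge: "i \<notin> C \<Longrightarrow> 1 \<le> i \<Longrightarrow> i \<le> zeta_val n C F i"
  using out_row_ge[of i n F] by (simp add: zeta_val_def live_in_def row_in_def)

lemma zeta_val_row_gt: "(i, c) \<in> F \<Longrightarrow> 1 \<le> i \<Longrightarrow> i < zeta_val n C F i"
  using out_row_gt[OF pre_filling_filling[OF P], of i c] pre_fillingD(4)[OF P, of i c]
  by (simp add: zeta_val_def live_in_def row_in_def)

lemma zeta_val_empty_row: "(\<And>c. (i, c) \<notin> F) \<Longrightarrow> i \<notin> C \<Longrightarrow> zeta_val n C F i = i"
  using out_empty_row[of i F n] by (simp add: zeta_val_def live_in_def)

text \<open>Together with \<open>zeta_val_row_ge\<close> this recovers the column labels, if no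
  column is empty, as the i with \<open>zeta_val n C F i < i\<close>. If the diagonal contains 1,
  the negative sign decides; otherwise the path from column i has to turn east.\<close>

lemma zeta_val_col_less:
  assumes "i \<in> C" "(r, i) \<in> F"
  shows "zeta_val n C F i < i"
proof (cases "(- i, i) \<in> F")
  case True
  then show ?thesis using out_state_zeta_val(4)[of i] pre_filling_cols[OF P assms(1)] assms(1) by simp
next
  case False
  then show ?thesis
    using out_col_less[OF pre_filling_filling[OF P] assms(2)] assms(1) by (simp add: zeta_val_def live_in_def)
qed

end

text \<open>Read as an empty column, k ends at its own bottom; read as an empty row, it ends at its
  own right end. Both give the value k, so the zero-column convention does not affect
  \<open>zeta\<close>.\<close>

lemma zeta_val_drop_col:
  assumes "pre_filling n C F" "k \<in> C" "\<And>r. (r, k) \<notin> F" "\<And>c. (- k, c) \<notin> F"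
  shows "zeta_val n (C - {k}) F i = zeta_val n C F i"
proof (cases "i = k")
  case True
  have "(k, c) \<notin> F" for c using pre_fillingD(4)[OF assms(1)] assms(2) by blast
  then show ?thesis using assms(2,3) out_empty_row[of k F n] out_empty_col[of k F n]
    by (simp add: zeta_val_def live_in_def)
next
  case False
  then show ?thesis by (simp add: zeta_val_def live_in_def)
qed

lemma zeta_eq_zeta_val:
  assumes T: "T \<in> PT n" and i: "1 \<le> i" "i \<le> int n"
  shows "zeta n T i = zeta_val n (cols n T) (ones T) i" "zeta n T (- i) = - zeta n T i"
proof -
  define C F where CF: "C = cols n T" "F = ones T"
  have dia: "is_diagram n (part T)" and P: "pre_filling n C F"
    using T unfolding PT_iff pt_filling_iff CF by auto
  have rows: "i \<in> rows n T \<longleftrightarrow> i \<notin> C"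
    using cols_subset[OF dia] i unfolding rows_eq[OF dia] CF by auto
  have frame: "in_frame n (ones T)" using pre_filling_in_frame[OF P] by (simp add: CF)
  note m = horizon_gt(1)[of n]
  have "path_end T (row_start n i) = out_state n F (row_in i) div 2"
    "path_end T (row_start n (- i)) = out_state n F (row_in (- i)) div 2"
    "path_end T (col_start n i) = out_state n F (col_in n i) div 2"
    using row_start_trail(1)[OF frame m] col_start_trail(1)[OF frame m] i by (simp_all add: CF out_state_def)
  then have "zeta_pos n T i = zeta_val n C F i"
    using rows by (simp add: zeta_pos_def zeta_val_def live_in_def flip: CF)
  then show "zeta n T i = zeta_val n (cols n T) (ones T) i" "zeta n T (- i) = - zeta n T i"
    using i by (simp_all add: zeta_def pm_set_def flip: CF)
qed

lemma zeta_outside: "j \<notin> pm_set n \<Longrightarrow> zeta n T j = j"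
  by (simp add: zeta_def)

lemma PT_pre_filling: "T \<in> PT n \<Longrightarrow> pre_filling n (cols n T) (ones T)"
  by (simp add: PT_iff pt_filling_iff)

lemma zeta_minus:
  assumes "T \<in> PT n"
  shows "zeta n T (- j) = - zeta n T j"
proof -
  consider "1 \<le> j" "j \<le> int n" | "1 \<le> - j" "- j \<le> int n" | "j \<notin> pm_set n" "- j \<notin> pm_set n"
    by (cases "0 \<le> j") (auto simp: pm_set_def)
  then show ?thesis
    by cases (use zeta_eq_zeta_val(2)[OF assms, of j] zeta_eq_zeta_val(2)[OF assms, of "- j"] in
      \<open>simp_all add: zeta_outside\<close>)
qed

lemma zeta_signed_perm:
  assumes T: "T \<in> PT n"
  shows "zeta n T \<in> signed_perms n"
proof -
  note P = PT_pre_filling[OF T]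
  have abs_zeta: "\<bar>zeta n T j\<bar> = \<bar>zeta n T \<bar>j\<bar>\<bar>" for j
    using zeta_minus[OF T, of j] by (simp add: abs_if)
  have "zeta n T ` pm_set n \<subseteq> pm_set n"
  proof (rule image_subsetI)
    fix j assume "j \<in> pm_set n"
    then show "zeta n T j \<in> pm_set n"
      using out_state_zeta_val(2,3)[OF P, of "\<bar>j\<bar>"] zeta_eq_zeta_val(1)[OF T, of "\<bar>j\<bar>"] abs_zeta[of j]
      by (simp add: pm_set_def)
  qed
  moreover have "inj_on (zeta n T) (pm_set n)"
  proof (rule inj_onI)
    fix j k assume jk: "j \<in> pm_set n" "k \<in> pm_set n" "zeta n T j = zeta n T k"
    then have "\<bar>zeta n T \<bar>j\<bar>\<bar> = \<bar>zeta n T \<bar>k\<bar>\<bar>" using abs_zeta by metis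
    then have "\<bar>j\<bar> = \<bar>k\<bar>"
      using zeta_val_abs_eq_iff[OF P, of "\<bar>j\<bar>" "\<bar>k\<bar>"] zeta_eq_zeta_val(1)[OF T] jk(1,2) by (simp add: pm_set_def)
    moreover have "zeta n T j \<noteq> 0"
      using out_state_zeta_val(2)[OF P, of "\<bar>j\<bar>"] zeta_eq_zeta_val(1)[OF T, of "\<bar>j\<bar>"] abs_zeta[of j] jk(1)
      by (auto simp: pm_set_def)
    ultimately show "j = k" using jk(3) zeta_minus[OF T, of j] by (auto simp: abs_if split: if_splits)
  qed
  ultimately have "bij_betw (zeta n T) (pm_set n) (pm_set n)"
    by (simp add: bij_betw_def endo_inj_surj)
  then have "zeta n T permutes pm_set n" by (rule bij_imp_permutes) (rule zeta_outside)
  then show ?thesis using zeta_minus[OF T] by (simp add: signed_perms_def)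
qed

text \<open>Injectivity of \<open>zeta\<close>: the i with value below i are the columns, the
  negative values show the diagonal 1's. Then the live starts are known together with their ends,
  the other ends are forced, and \<open>filling_eqI\<close> applies.\<close>

lemma pt_filling_eqI:
  assumes "pt_filling n C F" "pt_filling n C' F'"
    and val: "\<And>i. 1 \<le> i \<Longrightarrow> i \<le> int n \<Longrightarrow> zeta_val n C F i = zeta_val n C' F' i"
  shows "C = C'" "F = F'"
proof -
  have P: "pre_filling n C F" and "pre_filling n C' F'" using assms(1,2) by (simp_all add: pt_filling_iff)
  have col_iff: "i \<in> B \<longleftrightarrow> 1 \<le> i \<and> i \<le> int n \<and> zeta_val n B G i < i" if "pt_filling n B G" for i B G
  proof -
    have pre: "pre_filling n B G" using that by (simp add: pt_filling_iff)
    show ?thesis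
    proof (cases "i \<in> B")
      case True
      then show ?thesis
        using that zeta_val_col_less[OF pre True] pre_filling_cols[OF pre True] by (auto simp: pt_filling_iff)
    next
      case False
      then show ?thesis using zeta_val_row_ge[OF pre False] by auto
    qed
  qed
  show C: "C = C'" using col_iff[OF assms(1)] col_iff[OF assms(2)] val by auto
  then have P': "pre_filling n C F'" and val: "1 \<le> i \<Longrightarrow> i \<le> int n \<Longrightarrow> zeta_val n C F i = zeta_val n C F' i" for i
    using \<open>pre_filling n C' F'\<close> val by simp_all
  have diag: "(- d, d) \<in> F \<longleftrightarrow> (- d, d) \<in> F'" if "d \<in> C" for d
    using out_state_zeta_val(4)[OF P, of d] out_state_zeta_val(4)[OF P', of d] val[of d] that
      pre_filling_cols[OF P, of d] by simp
  have live: "out_state n F (live_in n C F i) = out_state n F' (live_in n C F i)"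
    if "1 \<le> i" "i \<le> int n" for i
  proof -
    have "live_in n C F i = live_in n C F' i" using diag by (simp add: live_in_def)
    then show ?thesis
      using out_state_zeta_val(1)[OF P that] out_state_zeta_val(1)[OF P' that] val[OF that] by simp
  qed
  have "out_state n F s = out_state n F' s" for s
  proof (cases s rule: start_state_cases[where n = n])
    case (1 r)
    show ?thesis
    proof (cases "(1 \<le> r \<and> r \<le> int n \<and> r \<notin> C) \<or> (- r \<in> C \<and> (r, - r) \<in> F)")
      case True
      then show ?thesis
      proof
        assume "1 \<le> r \<and> r \<le> int n \<and> r \<notin> C"
        then show ?thesis using live[of r] 1 by (simp add: live_in_def)
      next
        assume "- r \<in> C \<and> (r, - r) \<in> F"
        then show ?thesis using live[of "- r"] 1 pre_filling_cols[OF P, of "- r"] by (simp add: live_in_def)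
      qed
    next
      case False
      moreover have "\<not> (- r \<in> C \<and> (r, - r) \<in> F')" using False diag[of "- r"] by auto
      ultimately show ?thesis using out_dead_row[OF P, of r] out_dead_row[OF P', of r] 1 by simp
    qed
  next
    case (2 c)
    consider "c \<notin> C" | "c \<in> C" "(- c, c) \<in> F" | "c \<in> C" "(- c, c) \<notin> F" by blast
    then show ?thesis
    proof cases
      case 1
      then show ?thesis using out_unused_col[OF P, of c] out_unused_col[OF P', of c] 2 by simp
    next
      case c: 2
      then show ?thesis using out_dead_col[OF P] out_dead_col[OF P'] diag[of c] 2 by simp
    next
      case 3
      then show ?thesis using live[of c] 2 pre_filling_cols[OF P, of c] by (simp add: live_in_def)
    qed
  qed
  then show "F = F'"
    using filling_eqI[OF pre_filling_filling[OF P] pre_filling_filling[OF P']] by (simp add: out_state_def)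
qed

section \<open>Effect of the operations\<close>

text \<open>\<open>zeta_val\<close> is meant for positive labels, but \<open>gen 0\<close> sends 1
  to -1; the odd extension supplies this value.\<close>

definition zeta_ext :: "nat \<Rightarrow> int set \<Rightarrow> (int \<times> int) set \<Rightarrow> int \<Rightarrow> int" where
  "zeta_ext n C F j = (if j < 0 then - zeta_val n C F (- j) else zeta_val n C F j)"

definition zeta_ascent :: "nat \<Rightarrow> int set \<Rightarrow> (int \<times> int) set \<Rightarrow> nat \<Rightarrow> bool" where
  "zeta_ascent n C F k \<longleftrightarrow>
     (if k = 0 then 0 < zeta_val n C F 1 else zeta_val n C F (int k) < zeta_val n C F (int k + 1))"

text \<open>The common target for all operations. It asks for a \<open>pre_filling\<close> only, so
  that a zero column can be removed afterwards.\<close>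

definition cover_step :: "nat \<Rightarrow> int set \<Rightarrow> (int \<times> int) set \<Rightarrow> int set \<Rightarrow> (int \<times> int) set \<Rightarrow> nat \<Rightarrow> bool" where
  "cover_step n C F C' F' k \<longleftrightarrow> pre_filling n C' F' \<and> k < n \<and> zeta_ascent n C F k \<and>
     (\<forall>j. 1 \<le> j \<longrightarrow> j \<le> int n \<longrightarrow> zeta_val n C' F' j = zeta_ext n C F (gen k j))"

definition row_label_of :: "nat \<Rightarrow> int set \<Rightarrow> int \<Rightarrow> bool" where
  "row_label_of n C a \<longleftrightarrow> (1 \<le> a \<and> a \<le> int n \<and> a \<notin> C) \<or> - a \<in> C"

text \<open>By \<open>kind\<close>, the labels k and k + 1 are read with the same sign, so that
  exchanging the ends of their live paths is exchanging their values.\<close>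

lemma cover_step_same_cols:
  assumes P: "pre_filling n C F" and P': "pre_filling n C F'"
    and diag: "\<And>d. d \<in> C \<Longrightarrow> (- d, d) \<in> F' \<longleftrightarrow> (- d, d) \<in> F"
    and k: "1 \<le> k" "k < n" and asc: "zeta_ascent n C F k"
    and kind: "int k \<in> C \<and> (- int k, int k) \<in> F \<longleftrightarrow> int k + 1 \<in> C \<and> (- (int k + 1), int k + 1) \<in> F"
    and ends: "\<And>s. out_state n F' (transpose (live_in n C F (int k)) (live_in n C F (int k + 1)) s) = out_state n F s"
  shows "cover_step n C F C F' k"
  unfolding cover_step_def
proof (intro conjI allI impI P' k(2) asc)
  fix j assume j: "1 \<le> j" "j \<le> int n"
  have g: "gen k j = transpose (int k) (int k + 1) j" and g1: "1 \<le> gen k j"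
    using k j by (auto simp: gen_apply transpose_def)
  have "live_in n C F' j = live_in n C F j" using diag by (simp add: live_in_def)
  moreover have "live_in n C F (gen k j) = transpose (live_in n C F (int k)) (live_in n C F (int k + 1)) (live_in n C F j)"
    using live_in_eq_iff[OF P, of j "int k"] live_in_eq_iff[OF P, of j "int k + 1"] k j
    by (simp add: g transpose_def)
  ultimately have "out_state n F' (live_in n C F' j) = out_state n F (live_in n C F (gen k j))"
    using ends[of "live_in n C F (gen k j)"] by simp
  moreover have "j \<in> C \<and> (- j, j) \<in> F' \<longleftrightarrow> gen k j \<in> C \<and> (- gen k j, gen k j) \<in> F"
    using kind diag[of j] unfolding g by (auto simp: transpose_def)
  ultimately show "zeta_val n C F' j = zeta_ext n C F (gen k j)"
    using g1 by (simp add: zeta_val_def zeta_ext_def)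
qed

lemma zeta_ascent_iff_out:
  assumes P: "pre_filling n C F" and k: "1 \<le> k" "k < n"
    and kind: "\<not> (int k \<in> C \<and> (- int k, int k) \<in> F)" "\<not> (int k + 1 \<in> C \<and> (- (int k + 1), int k + 1) \<in> F)"
  shows "zeta_ascent n C F k \<longleftrightarrow>
    out_state n F (live_in n C F (int k)) < out_state n F (live_in n C F (int k + 1))"
proof -
  have "\<not> zeta_val n C F (int k) < 0" "\<not> zeta_val n C F (int k + 1) < 0"
    using out_state_zeta_val(4)[OF P, of "int k"] out_state_zeta_val(4)[OF P, of "int k + 1"] k kind by auto
  then show ?thesis
    using out_state_zeta_val(1)[OF P, of "int k"] out_state_zeta_val(1)[OF P, of "int k + 1"] k
    by (simp add: zeta_ascent_def label_out_less_iff)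
qed

lemma zeta_ascent_iff_out_neg:
  assumes P: "pre_filling n C F" and k: "1 \<le> k" "k < n"
    and kind: "int k \<in> C \<and> (- int k, int k) \<in> F" "int k + 1 \<in> C \<and> (- (int k + 1), int k + 1) \<in> F"
  shows "zeta_ascent n C F k \<longleftrightarrow>
    out_state n F (live_in n C F (int k + 1)) < out_state n F (live_in n C F (int k))"
proof -
  have "zeta_val n C F (int k) < 0" "zeta_val n C F (int k + 1) < 0"
    using out_state_zeta_val(4)[OF P, of "int k"] out_state_zeta_val(4)[OF P, of "int k + 1"] k kind by auto
  then show ?thesis
    using out_state_zeta_val(1)[OF P, of "int k"] out_state_zeta_val(1)[OF P, of "int k + 1"] k
    by (auto simp: zeta_ascent_def label_out_less_iff)
qed

text \<open>The rows -(k + 1) and -k belong to the generator k just as the rows k and k + 1 do, but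
  with the larger index on the upper row.\<close>

definition row_pair_index :: "int \<Rightarrow> nat" where
  "row_pair_index a = nat (if 0 < a then a else - (a + 1))"

context
  fixes n :: nat and C :: "int set" and F :: "(int \<times> int) set" and a :: int
  assumes P: "pre_filling n C F" and a: "row_label_of n C a" "row_label_of n C (a + 1)"
begin

lemma row_pair_index:
  shows "1 \<le> row_pair_index a" "row_pair_index a < n"
    and "0 < a \<Longrightarrow> int (row_pair_index a) = a \<and> a \<notin> C \<and> a + 1 \<notin> C"
    and "\<not> 0 < a \<Longrightarrow> int (row_pair_index a) = - (a + 1) \<and> - (a + 1) \<in> C \<and> - a \<in> C"
proof -
  have C: "c \<in> C \<Longrightarrow> 1 \<le> c \<and> c \<le> int n" for c by (rule pre_filling_cols[OF P])
  have "a \<noteq> 0" "a + 1 \<noteq> 0" using a C[of "- a"] C[of "- (a + 1)"] by (auto simp: row_label_of_def)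
  have "1 \<le> row_pair_index a \<and> row_pair_index a < n \<and>
    (0 < a \<longrightarrow> int (row_pair_index a) = a \<and> a \<notin> C \<and> a + 1 \<notin> C) \<and>
    (\<not> 0 < a \<longrightarrow> int (row_pair_index a) = - (a + 1) \<and> - (a + 1) \<in> C \<and> - a \<in> C)"
  proof (cases "0 < a")
    case True
    then have "a \<notin> C" "a + 1 \<notin> C" "a + 1 \<le> int n"
      using a C[of "- a"] C[of "- (a + 1)"] by (auto simp: row_label_of_def)
    then show ?thesis using True by (simp add: row_pair_index_def nat_less_iff)
  next
    case False
    then have "a < 0" "a + 1 < 0" using \<open>a \<noteq> 0\<close> \<open>a + 1 \<noteq> 0\<close> by linarith+
    then have "- a \<in> C" "- (a + 1) \<in> C" using a by (auto simp: row_label_of_def)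
    moreover from C[OF this(1)] C[OF this(2)] have "int (row_pair_index a) = - (a + 1)" "- a \<le> int n"
      by (simp_all add: row_pair_index_def)
    ultimately show ?thesis using \<open>a + 1 < 0\<close> by linarith
  qed
  then show "1 \<le> row_pair_index a" "row_pair_index a < n"
    "0 < a \<Longrightarrow> int (row_pair_index a) = a \<and> a \<notin> C \<and> a + 1 \<notin> C"
    "\<not> 0 < a \<Longrightarrow> int (row_pair_index a) = - (a + 1) \<and> - (a + 1) \<in> C \<and> - a \<in> C"
    by blast+
qed

lemma row_pair_live:
  assumes "(a, x) \<in> F" "(a + 1, y) \<in> F"
  shows "transpose (live_in n C F (int (row_pair_index a))) (live_in n C F (int (row_pair_index a) + 1)) =
      transpose (row_in a) (row_in (a + 1))" (is ?tr)
    and "zeta_ascent n C F (row_pair_index a) \<longleftrightarrow>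
      out_state n F (row_in a) < out_state n F (row_in (a + 1))" (is ?asc)
    and "int (row_pair_index a) \<in> C \<and> (- int (row_pair_index a), int (row_pair_index a)) \<in> F \<longleftrightarrow>
      int (row_pair_index a) + 1 \<in> C \<and> (- (int (row_pair_index a) + 1), int (row_pair_index a) + 1) \<in> F" (is ?kind)
proof -
  have "?tr \<and> ?asc \<and> ?kind"
  proof (cases "0 < a")
    case True
    note k = row_pair_index(3)[OF True]
    then have "live_in n C F (int (row_pair_index a)) = row_in a"
      "live_in n C F (int (row_pair_index a) + 1) = row_in (a + 1)" by (simp_all add: live_in_def)
    then show ?thesis using zeta_ascent_iff_out[OF P row_pair_index(1,2)] k by simp
  next
    case False
    note k = row_pair_index(4)[OF False]
    then have "0 < - a" "0 < - (a + 1)" using pre_filling_cols[OF P] by force+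
    then have diag: "(a, - a) \<in> F" "(a + 1, - (a + 1)) \<in> F"
      using pre_filling_diagonal[OF P, of "- a" x] pre_filling_diagonal[OF P, of "- (a + 1)" y] assms
      unfolding minus_minus by blast+
    define K where "K = - (a + 1)"
    then have K: "int (row_pair_index a) = K" "a = - (K + 1)" "a + 1 = - K" using k by simp_all
    have neg: "- (a + 1) = K" "- a = K + 1" by (simp_all add: K_def)
    have diag': "(- K, K) \<in> F" "(- (K + 1), K + 1) \<in> F" "K \<in> C" "K + 1 \<in> C"
      using diag k unfolding neg unfolding K(3) unfolding K(2) by blast+
    then have "live_in n C F K = row_in (- K)" "live_in n C F (K + 1) = row_in (- (K + 1))"
      by (simp_all add: live_in_def)
    then show ?thesis
      using zeta_ascent_iff_out_neg[OF P row_pair_index(1,2)] diag' transpose_commute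
      unfolding K(1,3) unfolding K(2) by metis
  qed
  then show ?tr ?asc ?kind by blast+
qed

lemma cover_step_rows:
  assumes x: "leftmost_one F a x" and y: "leftmost_one F (a + 1) y" and "x \<le> y" "(a + 1, x) \<in> F"
  shows "cover_step n C F C (replace_rows a x y F) (row_pair_index a)"
    and "(r, c) \<in> F \<Longrightarrow> \<exists>r. (r, c) \<in> replace_rows a x y F"
proof -
  define F' where "F' = replace_rows a x y F"
  note mem = mem_replace_rows[of _ _ a x y F, folded F'_def]
  have ax: "(a, x) \<in> F" "\<And>c. x < c \<Longrightarrow> (a, c) \<notin> F" and ay: "(a + 1, y) \<in> F" "\<And>c. y < c \<Longrightarrow> (a + 1, c) \<notin> F"
    using x y by (force simp: leftmost_one_def)+
  note bx = pre_fillingD[OF P ax(1)] and by' = pre_fillingD[OF P ay(1)] and bx' = pre_fillingD[OF P assms(4)]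
  have bound: "y - a < horizon n" using bx by' horizon_gt(1)[of n] by linarith
  note ex = replace_rows_exchange[OF pre_filling_filling[OF P] \<open>x \<le> y\<close> ax(1) assms(4) ay(1) ax(2) ay(2) bound]
  have sub: "c \<in> C \<and> \<bar>r\<bar> \<le> c \<and> r \<noteq> 0 \<and> r \<notin> C \<and> (r < 0 \<longrightarrow> - r \<in> C)" if "(r, c) \<in> F'" for r c
  proof (cases "(r, c) \<in> F")
    case True
    then show ?thesis using pre_fillingD[OF P True] by blast
  next
    case False
    then have "r = a" "x \<le> c" "(a + 1, c) \<in> F" using that by (auto simp: mem split: if_splits)
    then show ?thesis using bx pre_fillingD(1)[OF P, of "a + 1" c] by auto
  qed
  \<comment> \<open>The rectangle cannot change a diagonal: that of a negative row a + 1 lies to the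
    right of column x, and that of a negative row a contains 1 already because this row
    does.\<close>
  have neg: "(- d, d) \<in> F' \<longleftrightarrow> (- d, d) \<in> F" if "d \<in> C" for d
  proof -
    have "d < x" if "- d = a + 1" using that bx(2) by linarith
    moreover have "(- d, d) \<in> F" if "- d = a"
      using pre_filling_diagonal[OF P, of d x] that ax(1) pre_filling_cols[OF P \<open>d \<in> C\<close>] by simp
    ultimately show ?thesis by (auto simp: mem)
  qed
  have P': "pre_filling n C F'"
    unfolding pre_filling_def
  proof (intro conjI ballI impI allI)
    show "C \<subseteq> {1..int n}" using P by (simp add: pre_filling_def)
    show "filling (horizon n) F'" using ex(2) by (simp add: F'_def)
    fix d c assume d: "d \<in> C" "(- d, d) \<notin> F'"
    then have d1: "1 \<le> d" "(- d, d) \<notin> F" using neg pre_filling_cols[OF P d(1)] by auto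
    then have empty: "(- d, c') \<notin> F" for c' using pre_filling_diagonal[OF P, of d c'] by auto
    then have "- d \<noteq> a" using ax(1) by metis
    then show "(- d, c) \<notin> F'" using empty by (simp add: mem)
  qed (use sub in blast)+
  note tr = row_pair_live[OF ax(1) ay(1)]
  have ends: "out_state n F' (transpose (row_in a) (row_in (a + 1)) s) = out_state n F s" for s
    using ex(1)[of s] by (simp add: out_state_def F'_def)
  \<comment> \<open>The ascent is read off from the new filling: the lower entry in column y has
    become 0, so the two paths cross there, and undoing the exchange of starts gives the order of
    the old ends.\<close>
  have "out_state n F' (row_in (a + 1)) < out_state n F' (row_in a)"
    unfolding out_state_def
  proof (rule rows_cross[OF pre_filling_filling[OF P'], of a y])
    show "(a, y) \<in> F'" using ay(1) \<open>x \<le> y\<close> by (simp add: mem)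
    show "(a, c) \<notin> F'" if "y < c" for c using that ax(2) \<open>x \<le> y\<close> by (simp add: mem)
    show "(a + 1, c) \<notin> F'" if "y \<le> c" for c using that ay(2)[of c] \<open>x \<le> y\<close> by (cases "c = y") (auto simp: mem)
    show "a + 1 < y" using bx'(6) \<open>x \<le> y\<close> by simp
  qed
  then have "out_state n F (row_in a) < out_state n F (row_in (a + 1))"
    using ends[of "row_in a"] ends[of "row_in (a + 1)"] by simp
  then have "zeta_ascent n C F (row_pair_index a)" using tr(2) by simp
  then show "cover_step n C F C (replace_rows a x y F) (row_pair_index a)"
    using cover_step_same_cols[OF P P' neg row_pair_index(1,2) _ tr(3)] ends unfolding tr(1) F'_def by blast
  show "\<exists>r. (r, c) \<in> replace_rows a x y F" if "(r, c) \<in> F"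
  proof (cases "(r, c) \<in> F'")
    case False
    then have "(a, c) \<in> F'" using that by (auto simp: mem split: if_splits)
    then show ?thesis by (auto simp: F'_def)
  qed (auto simp: F'_def)
qed

text \<open>Otherwise row a + 1 contains only 0's from column x to the left, and the two paths cross
  in (a + 1, x), contrary to the ascent.\<close>

lemma ascent_rows:
  assumes x: "leftmost_one F a x" and nonempty: "\<exists>c. (a + 1, c) \<in> F" and asc: "zeta_ascent n C F (row_pair_index a)"
  obtains c where "x \<le> c" "(a + 1, c) \<in> F"
proof -
  have ax: "(a, x) \<in> F" "\<And>c. x < c \<Longrightarrow> (a, c) \<notin> F"
    using x by (force simp: leftmost_one_def)+
  have "a + 1 < x"
  proof -
    have "a + 1 \<noteq> x"
      using pre_fillingD(1,8)[OF P ax(1)] row_pair_index(3,4) by (cases "0 < a") auto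
    then show ?thesis using pre_fillingD(6)[OF P ax(1)] by simp
  qed
  moreover have "\<not> out_state n F (row_in (a + 1)) < out_state n F (row_in a)"
    using row_pair_live(2)[OF ax(1)] nonempty asc by auto
  ultimately show ?thesis
    using rows_cross[OF pre_filling_filling[OF P] ax] that unfolding out_state_def by blast
qed

end

lemma col_pair_live:
  assumes P: "pre_filling n C F" and j: "j \<in> C" "j + 1 \<in> C" "(- j, j) \<notin> F" "(- (j + 1), j + 1) \<notin> F"
  shows "int (nat j) = j" "1 \<le> nat j" "nat j < n"
    and "live_in n C F j = col_in n j" "live_in n C F (j + 1) = col_in n (j + 1)"
    and "zeta_ascent n C F (nat j) \<longleftrightarrow> out_state n F (col_in n j) < out_state n F (col_in n (j + 1))"
proof -
  show k: "int (nat j) = j" "1 \<le> nat j" "nat j < n"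
    using pre_filling_cols[OF P j(1)] pre_filling_cols[OF P j(2)] by auto
  show live: "live_in n C F j = col_in n j" "live_in n C F (j + 1) = col_in n (j + 1)"
    using j by (simp_all add: live_in_def)
  show "zeta_ascent n C F (nat j) \<longleftrightarrow> out_state n F (col_in n j) < out_state n F (col_in n (j + 1))"
    using zeta_ascent_iff_out[OF P k(2,3)] j unfolding k(1) live by simp
qed

text \<open>The 1's of column j inside the rectangle are moved or absorbed, so column j is the only
  one that can become empty; hence the exception in the second claim.\<close>

lemma cover_step_cols:
  assumes P: "pre_filling n C F" and j: "j \<in> C" "j + 1 \<in> C" "(- j, j) \<notin> F" "(- (j + 1), j + 1) \<notin> F"
    and x: "topmost_one F j x" and y: "topmost_one F (j + 1) y" and "x \<le> y" "(y, j) \<in> F"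
  shows "cover_step n C F C (replace_cols j x y F) (nat j)"
    and "(r, c) \<in> F \<Longrightarrow> c \<noteq> j \<Longrightarrow> \<exists>r. (r, c) \<in> replace_cols j x y F"
proof -
  define F' where "F' = replace_cols j x y F"
  note mem = mem_replace_cols[of _ _ j x y F, folded F'_def]
  have jx: "(x, j) \<in> F" "\<And>r. r < x \<Longrightarrow> (r, j) \<notin> F" and jy: "(y, j + 1) \<in> F" "\<And>r. r < y \<Longrightarrow> (r, j + 1) \<notin> F"
    using x y by (force simp: topmost_one_def)+
  note bx = pre_fillingD[OF P jx(1)] and by' = pre_fillingD[OF P jy(1)] and bx' = pre_fillingD[OF P assms(9)]
  have bound: "j + 1 - x < horizon n" using bx by' horizon_gt(1)[of n] by linarith
  note ex = replace_cols_exchange[OF pre_filling_filling[OF P] \<open>x \<le> y\<close> jx(1) assms(9) jy(1) jx(2) jy(2) bound]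
  have sub: "c \<in> C \<and> \<bar>r\<bar> \<le> c \<and> r \<noteq> 0 \<and> r \<notin> C \<and> (r < 0 \<longrightarrow> - r \<in> C)" if "(r, c) \<in> F'" for r c
  proof (cases "(r, c) \<in> F")
    case True
    then show ?thesis using pre_fillingD[OF P True] by blast
  next
    case False
    then have "c = j + 1" "(r, j) \<in> F" using that by (auto simp: mem split: if_splits)
    then show ?thesis using j pre_fillingD[OF P \<open>(r, j) \<in> F\<close>] by auto
  qed
  have empty: "(- d, c) \<notin> F'" if "1 \<le> d" "(- d, d) \<notin> F" for d c
  proof -
    have "(- d, c') \<notin> F" for c' using pre_filling_diagonal[OF P, of d c'] that by auto
    then show ?thesis by (simp add: mem)
  qed
  have neg: "(- d, d) \<in> F' \<longleftrightarrow> (- d, d) \<in> F" if "d \<in> C" for d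
  proof (cases "(- d, d) \<in> F")
    case True
    then have "d \<noteq> j" "d \<noteq> j + 1" using j by auto
    then show ?thesis by (simp add: mem)
  next
    case False
    then show ?thesis using empty pre_filling_cols[OF P that] by simp
  qed
  have P': "pre_filling n C F'"
    unfolding pre_filling_def
  proof (intro conjI ballI impI allI)
    show "C \<subseteq> {1..int n}" using P by (simp add: pre_filling_def)
    show "filling (horizon n) F'" using ex(2) by (simp add: F'_def)
    fix d c assume d: "d \<in> C" "(- d, d) \<notin> F'"
    then show "(- d, c) \<notin> F'" using empty neg pre_filling_cols[OF P d(1)] by simp
  qed (use sub in blast)+
  note k = col_pair_live[OF P j]
  have ends: "out_state n F' (transpose (col_in n j) (col_in n (j + 1)) s) = out_state n F s" for s
    using ex(1)[of s] by (simp add: out_state_def F'_def)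
  have "out_state n F' (col_in n (j + 1)) < out_state n F' (col_in n j)"
    unfolding out_state_def
  proof (rule cols_cross[OF pre_filling_filling[OF P'], of x])
    show "(x, j + 1) \<in> F'" using jx(1) \<open>x \<le> y\<close> by (simp add: mem)
    show "(r, j + 1) \<notin> F'" if "r < x" for r using that jy(2) \<open>x \<le> y\<close> by (simp add: mem)
    show "(r, j) \<notin> F'" if "r \<le> x" for r using that jx(2)[of r] \<open>x \<le> y\<close> by (cases "r = x") (auto simp: mem)
    show "x < j" by (rule bx(6))
  qed
  then have "out_state n F (col_in n j) < out_state n F (col_in n (j + 1))"
    using ends[of "col_in n j"] ends[of "col_in n (j + 1)"] by simp
  then have asc: "zeta_ascent n C F (nat j)" using k(6) by simp
  show "cover_step n C F C (replace_cols j x y F) (nat j)"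
    unfolding F'_def[symmetric]
  proof (rule cover_step_same_cols[OF P P' neg k(2,3) asc])
    show "int (nat j) \<in> C \<and> (- int (nat j), int (nat j)) \<in> F \<longleftrightarrow>
        int (nat j) + 1 \<in> C \<and> (- (int (nat j) + 1), int (nat j) + 1) \<in> F"
      using j unfolding k(1) by blast
    show "out_state n F' (transpose (live_in n C F (int (nat j))) (live_in n C F (int (nat j) + 1)) s)
        = out_state n F s" for s
      unfolding k(1,4,5) by (rule ends)
  qed
  show "\<exists>r. (r, c) \<in> replace_cols j x y F" if "(r, c) \<in> F" "c \<noteq> j"
  proof -
    have "(r, c) \<in> F'" using that by (auto simp: mem)
    then show ?thesis by (auto simp: F'_def)
  qed
qed

lemma ascent_cols:
  assumes P: "pre_filling n C F" and j: "j \<in> C" "j + 1 \<in> C" "(- j, j) \<notin> F" "(- (j + 1), j + 1) \<notin> F"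
    and y: "topmost_one F (j + 1) y" and asc: "zeta_ascent n C F (nat j)"
  obtains r where "r \<le> y" "(r, j) \<in> F"
proof -
  have jy: "(y, j + 1) \<in> F" "\<And>r. r < y \<Longrightarrow> (r, j + 1) \<notin> F" using y by (force simp: topmost_one_def)+
  have "y \<noteq> j" using pre_fillingD(4)[OF P jy(1)] j(1) by blast
  then have "y < j" using pre_fillingD(6)[OF P jy(1)] by simp
  moreover have "\<not> out_state n F (col_in n (j + 1)) < out_state n F (col_in n j)"
    using col_pair_live(6)[OF P j] asc by simp
  ultimately show ?thesis
    using cols_cross[OF pre_filling_filling[OF P] jy] that unfolding out_state_def by blast
qed

lemma horizon_bound:
  assumes "pre_filling n C F" "(r, c) \<in> F"
  shows "c - r < horizon n" "r < c"
  using pre_fillingD[OF assms] horizon_gt(1)[of n] by linarith+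

text \<open>Row -(i + 1) is empty and all 1's of row -i lie between the columns i and y, so the
  whole row -i moves up and its diagonal 1 merges with the imaginary one.\<close>

lemma mem_replace_imaginary_rows:
  assumes P: "pre_filling n C F" and i: "i \<in> C" "(- (i + 1), i + 1) \<notin> F" "(- i, i) \<in> F"
    and y: "leftmost_one F (- i) y"
  shows "(r, c) \<in> replace_rows (- (i + 1)) i y (insert (- (i + 1), i) F) \<longleftrightarrow>
    (if r = - (i + 1) then (- i, c) \<in> F else r \<noteq> - i \<and> (r, c) \<in> F)"
proof -
  define a where "a = - (i + 1)"
  have a1: "a + 1 = - i" by (simp add: a_def)
  have row_a: "(a, c) \<notin> F" for c
    using pre_filling_diagonal[OF P, of "i + 1" c] i(2) pre_filling_cols[OF P i(1)] by (auto simp: a_def)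
  have "i \<le> c \<and> c \<le> y" if "(- i, c) \<in> F" for c
    using y that pre_fillingD(2)[OF P that] by (force simp: leftmost_one_def)
  then show ?thesis
    unfolding a_def[symmetric] mem_replace_rows a1 using row_a i(3) by auto
qed

text \<open>Inserting the imaginary 1 only exchanges the ends of two paths that \<open>zeta\<close> does not use, the
  one from row \<open>- (i + 1)\<close> and the one from column \<open>i\<close>. Then the two replacement rules apply.\<close>

lemma cover_step_imaginary:
  assumes P: "pre_filling n C F" and i: "i \<in> C" "i + 1 \<in> C" "(- (i + 1), i + 1) \<notin> F" "(- i, i) \<in> F"
    and y: "leftmost_one F (- i) y"
    and F2: "F2 = replace_rows (- (i + 1)) i y (insert (- (i + 1), i) F)"
    and z: "(z, i) \<in> F2" "(z, i + 1) \<in> F2" "\<And>r. r < z \<Longrightarrow> (r, i + 1) \<notin> F2"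
  shows "cover_step n C F C (replace_cols i (- (i + 1)) z F2) (nat i)"
    and "(r, c) \<in> F \<Longrightarrow> c \<noteq> i \<Longrightarrow> \<exists>r. (r, c) \<in> replace_cols i (- (i + 1)) z F2"
proof -
  define a where "a = - (i + 1)"
  have a1: "a + 1 = - i" by (simp add: a_def)
  have i1: "1 \<le> i" "i + 1 \<le> int n" using pre_filling_cols[OF P] i(1,2) by force+
  have row_a: "(a, c) \<notin> F" for c
    using pre_filling_diagonal[OF P, of "i + 1" c] i(3) i1 by (auto simp: a_def)
  have iy: "i \<le> y" "(- i, y) \<in> F" "\<And>c. (- i, c) \<in> F \<Longrightarrow> i \<le> c \<and> c \<le> y"
    using y i(4) pre_fillingD(2)[OF P, of "- i"] by (force simp: leftmost_one_def)+
  define F1 where "F1 = insert (a, i) F"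
  have F2': "F2 = replace_rows a i y F1" by (simp add: F2 F1_def a_def)
  have mem2: "(r, c) \<in> F2 \<longleftrightarrow> (if r = a then (- i, c) \<in> F else r \<noteq> - i \<and> (r, c) \<in> F)" for r c
    unfolding F2 a_def by (rule mem_replace_imaginary_rows[OF P i(1,3,4) y])
  define F3 where "F3 = replace_cols i a z F2"
  note mem3 = mem_replace_cols[of _ _ i a z F2, folded F3_def]
  have F: "filling (horizon n) F" by (rule pre_filling_filling[OF P])
  have fill1: "filling (horizon n) F1"
  proof (rule fillingI)
    fix r c r' c'
    assume *: "r < c" "(r', c) \<in> F1" "r' < r" "(r, c') \<in> F1" "c < c'"
    consider "r' = a" "c = i" | "(r', c) \<in> F" "r = a" "c' = i" | "(r', c) \<in> F" "(r, c') \<in> F"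
      using *(2,4) by (auto simp: F1_def)
    then show "(r, c) \<in> F1"
    proof cases
      case 1
      then have "(r, c') \<in> F" using *(3-5) by (auto simp: F1_def)
      moreover have "- i \<le> r" using 1 *(3) a1 by simp
      ultimately show ?thesis
        using filling_corner[OF F *(1), of "- i" c'] * 1 i(4) by (cases "r = - i") (auto simp: F1_def)
    next
      case 2
      then show ?thesis using pre_fillingD(2)[OF P 2(1)] * a_def by simp
    next
      case 3
      then show ?thesis using filling_corner[OF F *(1) 3(1) *(3) 3(2) *(5)] by (simp add: F1_def)
    qed
  qed (use horizon_bound[OF P] i1 in \<open>auto simp: F1_def a_def horizon_def\<close>)
  \<comment> \<open>Both paths reach the box (a, i) straight from their starts: row a is empty, and
    column i has no 1 above this box.\<close>
  have E1: "out_state n F1 s = out_state n F (transpose (row_in a) (col_in n i) s)" for s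
    unfolding out_state_def
  proof (rule trail_toggle)
    show "b \<in> F1 \<longleftrightarrow> b \<in> F" if "b \<noteq> (a, i)" for b using that by (simp add: F1_def)
    show "(a, i) \<in> F1 \<longleftrightarrow> (a, i) \<notin> F" using row_a by (simp add: F1_def)
    show m: "- horizon n \<le> a - i" "a - i < 0" using i1 by (simp_all add: horizon_def a_def)
    show "trail F (horizon n) (row_in a) (a - i) = 2 * a + 1"
      using trail_row[of "horizon n" "- horizon n" "a - i" a F "row_in a"] row_a m
      by (simp add: row_in_def)
    have "(i + u, i) \<notin> F" if "u < a - i" for u
      using pre_fillingD(2)[OF P, of "i + u" i] that by (auto simp: a_def)
    then show "trail F (horizon n) (col_in n i) (a - i) = 2 * a"
      using trail_col[of "horizon n" "- horizon n" "a - i" i F "col_in n i"] m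
      by (simp add: col_start_state_def)
  qed
  have ex2: "out_state n F2 (transpose (row_in a) (row_in (a + 1)) s) = out_state n F1 s" "filling (horizon n) F2" for s
  proof -
    have ones: "(a, i) \<in> F1" "(a + 1, i) \<in> F1" "(a + 1, y) \<in> F1"
      using i(4) iy(2) by (simp_all add: F1_def a1)
    have "(a + 1, c) \<notin> F1" if "y < c" for c using that iy(3)[of c] unfolding a1 by (auto simp: F1_def a_def)
    moreover have "(a, c) \<notin> F1" if "i < c" for c using that row_a by (simp add: F1_def)
    moreover have "y - a < horizon n"
      using pre_fillingD(7)[OF P iy(2)] i1 by (simp add: a_def horizon_def)
    ultimately show "out_state n F2 (transpose (row_in a) (row_in (a + 1)) s) = out_state n F1 s"
      "filling (horizon n) F2"
      unfolding out_state_def F2' using replace_rows_exchange[OF fill1 iy(1) ones] by blast+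
  qed
  have "a \<le> z"
  proof (cases "z = a")
    case False
    then have "(z, i + 1) \<in> F" using z(2) by (simp add: mem2)
    then show ?thesis using pre_fillingD(2)[OF P, of z "i + 1"] by (simp add: a_def)
  qed simp
  have top: "(r, i) \<notin> F2" if "r < a" for r
    using pre_fillingD(2)[OF P, of r i] that by (auto simp: mem2 a_def)
  have ai: "(a, i) \<in> F2" using i(4) by (simp add: mem2)
  have bound: "i + 1 - a < horizon n" using i1 by (simp add: a_def horizon_def)
  have ex3: "out_state n F3 (transpose (col_in n i) (col_in n (i + 1)) s) = out_state n F2 s"
    "filling (horizon n) F3" for s
    unfolding out_state_def F3_def
    by (rule replace_cols_exchange[OF ex2(2) \<open>a \<le> z\<close> ai z(1,2) top z(3) bound]; assumption?)+
  have src: "\<exists>c0 r0. (r0, c0) \<in> F \<and> (r0 = r \<or> r = a \<and> r0 = - i) \<and> (c0 = c \<or> c0 = i \<and> c = i + 1)"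
    if "(r, c) \<in> F3" for r c
    using that by (auto simp: mem3 mem2 split: if_splits)
  have ai3: "(a, i) \<notin> F3" "(a, i + 1) \<in> F3" using \<open>a \<le> z\<close> ai by (simp_all add: mem3)
  have sub: "c \<in> C \<and> \<bar>r\<bar> \<le> c \<and> r \<noteq> 0 \<and> r \<notin> C \<and> (r < 0 \<longrightarrow> - r \<in> C)" if rc: "(r, c) \<in> F3" for r c
  proof -
    obtain c0 r0 where r0: "(r0, c0) \<in> F" "r0 = r \<or> r = a \<and> r0 = - i" "c0 = c \<or> c0 = i \<and> c = i + 1"
      using src[OF rc] by blast
    note b = pre_fillingD[OF P r0(1)]
    have c: "c \<in> C" "c0 \<le> c" using r0(3) b(1) i(2) by auto
    have "i + 1 \<le> c" if "r = a"
    proof -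
      have "c \<noteq> i" using ai3(1) rc that by auto
      moreover have "i \<le> c0" using r0(1,2) that row_a iy(3) by auto
      ultimately show ?thesis using c(2) by simp
    qed
    moreover have "a \<notin> C" using pre_filling_cols[OF P, of a] i1 by (auto simp: a_def)
    moreover have "1 + i \<in> C" using i(2) by (metis add.commute)
    ultimately show ?thesis using c b r0(2) by (auto simp: a_def)
  qed
  have row_i: "(- i, c) \<notin> F3" for c using a1 by (auto simp: mem3 mem2)
  have neg: "(- d, d) \<in> F3 \<longleftrightarrow> (- d, d) \<in> F" if "d \<noteq> i" "d \<noteq> i + 1" for d
    using that by (auto simp: mem3 mem2 a_def)
  have P3: "pre_filling n C F3"
    unfolding pre_filling_def
  proof (intro conjI ballI impI allI)
    show "C \<subseteq> {1..int n}" using P by (simp add: pre_filling_def)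
    fix d c assume d: "d \<in> C" "(- d, d) \<notin> F3"
    show "(- d, c) \<notin> F3"
    proof (cases "d = i")
      case True
      then show ?thesis using row_i by simp
    next
      case False
      moreover have "d \<noteq> i + 1" using d(2) ai3(2) by (auto simp: a_def)
      ultimately have "(- d, d) \<notin> F" "- d \<noteq> a" using neg d(2) by (auto simp: a_def)
      then have "(- d, c') \<notin> F" for c'
        using pre_filling_diagonal[OF P, of d c'] pre_filling_cols[OF P d(1)] by auto
      then show ?thesis using src[of "- d" c] \<open>- d \<noteq> a\<close> by blast
    qed
  qed (use sub ex3(2) in blast)+
  have k: "int (nat i) = i" "nat i < n" "nat i \<noteq> 0" using i1 by simp_all
  \<comment> \<open>Here the ascent is a matter of signs: the diagonals differ, so the value at i is
    negative and the one at i + 1 is not.\<close>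
  have "zeta_val n C F i < 0" "\<not> zeta_val n C F (i + 1) < 0"
    using out_state_zeta_val(4)[OF P, of i] out_state_zeta_val(4)[OF P, of "i + 1"] i i1 by auto
  then have asc: "zeta_ascent n C F (nat i)" using k(3) by (simp add: zeta_ascent_def)
  \<comment> \<open>The three exchanges composed, as seen by the live starts: column i takes over
    the end of column i + 1, and row -(i + 1) that of row -i.\<close>
  have end1: "out_state n F3 (col_in n i) = out_state n F (col_in n (i + 1))"
    using ex3(1)[of "col_in n (i + 1)"] ex2(1)[of "col_in n (i + 1)"] E1[of "col_in n (i + 1)"]
    by (simp add: transpose_def)
  have end2: "out_state n F3 (row_in a) = out_state n F (row_in (- i))"
  proof -
    have "- i \<noteq> a" using a1 by simp
    then show ?thesis
      using ex3(1)[of "row_in a"] ex2(1)[of "row_in (a + 1)"] E1[of "row_in (a + 1)"]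
      by (simp add: transpose_def a1)
  qed
  have end3: "out_state n F3 s = out_state n F s"
    if "s \<notin> {row_in a, row_in (- i), col_in n i, col_in n (i + 1)}" for s
    using ex3(1)[of s] ex2(1)[of s] E1[of s] that by (simp add: transpose_def a1)
  have "zeta_val n C F3 j = zeta_ext n C F (gen (nat i) j)" if j: "1 \<le> j" "j \<le> int n" for j
  proof -
    consider "j = i" | "j = i + 1" | "j \<noteq> i" "j \<noteq> i + 1" by blast
    then show ?thesis
    proof cases
      case 1
      then have "gen (nat i) j = i + 1" using k by (simp add: gen_apply)
      then show ?thesis using 1 i i1 row_i end1 by (simp add: zeta_ext_def zeta_val_def live_in_def)
    next
      case 2
      then have g: "gen (nat i) j = i" using k by (simp add: gen_apply)
      have "live_in n C F3 (i + 1) = row_in a" using i ai3(2) by (simp add: live_in_def a_def)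
      moreover have "live_in n C F i = row_in (- i)" using i by (simp add: live_in_def)
      moreover have "(- (i + 1), i + 1) \<in> F3" using ai3(2) by (simp add: a_def)
      ultimately show ?thesis unfolding g unfolding 2 using i i1 end2 by (simp add: zeta_ext_def zeta_val_def)
    next
      case 3
      then have g: "gen (nat i) j = j" using j i1 by (simp add: gen_apply)
      have "live_in n C F j \<notin> {row_in a, row_in (- i), col_in n i, col_in n (i + 1)}"
        using 3 j i1 by (auto simp: live_in_def a_def)
      moreover have "live_in n C F3 j = live_in n C F j" using neg 3 by (simp add: live_in_def)
      ultimately show ?thesis unfolding g using j neg[OF 3] end3 by (simp add: zeta_ext_def zeta_val_def)
    qed
  qed
  then show "cover_step n C F C (replace_cols i (- (i + 1)) z F2) (nat i)"
    unfolding cover_step_def using P3 k(2) asc by (simp add: F3_def a_def)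
  show "\<exists>r. (r, c) \<in> replace_cols i (- (i + 1)) z F2" if "(r, c) \<in> F" "c \<noteq> i"
  proof -
    have "(r, c) \<in> F2 \<or> (a, c) \<in> F2" using that row_a by (auto simp: mem2)
    then have "(r, c) \<in> F3 \<or> (a, c) \<in> F3" using that(2) by (auto simp: mem3)
    then show ?thesis by (auto simp: F3_def a_def)
  qed
qed

section \<open>Relabeling by swaps of an empty row or column with its neighbour, and the new
  box\<close>

lemma out_row_swap:
  assumes mem: "\<And>r c. (r, c) \<in> F' \<longleftrightarrow> (transpose a (a + 1) r, c) \<in> F" and "\<And>c. (a, c) \<notin> F"
    and bounds: "(a + 1, a + 1) \<notin> F" "(a + 1, a + 1 + horizon n) \<notin> F"
  shows "out_state n F' (transpose (row_in a) (row_in (a + 1)) s) =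
    transpose (2 * a + 1) (2 * a + 3) (out_state n F s)"
proof -
  have "trail F' (horizon n) (transpose (2 * a + 1) (2 * a + 3) s) 0 =
      transpose (2 * a + 1) (2 * a + 3) (trail F (horizon n) s 0)"
    by (rule trail_empty_row_exchange) (use assms horizon_gt[of n] in \<open>simp_all add: transpose_def\<close>)
  moreover have "row_in (a + 1) = 2 * a + 3" "row_in a = 2 * a + 1" by (simp_all add: row_in_def)
  ultimately show ?thesis by (simp only: out_state_def)
qed

lemma out_state_mirror_state: "out_state n (mirror F) (1 - 2 * horizon n - s) = 1 - out_state n F s"
  using trail_mirror[of "horizon n" 0 F s] horizon_gt[of n] by (simp add: out_state_def)

lemma out_col_swap:
  assumes mem: "\<And>r c. (r, c) \<in> F' \<longleftrightarrow> (r, transpose j (j + 1) c) \<in> F" and "\<And>r. (r, j + 1) \<notin> F"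
    and bounds: "(j, j) \<notin> F" "(j - horizon n, j) \<notin> F"
  shows "out_state n F' (transpose (col_in n j) (col_in n (j + 1)) s) =
    transpose (2 * j) (2 * j + 2) (out_state n F s)"
proof -
  define a where "a = - (j + 1)"
  have a1: "a + 1 = - j" by (simp add: a_def)
  have "out_state n (mirror F') (transpose (row_in a) (row_in (a + 1)) (1 - 2 * horizon n - s)) =
      transpose (2 * a + 1) (2 * a + 3) (out_state n (mirror F) (1 - 2 * horizon n - s))"
  proof (rule out_row_swap)
    show "(r, c) \<in> mirror F' \<longleftrightarrow> (transpose a (a + 1) r, c) \<in> mirror F" for r c
      unfolding mem_mirror mem a1 by (auto simp: transpose_def a_def)
    show "(a, c) \<notin> mirror F" for c using assms(2)[of "- c"] unfolding mem_mirror a_def minus_minus .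
  qed (use bounds in \<open>simp_all add: a1\<close>)
  moreover have "transpose (row_in a) (row_in (a + 1)) (1 - 2 * horizon n - s) =
      1 - 2 * horizon n - transpose (col_in n j) (col_in n (j + 1)) s"
    by (auto simp: transpose_def row_in_def col_start_state_def a_def)
  moreover have "transpose (2 * a + 1) (2 * a + 3) (1 - p) = 1 - transpose (2 * j) (2 * j + 2) p" for p
    by (auto simp: transpose_def a_def)
  ultimately show ?thesis by (simp add: out_state_mirror_state)
qed

text \<open>No further turn follows to the right in row r or below in column c, so the two paths
  entering the box go straight to the ends of this row and this column. The new 1 exchanges these
  ends.\<close>

lemma out_insert_corner:
  assumes "r < c" "c - r < horizon n" and "(r, c) \<notin> F"
    and row: "\<And>c'. c' < c \<Longrightarrow> (r, c') \<notin> F" and col: "\<And>r'. r < r' \<Longrightarrow> (r', c) \<notin> F"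
  shows "out_state n (insert (r, c) F) s = transpose (2 * r + 1) (2 * c) (out_state n F s)"
proof -
  let ?m = "horizon n"
  have m: "- ?m \<le> r - c" using assms(2) by simp
  obtain P Q where PQ: "trail F ?m P (r - c) = 2 * r + 1" "trail F ?m Q (r - c) = 2 * r"
    using trail_surj m by metis
  have out: "out_state n F P = 2 * r + 1" "out_state n F Q = 2 * c"
  proof -
    have "(r, r - u) \<notin> F" if "r - c \<le> u" for u using row[of "r - u"] assms(3) that by (cases "r - u = c") auto
    then show "out_state n F P = 2 * r + 1"
      using trail_row[of ?m "r - c" 0 r F P] m PQ assms(1) by (simp add: out_state_def)
    have "(c + u, c) \<notin> F" if "r - c \<le> u" for u using col[of "c + u"] assms(3) that by (cases "c + u = r") auto
    then show "out_state n F Q = 2 * c"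
      using trail_col[of ?m "r - c" 0 c F Q] m PQ assms(1) by (simp add: out_state_def)
  qed
  have "out_state n (insert (r, c) F) s = out_state n F (transpose P Q s)"
    unfolding out_state_def by (rule trail_toggle[of r c _ _ _ P Q]) (use assms m PQ in auto)
  also have "\<dots> = transpose (out_state n F P) (out_state n F Q) (out_state n F s)"
    by (auto simp: transpose_def out_state_eq_iff)
  finally show ?thesis by (simp only: out)
qed

lemma mem_gen_image: "(r, c) \<in> map_prod (gen k) (gen k) ` F \<longleftrightarrow> (gen k r, gen k c) \<in> F"
proof
  assume "(gen k r, gen k c) \<in> F"
  then have "map_prod (gen k) (gen k) (gen k r, gen k c) \<in> map_prod (gen k) (gen k) ` F" by (rule imageI)
  then show "(r, c) \<in> map_prod (gen k) (gen k) ` F" by simp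
qed auto

lemma mem_gen_cols:
  assumes "\<And>c. c \<in> C \<Longrightarrow> 1 \<le> c" "1 \<le> k" "int k + 1 \<notin> C"
  shows "c \<in> insert (int k + 1) (C - {int k}) \<longleftrightarrow> c = int k + 1 \<or> (gen k c \<in> C \<and> 1 \<le> c)"
    (is "?lhs \<longleftrightarrow> ?rhs")
  using assms assms(1)[of "- int k"] assms(1)[of "- int k - 1"] by (auto simp: gen_apply split: if_splits)

context
  fixes n :: nat and C :: "int set" and F :: "(int \<times> int) set" and k :: nat
  assumes P: "pt_filling n C F" and k: "1 \<le> k" "int k + 1 \<le> int n" "int k + 1 \<notin> C"
    and row: "\<And>c. (int k, c) \<notin> F"
begin

text \<open>Common to adding a box and to the zero-row rule. No 1 lies in row k if k labels a
  column, either; in that case this column label is replaced by k + 1, while for a zero row nothing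
  is removed.\<close>

definition relabel_cols :: "int set" where
  "relabel_cols = insert (int k + 1) (C - {int k})"

definition relabel_ones :: "(int \<times> int) set" where
  "relabel_ones = insert (int k, int k + 1) (map_prod (gen k) (gen k) ` F)"

private lemma old_filling: "pre_filling n C F"
  using P by (simp add: pt_filling_iff)

private lemma mem_relabel_ones: "(r, c) \<in> relabel_ones \<longleftrightarrow> (r = int k \<and> c = int k + 1) \<or> (gen k r, gen k c) \<in> F"
  unfolding relabel_ones_def insert_iff mem_gen_image by simp

private lemma relabel_one_row:
  assumes "(gen k r, c) \<in> F"
  shows "r \<noteq> int k + 1" "r \<noteq> - int k" "r \<noteq> 0"
  using assms row[of c] pre_fillingD(3,5)[OF old_filling assms] k(3)[unfolded add.commute[of "int k"]] by (auto simp: gen_apply split: if_splits)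

private lemma relabel_one_col:
  assumes "(r, gen k c) \<in> F"
  shows "c \<noteq> int k" "1 \<le> c"
  using pre_fillingD(1,8)[OF old_filling assms] k by (auto simp: gen_apply split: if_splits)

private lemma relabel_mono: "r < r' \<Longrightarrow> r \<noteq> int k + 1 \<or> r' \<noteq> int k + 1 \<Longrightarrow> r \<noteq> - int k \<Longrightarrow> r' \<noteq> - int k \<Longrightarrow>
    r' \<noteq> int k + 1 \<Longrightarrow> gen k r < gen k r'"
  using k by (auto simp: gen_apply split: if_splits)

private lemma relabel_mono_col: "c < c' \<Longrightarrow> 1 \<le> c \<Longrightarrow> c \<noteq> int k \<Longrightarrow> gen k c < gen k c'"
  by (auto simp: gen_apply split: if_splits)

private lemma relabel_less: "r < c \<Longrightarrow> r \<noteq> int k + 1 \<Longrightarrow> 1 \<le> c \<Longrightarrow> c \<noteq> int k \<Longrightarrow>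
    \<not> (r = int k \<and> c = int k + 1) \<Longrightarrow> gen k r < gen k c"
  using k by (auto simp: gen_apply split: if_splits)

private lemma mem_relabel_cols: "c \<in> relabel_cols \<longleftrightarrow> c = int k + 1 \<or> (gen k c \<in> C \<and> 1 \<le> c)"
  unfolding relabel_cols_def by (rule mem_gen_cols) (use pre_filling_cols[OF old_filling] k in auto)

lemma relabel_pt_filling: "pt_filling n relabel_cols relabel_ones"
proof -
  have sub: "c \<in> relabel_cols \<and> \<bar>r\<bar> \<le> c \<and> r \<noteq> 0 \<and> r \<notin> relabel_cols \<and> (r < 0 \<longrightarrow> - r \<in> relabel_cols)"
    if rc: "(r, c) \<in> relabel_ones" for r c
  proof (cases "r = int k \<and> c = int k + 1")
    case True
    then show ?thesis using k by (auto simp: relabel_cols_def)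
  next
    case False
    then have m: "(gen k r, gen k c) \<in> F" using rc unfolding mem_relabel_ones by blast
    note b = pre_fillingD[OF old_filling m] and r = relabel_one_row[OF m] and c = relabel_one_col[OF m]
    have "\<bar>r\<bar> \<le> c" using b(2) r c k by (auto simp: gen_apply split: if_splits)
    moreover have "r < 0 \<Longrightarrow> gen k r < 0" using k by (simp add: gen_apply)
    ultimately show ?thesis
      unfolding mem_relabel_cols gen_minus using b r by auto
  qed
  have C: "relabel_cols \<subseteq> {1..int n}"
    using pre_filling_cols[OF old_filling] k by (force simp: relabel_cols_def)
  have "filling (horizon n) relabel_ones"
  proof (rule fillingI)
    fix r c assume rc: "(r, c) \<in> relabel_ones"
    have "r \<noteq> c" "c \<le> int n" using sub[OF rc] C by force+
    then show "r < c" "c - r < horizon n"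
      using sub[OF rc] horizon_gt(1)[of n] by auto
  next
    fix r c r' c'
    assume *: "r < c" "(r', c) \<in> relabel_ones" "r' < r" "(r, c') \<in> relabel_ones" "c < c'"
    show "(r, c) \<in> relabel_ones"
    proof (cases "r = int k \<and> c = int k + 1")
      case False
      then have "(gen k r', gen k c) \<in> F" "(gen k r, gen k c') \<in> F" using *
        by (auto simp: mem_relabel_ones)
      note m = this
      have "gen k r < gen k c" by (rule relabel_less) (use * relabel_one_row[OF m(2)] relabel_one_col[OF m(1)] False in auto)
      moreover have "gen k r' < gen k r" by (rule relabel_mono) (use * relabel_one_row[OF m(1)] relabel_one_row[OF m(2)] in auto)
      moreover have "gen k c < gen k c'" by (rule relabel_mono_col) (use * relabel_one_col[OF m(1)] in auto)
      ultimately show ?thesis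
        using filling_corner[OF pre_filling_filling[OF old_filling], of "gen k r" "gen k c" "gen k r'" "gen k c'"] m
        by (simp add: mem_relabel_ones)
    qed (simp add: mem_relabel_ones)
  qed
  moreover have "(- d, c) \<notin> relabel_ones" if d: "d \<in> relabel_cols" "(- d, d) \<notin> relabel_ones" for d c
  proof
    assume "(- d, c) \<in> relabel_ones"
    moreover have "1 \<le> d" using C d by auto
    ultimately have m: "(- gen k d, gen k c) \<in> F" by (auto simp: mem_relabel_ones gen_minus)
    then have "0 < gen k d" using \<open>1 \<le> d\<close> k by (simp add: gen_apply)
    then have "(- gen k d, gen k d) \<in> F" using pre_filling_diagonal[OF old_filling m] by simp
    then show False using d(2) by (simp add: mem_relabel_ones gen_minus)
  qed
  moreover have "\<exists>r. (r, c) \<in> relabel_ones" if c: "c \<in> relabel_cols" for c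
  proof (cases "c = int k + 1")
    case True
    then show ?thesis by (auto simp: mem_relabel_ones)
  next
    case False
    then have "c \<in> C" "c \<noteq> int k" "1 \<le> c" using c C by (auto simp: relabel_cols_def)
    then obtain r where "(r, c) \<in> F" using P by (auto simp: pt_filling_def)
    moreover have "gen k c = c" using \<open>c \<noteq> int k\<close> \<open>1 \<le> c\<close> False by (simp add: gen_apply)
    ultimately have "(gen k r, c) \<in> relabel_ones" by (simp add: mem_relabel_ones)
    then show ?thesis by blast
  qed
  ultimately show ?thesis
    unfolding pt_filling_iff pre_filling_def using sub C by blast
qed

private definition moved :: "(int \<times> int) set" where
  "moved = {(r, c). (gen k r, gen k c) \<in> F}"

text \<open>\<open>gen k\<close> is composed of three swaps of neighbours, one of which is empty
  each time: row k, row -(k + 1) because k + 1 is not a column label, and column k + 1 for the same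
  reason.\<close>

private lemma out_moved:
  "out_state n moved (transpose (col_in n (int k)) (col_in n (int k + 1))
     (transpose (row_in (- int k - 1)) (row_in (- int k)) (transpose (row_in (int k)) (row_in (int k + 1)) s))) =
   transpose (2 * int k) (2 * int k + 2)
     (transpose (- 2 * int k - 1) (- 2 * int k + 1)
       (transpose (2 * int k + 1) (2 * int k + 3) (out_state n F s)))"
proof -
  define i where "i = int k"
  define F1 where "F1 = {(r, c). (transpose i (i + 1) r, c) \<in> F}"
  define F2 where "F2 = {(r, c). (transpose (- i - 1) (- i) r, c) \<in> F1}"
  have far: "(r, c) \<notin> F" if "c \<le> r \<or> horizon n \<le> c - r" for r c
    using that horizon_bound[OF old_filling, of r c] by auto
  have i1: "1 \<le> i" "i + 1 \<notin> C" using k by (simp_all add: i_def)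
  have e1: "out_state n F1 (transpose (row_in i) (row_in (i + 1)) s) =
      transpose (2 * i + 1) (2 * i + 3) (out_state n F s)" for s
    by (rule out_row_swap) (use row far in \<open>simp_all add: F1_def i_def\<close>)
  define a where "a = - i - 1"
  have a1: "a + 1 = - i" by (simp add: a_def)
  have rowa: "(a, c) \<notin> F" for c
    using pre_fillingD(5)[OF old_filling, of a c] i1 i1(2)[unfolded add.commute[of i]] by (auto simp: a_def)
  have e2: "out_state n F2 (transpose (row_in a) (row_in (a + 1)) s) =
      transpose (2 * a + 1) (2 * a + 3) (out_state n F1 s)" for s
    by (rule out_row_swap) (use i1 rowa far in \<open>auto simp: F2_def F1_def transpose_def a_def\<close>)
  have colj: "(r, i + 1) \<notin> F" for r using pre_fillingD(1)[OF old_filling, of r "i + 1"] i1 by blast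
  have e3: "out_state n moved (transpose (col_in n i) (col_in n (i + 1)) s) =
      transpose (2 * i) (2 * i + 2) (out_state n F2 s)" for s
  proof (rule out_col_swap)
    fix r c
    have "gen k r = transpose i (i + 1) (transpose (- i - 1) (- i) r)"
      using i1 by (auto simp: gen_apply transpose_def i_def)
    moreover have "(x, gen k c) \<in> F \<longleftrightarrow> (x, transpose i (i + 1) c) \<in> F" for x
    proof (cases "1 \<le> c")
      case True
      then show ?thesis using i1 by (simp add: gen_apply transpose_def i_def)
    next
      case False
      then have "\<not> 1 \<le> gen k c" "\<not> 1 \<le> transpose i (i + 1) c"
        using i1 by (auto simp: gen_apply transpose_def i_def)
      then show ?thesis using pre_fillingD(8)[OF old_filling] by blast
    qed
    ultimately show "(r, c) \<in> moved \<longleftrightarrow> (r, transpose i (i + 1) c) \<in> F2"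
      by (simp add: moved_def F2_def F1_def)
  next
    show "(r, i + 1) \<notin> F2" for r using colj by (simp add: F2_def F1_def)
    show "(i, i) \<notin> F2" "(i - horizon n, i) \<notin> F2"
      using far i1 k(2)[folded i_def] by (auto simp: F2_def F1_def transpose_def horizon_def)
  qed
  show ?thesis
  proof -
    have "- 2 * i - 1 = 2 * a + 1" "- 2 * i + 1 = 2 * a + 3" by (simp_all add: a_def)
    then show ?thesis
      by (simp only: e3 e2 e1 i_def[symmetric] a_def[symmetric] a1[symmetric] add_diff_cancel_right')
  qed
qed

private lemma out_relabel:
  "out_state n relabel_ones s = transpose (2 * int k + 1) (2 * int k + 2) (out_state n moved s)"
proof -
  have eq: "relabel_ones = insert (int k, int k + 1) moved"
    unfolding relabel_ones_def moved_def by (auto simp: mem_gen_image)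
  have empty: "(int k, c') \<notin> moved" if "c' \<le> int k + 1" for c'
  proof
    assume "(int k, c') \<in> moved"
    then have m: "(int k + 1, gen k c') \<in> F" using k by (simp add: moved_def gen_apply)
    show False using pre_fillingD(6)[OF old_filling m] that by (auto simp: gen_apply split: if_splits)
  qed
  have "(r', int k + 1) \<notin> moved" if "int k < r'" for r'
  proof
    assume "(r', int k + 1) \<in> moved"
    then have m: "(gen k r', int k) \<in> F" using k by (simp add: moved_def gen_apply)
    show False using pre_fillingD(6)[OF old_filling m] that k by (auto simp: gen_apply split: if_splits)
  qed
  then show ?thesis
    using out_insert_corner[of "int k" "int k + 1" n moved s] empty
    unfolding eq by (simp add: horizon_def algebra_simps)
qed

text \<open>Relabeling alone would change positions and values by \<open>gen k\<close>. The new box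
  exchanges the ends in row k and column k + 1, which restores the values and leaves the change of
  positions.\<close>

lemma cover_step_relabel: "cover_step n C F relabel_cols relabel_ones k"
proof -
  define i where "i = int k"
  have i1: "1 \<le> i" "i + 1 \<le> int n" "i + 1 \<notin> C" using k by (simp_all add: i_def)
  have zi: "int k \<in> C \<Longrightarrow> zeta_val n C F (int k) < int k"
    using P zeta_val_col_less[OF old_filling, of "int k"] by (auto simp: pt_filling_def)
  have zi': "int k \<notin> C \<Longrightarrow> zeta_val n C F (int k) = int k"
    using zeta_val_empty_row[OF old_filling row] by blast
  have zi1: "int k + 1 \<le> zeta_val n C F (int k + 1)"
    using zeta_val_row_ge[OF old_filling] k by simp
  have asc: "zeta_ascent n C F k"
    using zi zi' zi1 k by (cases "int k \<in> C") (auto simp: zeta_ascent_def)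
  have main: "zeta_val n relabel_cols relabel_ones (gen k j) = zeta_val n C F j"
    if j: "1 \<le> j" "j \<le> int n" for j
  proof (cases "j = i \<and> i \<notin> C")
    \<comment> \<open>The zero row: label i passes from row i to the new column i + 1, a start of
      another kind. In that column the only 1 is the new box, where the path turns and leaves along
      row i, in accordance with the value i of an empty row.\<close>
    case True
    then have g: "gen k j = i + 1" by (simp add: gen_apply i_def) (use k in simp)
    have "(- (i + 1), i + 1) \<notin> relabel_ones"
      using True pre_fillingD(1)[OF old_filling, of "- i" i] k by (auto simp: mem_relabel_ones gen_apply i_def)
    moreover have "i + 1 \<in> relabel_cols" by (simp add: relabel_cols_def i_def)
    moreover have "out_state n relabel_ones (col_in n (i + 1)) = 2 * i + 1"
    proof -
      have "(r, i + 1) \<notin> moved" for r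
        using True pre_fillingD(1)[OF old_filling, of "gen k r" i] k by (auto simp: moved_def gen_apply i_def)
      then have "out_state n moved (col_in n (i + 1)) = 2 * (i + 1)" by (rule out_empty_col)
      then show ?thesis using out_relabel by (simp add: i_def transpose_def)
    qed
    ultimately show ?thesis unfolding g using True zi' by (simp add: zeta_val_def live_in_def i_def)
  next
    case False
    define v where "v = \<bar>zeta_val n C F j\<bar>"
    have out: "out_state n F (live_in n C F j) = label_out C v" and v: "1 \<le> v" "v \<le> int n"
      using out_state_zeta_val[OF old_filling j] by (simp_all add: v_def)
    have vi: "v \<noteq> i" if "i \<notin> C"
    proof -
      have "j \<noteq> i" using False that by blast
      then show ?thesis
        using zeta_val_abs_eq_iff[OF old_filling j, of i] zi' that i1 by (simp add: v_def i_def)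
    qed
    have gj: "1 \<le> gen k j" "gen k j = i \<longleftrightarrow> j = i + 1" "gen k j = i + 1 \<longleftrightarrow> j = i"
      using j k by (auto simp: gen_apply i_def)
    have diag: "(- gen k j, gen k j) \<in> relabel_ones \<longleftrightarrow> (- j, j) \<in> F"
      by (auto simp: mem_relabel_ones gen_minus)
    have col: "gen k j \<in> relabel_cols \<longleftrightarrow> j \<in> C"
      using gj False by (auto simp: mem_relabel_cols i_def)
    have live: "live_in n relabel_cols relabel_ones (gen k j) =
        transpose (col_in n i) (col_in n (i + 1))
          (transpose (row_in (- i - 1)) (row_in (- i)) (transpose (row_in i) (row_in (i + 1)) (live_in n C F j)))"
    proof -
      consider "j = i" | "j = i + 1" | "j \<noteq> i" "j \<noteq> i + 1" by blast
      then show ?thesis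
      proof cases
        case 1
        then have "gen k j = i + 1" using gj by simp
        then show ?thesis using 1 i1 diag col by (auto simp: live_in_def transpose_def)
      next
        case 2
        then have "gen k j = i" using gj by simp
        then show ?thesis using 2 i1 col by (auto simp: live_in_def transpose_def)
      next
        case 3
        then have "gen k j = j" using j by (simp add: gen_apply i_def)
        then show ?thesis using 3 j i1 diag col by (auto simp: live_in_def transpose_def)
      qed
    qed
    have "out_state n relabel_ones (live_in n relabel_cols relabel_ones (gen k j)) =
        transpose (2 * i + 1) (2 * i + 2) (transpose (2 * i) (2 * i + 2)
          (transpose (- 2 * i - 1) (- 2 * i + 1) (transpose (2 * i + 1) (2 * i + 3) (label_out C v))))"
      unfolding live out_relabel using out_moved[of "live_in n C F j"] by (simp add: i_def out)
    also have "\<dots> div 2 = v"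
    proof -
      have low: "label_out C v \<noteq> - 2 * i - 1" "label_out C v \<noteq> - 2 * i + 1" using v i1 by (auto simp: label_out_def)
      \<comment> \<open>The final states pass through the swaps as follows: column i, at 2i, goes to
        2i + 2 and on to 2i + 1, so that i is now a row; row i + 1, at 2i + 3, goes to 2i + 1 and on
        to 2i + 2, so that i + 1 is now a column.\<close>
      consider "v = i" "i \<in> C" | "v = i + 1" | "v \<noteq> i" "v \<noteq> i + 1" using vi by blast
      then show ?thesis
      proof cases
        case 1
        then have "label_out C v = 2 * i" by (simp add: label_out_def)
        then show ?thesis using 1 i1 by (simp add: transpose_def)
      next
        case 2
        then have "label_out C v = 2 * i + 3" using i1 by (simp add: label_out_def)
        then show ?thesis using 2 i1 by (simp add: transpose_def)
      next
        case 3
        then have "label_out C v \<notin> {2 * i, 2 * i + 1, 2 * i + 2, 2 * i + 3}"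
          by (auto simp: label_out_def split: if_splits)
        then show ?thesis using low by (simp add: transpose_def)
      qed
    qed
    finally have "out_state n relabel_ones (live_in n relabel_cols relabel_ones (gen k j)) div 2 = v" .
    then show ?thesis unfolding zeta_val_def diag col out label_out_div by simp
  qed
  have "zeta_val n relabel_cols relabel_ones j = zeta_ext n C F (gen k j)" if "1 \<le> j" "j \<le> int n" for j
  proof -
    have "1 \<le> gen k j" "gen k j \<le> int n" using that k by (auto simp: gen_apply)
    then show ?thesis using main[of "gen k j"] by (simp add: zeta_ext_def)
  qed
  then show ?thesis
    using asc k relabel_pt_filling by (simp add: cover_step_def pt_filling_iff)
qed

end

context
  fixes n :: nat and C :: "int set" and F :: "(int \<times> int) set"
  assumes P: "pt_filling n C F" and n: "1 \<le> n" "1 \<notin> C"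
begin

private lemma unstair_filling: "pre_filling n C F"
  using P by (simp add: pt_filling_iff)

private lemma stair_col: "(r, c) \<in> F \<Longrightarrow> 2 \<le> c"
  using pre_fillingD(1,8)[OF unstair_filling] n(2) by (metis add1_zle_eq le_less one_add_one)

private lemma stair_row: "(- 1, c) \<notin> F" "(0, c) \<notin> F"
  using pre_fillingD(3,5)[OF unstair_filling] n(2) by force+

definition stair_ones :: "(int \<times> int) set" where
  "stair_ones = insert (- 1, 1) (map_prod (gen 0) (gen 0) ` F)"

private lemma mem_stair_ones: "(r, c) \<in> stair_ones \<longleftrightarrow> (r = - 1 \<and> c = 1) \<or> (gen 0 r, c) \<in> F"
proof -
  have "(gen 0 r, gen 0 c) \<in> F \<longleftrightarrow> (gen 0 r, c) \<in> F"
    using stair_col[of "gen 0 r" c] stair_col[of "gen 0 r" "gen 0 c"] by (auto simp: gen_apply)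
  then show ?thesis unfolding stair_ones_def insert_iff mem_gen_image by simp
qed

private lemma stair_one_row: "(gen 0 r, c) \<in> F \<Longrightarrow> r \<noteq> 0 \<and> r \<noteq> 1"
  using stair_row[of c] by (auto simp: gen_apply split: if_splits)

lemma stair_pt_filling: "pt_filling n (insert 1 C) stair_ones"
proof -
  have sub: "c \<in> insert 1 C \<and> \<bar>r\<bar> \<le> c \<and> r \<noteq> 0 \<and> r \<notin> insert 1 C \<and> (r < 0 \<longrightarrow> - r \<in> insert 1 C)"
    if rc: "(r, c) \<in> stair_ones" for r c
  proof (cases "r = - 1 \<and> c = 1")
    case True
    then show ?thesis using pre_filling_cols[OF unstair_filling, of "- 1"] by auto
  next
    case False
    then have m: "(gen 0 r, c) \<in> F" using rc unfolding mem_stair_ones by blast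
    have "r = - 1 \<or> gen 0 r = r" using stair_one_row[OF m] by (auto simp: gen_apply)
    then show ?thesis
    proof
      assume "r = - 1"
      then show ?thesis using pre_fillingD[OF unstair_filling m] pre_filling_cols[OF unstair_filling, of "- 1"] by auto
    next
      assume "gen 0 r = r"
      then show ?thesis using pre_fillingD[OF unstair_filling m] stair_one_row[OF m] by auto
    qed
  qed
  have C: "insert 1 C \<subseteq> {1..int n}"
    using pre_filling_cols[OF unstair_filling] n by auto
  have "filling (horizon n) stair_ones"
  proof (rule fillingI)
    fix r c assume rc: "(r, c) \<in> stair_ones"
    then have "c \<in> insert 1 C" "r \<notin> insert 1 C" and b: "\<bar>r\<bar> \<le> c" using sub by blast+
    then have "r \<noteq> c" "c \<le> int n" using C by (blast, auto)
    then show "r < c" "c - r < horizon n"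
      using b horizon_gt(1)[of n] by linarith+
  next
    fix r c r' c'
    assume *: "r < c" "(r', c) \<in> stair_ones" "r' < r" "(r, c') \<in> stair_ones" "c < c'"
    have "r \<noteq> 0" "1 \<le> c" using sub[OF *(4)] sub[OF *(2)] by auto
    then have m: "(gen 0 r', c) \<in> F" "(gen 0 r, c') \<in> F" using * by (auto simp: mem_stair_ones)
    note r = stair_one_row[OF m(1)] stair_one_row[OF m(2)] and c = stair_col[OF m(1)]
    have "gen 0 r < c" "gen 0 r' < gen 0 r" using r c * by (auto simp: gen_apply)
    then show "(r, c) \<in> stair_ones"
      using filling_corner[OF pre_filling_filling[OF unstair_filling], of "gen 0 r" c "gen 0 r'" c'] m *(5) by (simp add: mem_stair_ones)
  qed
  moreover have "(- d, c) \<notin> stair_ones" if d: "d \<in> insert 1 C" "(- d, d) \<notin> stair_ones" for d c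
  proof
    assume dc: "(- d, c) \<in> stair_ones"
    have "d \<noteq> 1" using d(2) by (auto simp: mem_stair_ones)
    then have "gen 0 (- d) = - d" "1 \<le> d" using d(1) C by (auto simp: gen_apply)
    then have "(- d, c) \<in> F" "(- d, d) \<notin> F" using dc d(2) \<open>d \<noteq> 1\<close> by (auto simp: mem_stair_ones)
    then show False using pre_filling_diagonal[OF unstair_filling, of d c] \<open>1 \<le> d\<close> by simp
  qed
  moreover have "\<exists>r. (r, c) \<in> stair_ones" if c: "c \<in> insert 1 C" for c
  proof (cases "c = 1")
    case False
    then obtain r where "(r, c) \<in> F" using P c by (auto simp: pt_filling_def)
    then have "(gen 0 r, c) \<in> stair_ones" by (simp add: mem_stair_ones)
    then show ?thesis by blast
  qed (auto simp: mem_stair_ones)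
  ultimately show ?thesis
    unfolding pt_filling_iff pre_filling_def using sub C by blast
qed

text \<open>\<open>gen 0\<close> jumps over 0, so it is realized by two neighbour swaps through the
  empty row 0, which carry row 1 to row -1. The outermost transposition on the right is the effect
  of the new box (-1, 1).\<close>

private lemma out_stair:
  "out_state n stair_ones (transpose (row_in (- 1)) (row_in 0) (transpose (row_in 0) (row_in 1) s)) =
   transpose (- 1) 2 (transpose (- 1) 1 (transpose 1 3 (out_state n F s)))"
proof -
  define F1 where "F1 = {(r, c). (transpose 0 1 r, c) \<in> F}"
  define F2 where "F2 = {(r, c). (transpose (- 1) 0 r, c) \<in> F1}"
  have far: "(r, c) \<notin> F" if "c \<le> r \<or> horizon n \<le> c - r" for r c
    using that horizon_bound[OF unstair_filling, of r c] by auto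
  have e1: "out_state n F1 (transpose (row_in 0) (row_in 1) s) = transpose 1 3 (out_state n F s)" for s
    using out_row_swap[of F1 0 F n s] stair_row far by (simp add: F1_def)
  have e2: "out_state n F2 (transpose (row_in (- 1)) (row_in 0) s) = transpose (- 1) 1 (out_state n F1 s)" for s
  proof -
    have "(1, horizon n) \<notin> F" using pre_fillingD(7)[OF unstair_filling, of 1 "horizon n"] horizon_gt(1)[of n] by auto
    then have "out_state n F2 (transpose (row_in (- 1)) (row_in (- 1 + 1)) s) =
        transpose (2 * - 1 + 1) (2 * - 1 + 3) (out_state n F1 s)"
      by (intro out_row_swap) (use stair_row far in \<open>simp_all add: F2_def F1_def transpose_def\<close>)
    then show ?thesis by simp
  qed
  have stair: "stair_ones = insert (- 1, 1) F2"
  proof -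
    have "(gen 0 r, c) \<in> F \<longleftrightarrow> (r, c) \<in> F2" for r c
      using stair_row[of c] by (auto simp: F2_def F1_def transpose_def gen_apply)
    then have "(r, c) \<in> stair_ones \<longleftrightarrow> (r, c) \<in> insert (- 1, 1) F2" for r c
      unfolding mem_stair_ones by auto
    then show ?thesis by auto
  qed
  have "(- 1, c') \<notin> F2" if "c' \<le> 1" for c'
    using that stair_col[of 1 c'] by (auto simp: F2_def F1_def transpose_def)
  moreover have "(r, 1) \<notin> F2" for r
    using stair_col[of _ 1] by (auto simp: F2_def F1_def)
  ultimately have e3: "out_state n stair_ones s = transpose (- 1) 2 (out_state n F2 s)" for s
    unfolding stair using out_insert_corner[of "- 1" 1 n F2 s] horizon_gt(1)[of n] n(1) by simp
  show ?thesis by (simp only: e3 e2 e1)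
qed

lemma cover_step_stair: "cover_step n C F (insert 1 C) stair_ones 0"
proof -
  have pos: "0 < zeta_val n C F 1"
    using zeta_val_row_ge[OF unstair_filling, of 1] n by simp
  have main: "out_state n stair_ones
      (transpose (row_in (- 1)) (row_in 0) (transpose (row_in 0) (row_in 1) (live_in n C F j))) div 2
      = \<bar>zeta_val n C F j\<bar>" if j: "1 \<le> j" "j \<le> int n" for j
  proof -
    define v where "v = \<bar>zeta_val n C F j\<bar>"
    have out: "out_state n F (live_in n C F j) = label_out C v" and v: "1 \<le> v"
      using out_state_zeta_val[OF unstair_filling j] by (simp_all add: v_def)
    show ?thesis
      unfolding out_stair out v_def[symmetric] using v n(2)
      by (cases "v = 1") (auto simp: label_out_def transpose_def)
  qed
  have "zeta_val n (insert 1 C) stair_ones j = zeta_ext n C F (gen 0 j)" if j: "1 \<le> j" "j \<le> int n" for j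
  proof (cases "j = 1")
    case True
    have "live_in n (insert 1 C) stair_ones 1 = row_in (- 1)" by (simp add: live_in_def mem_stair_ones)
    moreover have "live_in n C F 1 = row_in 1" using n by (simp add: live_in_def)
    ultimately show ?thesis
      using True main[of 1] pos n by (simp add: zeta_val_def[of n "insert 1 C"] mem_stair_ones zeta_ext_def gen_apply transpose_def)
  next
    case False
    have diag: "(- j, j) \<in> stair_ones \<longleftrightarrow> (- j, j) \<in> F" using False j by (simp add: mem_stair_ones gen_apply)
    then have "live_in n (insert 1 C) stair_ones j = live_in n C F j" using False by (simp add: live_in_def)
    moreover have "transpose (row_in (- 1)) (row_in 0) (transpose (row_in 0) (row_in 1) (live_in n C F j)) = live_in n C F j"
      using False j by (auto simp: live_in_def transpose_def)
    ultimately have "out_state n stair_ones (live_in n (insert 1 C) stair_ones j) div 2 = \<bar>zeta_val n C F j\<bar>"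
      using main[OF j] by simp
    then show ?thesis
      using False j diag out_state_zeta_val(4)[OF unstair_filling j]
      by (auto simp: zeta_val_def[of n "insert 1 C"] zeta_ext_def gen_apply)
  qed
  then show ?thesis
    using pos n stair_pt_filling by (simp add: cover_step_def zeta_ascent_def pt_filling_iff)
qed

end

text \<open>The rule admits every 1 common to the two paths, but a filling remains only if the first
  one is removed: the paths then cross there, so one of them has been straight since its start, and
  this must be the one from row a + 1.\<close>

lemma meeting_rows_first:
  assumes F: "filling m F" and F': "filling m (F - {(r, c)})" and rc: "(r, c) \<in> F"
    and meet: "trail F m (row_in a) (r - c) div 2 = r" "trail F m (row_in (a + 1)) (r - c) div 2 = r"
  shows "r = a + 1" "(a, c) \<in> F" "\<And>c'. c < c' \<Longrightarrow> (a, c') \<notin> F" "\<And>c'. c < c' \<Longrightarrow> (a + 1, c') \<notin> F"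
proof -
  define F0 where "F0 = F - {(r, c)}"
  define t where "t = r - c"
  have t: "- m \<le> t" "t < 0" "r - t = c" using filling_bounds[OF F rc] by (simp_all add: t_def)
  have F0: "filling m F0" using F' by (simp add: F0_def)
  have same: "trail F0 m s t = trail F m s t" for s
    by (rule trail_cong[of m "- m"]) (use t in \<open>auto simp: F0_def t_def\<close>)
  have ne: "trail F m (row_in a) t \<noteq> trail F m (row_in (a + 1)) t"
    using trail_inj[of m t F] t by simp
  have zero: "(r, r - t) \<notin> F0" using t by (simp add: F0_def)
  have "trail F0 m (row_in a) t = 2 * r \<and> trail F0 m (row_in (a + 1)) t = 2 * r + 1"
  proof (rule ccontr)
    assume "\<not> ?thesis"
    then have "trail F0 m (row_in a) t = 2 * r + 1" "trail F0 m (row_in (a + 1)) t = 2 * r"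
      using meet ne unfolding same t_def[symmetric] by presburger+
    then show False using cross_order(1)[OF F0 t(1,2) _ _ zero] by (force simp: row_in_def)
  qed
  then have A: "trail F0 m (row_in a) t = 2 * r" and B: "trail F0 m (row_in (a + 1)) t = 2 * r + 1" by auto
  have straight: "trail F0 m (row_in (a + 1)) u = 2 * r + 1" if "- m \<le> u" "u \<le> t" for u
  proof -
    \<comment> \<open>A path straight in a column has an even state at time -m, whereas the start of
      a row is odd.\<close>
    have "\<not> (\<forall>u. - m \<le> u \<longrightarrow> u \<le> t \<longrightarrow> trail F0 m (row_in a) u = 2 * (r - t + u))"
    proof
      assume "\<forall>u. - m \<le> u \<longrightarrow> u \<le> t \<longrightarrow> trail F0 m (row_in a) u = 2 * (r - t + u)"
      then have "row_in a = 2 * (r - t - m)" using t(1) by force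
      then show False unfolding row_in_def by presburger
    qed
    then show ?thesis using cross_straight[OF F0 t(1,2) B A zero] that by blast
  qed
  then have "row_in (a + 1) = 2 * r + 1" using t(1) by force
  then show r: "r = a + 1" by (simp add: row_in_def)
  show "(a + 1, c') \<notin> F" if "c < c'" for c'
  proof
    assume c': "(a + 1, c') \<in> F"
    define u where "u = a + 1 - c'"
    have u: "- m \<le> u" "u < t" using filling_bounds[OF F c'] that r by (simp_all add: u_def t_def)
    have "(r, r - u) \<in> F0" using c' r that by (simp add: F0_def u_def)
    moreover have "trail F0 m (row_in (a + 1)) u = 2 * r + 1" "trail F0 m (row_in (a + 1)) (u + 1) = 2 * r + 1"
      using straight[of u] straight[of "u + 1"] u by simp_all
    ultimately show False using u by (simp add: trail_step step_odd)
  qed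
  have ge: "2 * a + 1 \<le> trail F0 m (row_in a) u" if "- m \<le> u" for u
    using trail_mono[of m "- m" u F0 "row_in a"] that by (simp add: row_in_def)
  have "t \<noteq> - m"
  proof
    assume "t = - m"
    then have "row_in a = 2 * r" using A by simp
    then show False unfolding row_in_def by presburger
  qed
  then have t1: "- m \<le> t - 1" using t(1) by simp
  \<comment> \<open>From the state 2a + 2 a step leads to 2a + 3 or 2a + 4, never to 2a + 2 again.
    So one unit before the meeting the path from row a was still in its row, where it had not yet
    turned.\<close>
  have "trail F0 m (row_in a) (t - 1) \<le> 2 * a + 2"
    using trail_mono[of m "t - 1" t F0 "row_in a"] A r t1 by simp
  moreover have "trail F0 m (row_in a) t = step F0 (t - 1) (trail F0 m (row_in a) (t - 1))"
    using trail_step[OF t1, of F0 "row_in a"] by simp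
  moreover have "step F0 (t - 1) (2 * (a + 1)) \<noteq> 2 * (a + 1)" by (simp only: step_even) simp
  ultimately have "trail F0 m (row_in a) (t - 1) \<noteq> 2 * (a + 1)" "trail F0 m (row_in a) (t - 1) \<le> 2 * a + 2"
    using A r by metis+
  then have last: "trail F0 m (row_in a) (t - 1) = 2 * a + 1"
    using ge[OF t1] by simp
  then have "(a, a - (t - 1)) \<in> F0"
    using trail_step[OF t1, of F0 "row_in a"] A r by (simp add: step_odd split: if_splits)
  moreover have "a - (t - 1) = c" using t(3) r by simp
  ultimately show "(a, c) \<in> F" by (simp add: F0_def)
  show "(a, c') \<notin> F" if "c < c'" for c'
  proof
    assume c': "(a, c') \<in> F"
    define u where "u = a - c'"
    have u: "- m \<le> u" "u < t - 1" using filling_bounds[OF F c'] that r by (simp_all add: u_def t_def)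
    have "trail F0 m (row_in a) u \<le> 2 * a + 1" "trail F0 m (row_in a) (u + 1) \<le> 2 * a + 1"
      using trail_mono[of m u "t - 1" F0 "row_in a"] trail_mono[of m "u + 1" "t - 1" F0 "row_in a"] last u by simp_all
    then have "trail F0 m (row_in a) u = 2 * a + 1" "trail F0 m (row_in a) (u + 1) = 2 * a + 1"
      using ge[of u] ge[of "u + 1"] u by simp_all
    moreover have "(a, a - u) \<in> F0" using c' r by (simp add: F0_def u_def)
    ultimately show False using u by (simp add: trail_step step_odd)
  qed
qed

lemma mirror_row_in:
  assumes "- m \<le> t" "t \<le> 0"
  shows "trail (mirror F) m (row_in (- c)) t = 2 * t + 1 - trail F m (col_start_state m c) t"
proof -
  have "row_in (- c) = 1 - 2 * m - col_start_state m c" by (simp add: row_in_def col_start_state_def)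
  then show ?thesis using trail_mirror[OF assms] by metis
qed

lemma first_meeting_cols:
  assumes F: "filling m F" and "(x, j + 1) \<in> F" "\<And>r. r < x \<Longrightarrow> (r, j + 1) \<notin> F" "\<And>r. r < x \<Longrightarrow> (r, j) \<notin> F"
    and "x < j"
  shows "trail F m (col_start_state m j) (x - j) div 2 = x"
    and "trail F m (col_start_state m (j + 1)) (x - j) div 2 = x"
proof -
  define a where "a = - (j + 1)"
  have a1: "a + 1 = - j" by (simp add: a_def)
  have "(a, - x) \<in> mirror F" using assms(2) by (simp add: a_def add.commute)
  moreover have "(a, c) \<notin> mirror F" if "- x < c" for c
    using assms(3)[of "- c"] that by (simp add: a_def add.commute)
  moreover have "(a + 1, c) \<notin> mirror F" if "- x < c" for c
    using assms(4)[of "- c"] that unfolding a1 by simp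
  ultimately have *: "trail (mirror F) m (row_in a) (a + 1 - - x) = 2 * (a + 1)"
    "trail (mirror F) m (row_in (a + 1)) (a + 1 - - x) = 2 * (a + 1) + 1"
    using first_meeting_rows[OF filling_mirror[OF F], of a "- x"] by blast+
  have t: "- m \<le> x - j" "x - j \<le> 0" using filling_bounds[OF F assms(2)] by simp_all
  have e: "a + 1 - - x = x - j" by (simp add: a_def)
  show "trail F m (col_start_state m j) (x - j) div 2 = x"
    using *(2) mirror_row_in[OF t, of F j] unfolding e a1 by simp
  show "trail F m (col_start_state m (j + 1)) (x - j) div 2 = x"
    using *(1) mirror_row_in[OF t, of F "j + 1"] unfolding e a1 unfolding a_def by simp
qed

lemma meeting_cols_first:
  assumes F: "filling m F" and F': "filling m (F - {(r, c)})" and rc: "(r, c) \<in> F"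
    and meet: "trail F m (col_start_state m j) (r - c) div 2 = r"
      "trail F m (col_start_state m (j + 1)) (r - c) div 2 = r"
  shows "c = j" "(r, j + 1) \<in> F" "\<And>r'. r' < r \<Longrightarrow> (r', j) \<notin> F" "\<And>r'. r' < r \<Longrightarrow> (r', j + 1) \<notin> F"
proof -
  define a where "a = - (j + 1)"
  have a1: "a + 1 = - j" by (simp add: a_def)
  have t: "- m \<le> r - c" "r - c \<le> 0" using filling_bounds[OF F rc] by simp_all
  have div: "(2 * (r - c) + 1 - p) div 2 = - c" if "p div 2 = r" for p
    using that by presburger
  have e: "- c - - r = r - c" by simp
  have "mirror F - {(- c, - r)} = mirror (F - {(r, c)})" by (auto simp: mirror_def)
  then have *: "filling m (mirror F - {(- c, - r)})" using filling_mirror[OF F'] by simp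
  have "trail (mirror F) m (row_in a) (- c - - r) div 2 = - c"
    "trail (mirror F) m (row_in (a + 1)) (- c - - r) div 2 = - c"
    using div[OF meet(2)] div[OF meet(1)] unfolding e a1 unfolding a_def mirror_row_in[OF t] by blast+
  note first = meeting_rows_first[OF filling_mirror[OF F] * _ this]
  have mem: "(- c, - r) \<in> mirror F" using rc by simp
  show "c = j" using first(1)[OF mem] by (simp add: a_def)
  show "(r, j + 1) \<in> F" using first(2)[OF mem] by (simp add: a_def add.commute)
  show "(r', j) \<notin> F" if "r' < r" for r' using first(4)[OF mem, of "- r'"] that unfolding a1 by simp
  show "(r', j + 1) \<notin> F" if "r' < r" for r' using first(3)[OF mem, of "- r'"] that by (simp add: a_def add.commute)
qed

section \<open>The characterization\<close>

lemma leftmost_exists: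
  assumes "pre_filling n C F" "(r, c) \<in> F"
  obtains x where "leftmost_one F r x"
proof -
  have "{c. (r, c) \<in> F} \<subseteq> {1..int n}" using pre_fillingD(7,8)[OF assms(1), of r] by auto
  then have S: "finite {c. (r, c) \<in> F}" "{c. (r, c) \<in> F} \<noteq> {}"
    using assms(2) by (auto intro: finite_subset)
  show ?thesis
    by (rule that[of "Max {c. (r, c) \<in> F}"]) (use Max_in[OF S] Max_ge[OF S(1)] in \<open>auto simp: leftmost_one_def\<close>)
qed

lemma topmost_exists:
  assumes "pre_filling n C F" "(r, c) \<in> F"
  obtains x where "topmost_one F c x"
proof -
  have "{r. (r, c) \<in> F} \<subseteq> {- int n..int n}"
    using in_frameD[OF pre_filling_in_frame[OF assms(1)], of _ c] by force
  then have S: "finite {r. (r, c) \<in> F}" "{r. (r, c) \<in> F} \<noteq> {}"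
    using assms(2) by (auto intro: finite_subset)
  show ?thesis
    by (rule that[of "Min {r. (r, c) \<in> F}"]) (use Min_in[OF S] Min_le[OF S(1)] in \<open>auto simp: topmost_one_def\<close>)
qed

lemma leftmost_oneD:
  "leftmost_one F r x \<Longrightarrow> (r, x) \<in> F" "leftmost_one F r x \<Longrightarrow> x < c \<Longrightarrow> (r, c) \<notin> F"
  by (auto simp: leftmost_one_def)

lemma topmost_oneD:
  "topmost_one F c x \<Longrightarrow> (x, c) \<in> F" "topmost_one F c x \<Longrightarrow> r < x \<Longrightarrow> (r, c) \<notin> F"
  by (auto simp: topmost_one_def)

lemma replace_rows_single: "(a, x) \<in> F \<Longrightarrow> replace_rows a x x F = F - {(a + 1, x)}"
  by (auto simp: replace_rows_def)

lemma replace_cols_single: "(x, j + 1) \<in> F \<Longrightarrow> replace_cols j x x F = F - {(x, j)}"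
  by (auto simp: replace_cols_def)

lemma gen_image_cols:
  assumes "1 \<le> k" "\<And>c. c \<in> C \<Longrightarrow> 1 \<le> c" "int k \<in> C" "int k + 1 \<notin> C"
  shows "gen k ` C = insert (int k + 1) (C - {int k})"
proof -
  have "c \<in> gen k ` C \<longleftrightarrow> gen k c \<in> C" for c by (metis gen_gen image_iff)
  moreover have "gen k c \<in> C \<longleftrightarrow> c = int k + 1 \<or> (c \<in> C \<and> c \<noteq> int k)" for c
    using assms assms(2)[of "- int k"] assms(2)[of "- int k - 1"] by (auto simp: gen_apply split: if_splits)
  ultimately show ?thesis by auto
qed

lemma pt_filling_nonempty: "pt_filling n C F \<Longrightarrow> c \<in> C \<Longrightarrow> \<exists>r. (r, c) \<in> F"
  by (simp add: pt_filling_iff)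

context
  fixes n :: nat and T :: tableau
  assumes T: "T \<in> PT n"
begin

private abbreviation "C \<equiv> cols n T"
private abbreviation "F \<equiv> ones T"

private lemma filled: "pt_filling n C F"
  using T by (simp add: PT_iff)

private lemma pre: "pre_filling n C F"
  by (rule PT_pre_filling[OF T])

lemma mem_rows_iff: "a \<in> rows n T \<longleftrightarrow> row_label_of n C a"
proof -
  have "is_diagram n (part T)" using T by (simp add: PT_iff)
  moreover have "a \<in> uminus ` A \<longleftrightarrow> - a \<in> A" for A :: "int set" by (metis add.inverse_inverse image_iff)
  ultimately show ?thesis by (auto simp: rows_eq row_label_of_def)
qed

lemma pos_mem_rows_iff: "1 \<le> a \<Longrightarrow> a \<in> rows n T \<longleftrightarrow> a \<le> int n \<and> a \<notin> C"
  using pre_filling_cols[OF pre, of "- a"] by (auto simp: mem_rows_iff row_label_of_def)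

lemma meets_row_iff:
  assumes "a \<in> rows n T"
  shows "meets_one T (row_start n a) (r, c) \<longleftrightarrow>
    (r, c) \<in> F \<and> trail F (horizon n) (row_in a) (r - c) div 2 = r"
  using assms pre_filling_cols[OF pre, of "- a"]
  by (intro row_start_trail(2)[OF pre_filling_in_frame[OF pre] horizon_gt(1)])
    (auto simp: mem_rows_iff row_label_of_def)

lemma meets_col_iff:
  assumes "j \<in> C"
  shows "meets_one T (col_start n j) (r, c) \<longleftrightarrow>
    (r, c) \<in> F \<and> trail F (horizon n) (col_in n j) (r - c) div 2 = r"
  using pre_filling_cols[OF pre assms]
  by (intro col_start_trail(2)[OF pre_filling_in_frame[OF pre] horizon_gt(1)]) auto

lemma ascent_zeta_iff:
  assumes "k < n"
  shows "ascent (zeta n T) k \<longleftrightarrow> zeta_ascent n C F k"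
  using assms zeta_eq_zeta_val(1)[OF T, of "int k"]
    zeta_eq_zeta_val(1)[OF T, of "int k + 1"]
  by (auto simp: ascent_def zeta_ascent_def)

lemma cover_step_zeta_val:
  assumes cs: "cover_step n C F C' F' k" and j: "1 \<le> j" "j \<le> int n"
  shows "zeta_val n C' F' j = zeta n T (gen k j)"
proof -
  have "j \<in> pm_set n" using j by (simp add: pm_set_def)
  then have "gen k j \<in> pm_set n" using cs by (simp add: cover_step_def)
  then have "zeta_ext n C F (gen k j) = zeta n T (gen k j)"
    using zeta_eq_zeta_val(1)[OF T, of "\<bar>gen k j\<bar>"] zeta_minus[OF T, of "gen k j"]
    by (auto simp: zeta_ext_def pm_set_def)
  then show ?thesis using cs j by (simp add: cover_step_def)
qed

lemma zeta_cover_step: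
  assumes T': "T' \<in> PT n" and cs: "cover_step n C F C' (ones T') k"
    and C': "cols n T' = C' \<or>
      (\<exists>i\<in>C'. (\<forall>r. (r, i) \<notin> ones T') \<and> (\<forall>c. (- i, c) \<notin> ones T') \<and> cols n T' = C' - {i})"
  shows "zeta n T' = zeta n T \<circ> gen k" "k < n" "ascent (zeta n T) k"
proof -
  show k: "k < n" using cs by (simp add: cover_step_def)
  show "ascent (zeta n T) k" using cs by (simp add: cover_step_def ascent_zeta_iff)
  have P': "pre_filling n C' (ones T')" using cs by (simp add: cover_step_def)
  have val: "zeta_val n (cols n T') (ones T') j = zeta_val n C' (ones T') j" for j
    using C' zeta_val_drop_col[OF P'] by auto
  have pos: "zeta n T' j = zeta n T (gen k j)" if "1 \<le> j" "j \<le> int n" for j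
    using zeta_eq_zeta_val(1)[OF T' that] val cover_step_zeta_val[OF cs that] by simp
  have "zeta n T' j = zeta n T (gen k j)" for j
  proof -
    consider "1 \<le> j" "j \<le> int n" | "1 \<le> - j" "- j \<le> int n" | "j \<notin> pm_set n"
      by (cases "0 \<le> j") (auto simp: pm_set_def)
    then show ?thesis
    proof cases
      case 1
      then show ?thesis by (rule pos)
    next
      case 2
      then show ?thesis
        using pos[of "- j"] zeta_minus[OF T, of "gen k j"] zeta_minus[OF T', of j] by (simp add: gen_minus)
    next
      case 3
      then have "gen k j = j" using k by (auto simp: pm_set_def gen_apply)
      then show ?thesis using 3 by (simp add: zeta_outside)
    qed
  qed
  then show "zeta n T' = zeta n T \<circ> gen k" by auto
qed

text \<open>Only column d can have lost its last 1, and dropping it changes no value. What remains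
  has the same values as \<open>T'\<close> and is \<open>T'\<close> by injectivity.\<close>

lemma obtained_if_cover_step:
  assumes op: "operation n T C' F'" and cs: "cover_step n C F C' F' k"
    and ne: "\<And>c. c \<in> C' \<Longrightarrow> c \<noteq> d \<Longrightarrow> \<exists>r. (r, c) \<in> F'"
    and T': "T' \<in> PT n" "zeta n T' = zeta n T \<circ> gen k"
  shows "obtained n T T'"
proof -
  have P': "pre_filling n C' F'" using cs by (simp add: cover_step_def)
  obtain B where B: "pt_filling n B F'" "\<And>j. zeta_val n B F' j = zeta_val n C' F' j" and C': "B = C' \<or>
      (\<exists>i\<in>C'. (\<forall>r. (r, i) \<notin> F') \<and> (\<forall>c. (- i, c) \<notin> F') \<and> B = C' - {i})"
  proof (cases "d \<in> C' \<and> (\<forall>r. (r, d) \<notin> F')")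
    case False
    then have "pt_filling n C' F'" using P' ne by (auto simp: pt_filling_iff)
    then show ?thesis using that by blast
  next
    case True
    then have row: "(- d, c) \<notin> F'" for c
      using pre_filling_diagonal[OF P', of d c] pre_filling_cols[OF P', of d] by auto
    have "c \<in> C' - {d} \<and> r \<notin> C' - {d} \<and> (r < 0 \<longrightarrow> - r \<in> C' - {d}) \<and> \<bar>r\<bar> \<le> c \<and> r \<noteq> 0"
      if "(r, c) \<in> F'" for r c
      using pre_fillingD(1-5)[OF P' that] that True row[of c] by auto
    then have "pre_filling n (C' - {d}) F'"
      using P' unfolding pre_filling_def by blast
    then have "pt_filling n (C' - {d}) F'" using ne by (auto simp: pt_filling_iff)
    then show ?thesis using that[of "C' - {d}"] True row zeta_val_drop_col[OF P'] by blast
  qed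
  have "zeta_val n B F' j = zeta_val n (cols n T') (ones T') j" if "1 \<le> j" "j \<le> int n" for j
    using B(2) cover_step_zeta_val[OF cs that] zeta_eq_zeta_val(1)[OF T'(1) that] T'(2) by simp
  moreover have "pt_filling n (cols n T') (ones T')" using T'(1) by (simp add: PT_iff)
  ultimately have "B = cols n T'" "F' = ones T'" using pt_filling_eqI[OF B(1)] by blast+
  then show ?thesis unfolding obtained_def using op C' by blast
qed

text \<open>The ascent forces x \<le> y for the leftmost 1's of the upper and the lower row.
  Equality is a meeting of the two paths, strict inequality the situation of the rectangle
  rule.\<close>

lemma rows_operation_exists:
  assumes a: "a \<in> rows n T" "a + 1 \<in> rows n T" and "\<exists>c. (a, c) \<in> F" "\<exists>c. (a + 1, c) \<in> F"
    and asc: "zeta_ascent n C F (row_pair_index a)"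
  obtains F' where "operation n T C F'" "cover_step n C F C F' (row_pair_index a)"
    "\<And>c. c \<in> C \<Longrightarrow> \<exists>r. (r, c) \<in> F'"
proof -
  note lab = a[unfolded mem_rows_iff]
  obtain x y where x: "leftmost_one F a x" and y: "leftmost_one F (a + 1) y"
    using assms(3,4) leftmost_exists[OF pre] by metis
  note xD = leftmost_oneD[OF x] and yD = leftmost_oneD[OF y]
  obtain c where "x \<le> c" "(a + 1, c) \<in> F"
    using ascent_rows[OF pre lab x assms(4) asc] by blast
  then have "x \<le> y" using yD(2)[of c] by fastforce
  have "(a + 1, x) \<in> F"
  proof (cases "x = y")
    case False
    have "a + 1 \<noteq> x"
      using pre_fillingD(1,8)[OF pre xD(1)] row_pair_index(3,4)[OF pre lab] by (cases "0 < a") auto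
    then show ?thesis
      using filling_corner[OF pre_filling_filling[OF pre], of "a + 1" x a y] xD(1) yD(1) False \<open>x \<le> y\<close>
        pre_fillingD(6)[OF pre xD(1)] by simp
  qed (use yD in simp)
  note step = cover_step_rows[OF pre lab x y \<open>x \<le> y\<close> this]
  have ne: "\<exists>r. (r, c) \<in> replace_rows a x y F" if "c \<in> C" for c
    using filled that step(2) by (auto simp: pt_filling_def)
  have "operation n T C (replace_rows a x y F)"
  proof (cases "x = y")
    case False
    then show ?thesis using operation.rectangle_rows[OF a x y] \<open>x \<le> y\<close> by simp
  next
    case True
    note replace_rows_single[OF xD(1)]
    moreover have "(a + 1, c) \<notin> F" if "x < c" for c using yD(2) True that by simp
    then have "trail F (horizon n) (row_in a) (a + 1 - x) = 2 * (a + 1)"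
      "trail F (horizon n) (row_in (a + 1)) (a + 1 - x) = 2 * (a + 1) + 1"
      using first_meeting_rows[OF pre_filling_filling[OF pre] xD] by blast+
    then have "meets_one T (row_start n a) (a + 1, x)" "meets_one T (row_start n (a + 1)) (a + 1, x)"
      using a \<open>(a + 1, x) \<in> F\<close> by (simp_all add: meets_row_iff)
    ultimately show ?thesis using operation.meeting_rows[OF a] True by simp
  qed
  then show ?thesis using that step(1) ne by blast
qed

lemma cols_operation_exists:
  assumes j: "j \<in> C" "j + 1 \<in> C" "(- j, j) \<notin> F" "(- (j + 1), j + 1) \<notin> F"
    and asc: "zeta_ascent n C F (nat j)"
  obtains F' where "operation n T C F'" "cover_step n C F C F' (nat j)"
    "\<And>c. c \<in> C \<Longrightarrow> c \<noteq> j \<Longrightarrow> \<exists>r. (r, c) \<in> F'"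
proof -
  obtain x y where x: "topmost_one F j x" and y: "topmost_one F (j + 1) y"
    using filled j topmost_exists[OF pre] unfolding pt_filling_def by metis
  note xD = topmost_oneD[OF x] and yD = topmost_oneD[OF y]
  obtain r where "r \<le> y" "(r, j) \<in> F" using ascent_cols[OF pre j y asc] by blast
  then have "x \<le> y" using xD(2)[of r] by fastforce
  have "y \<noteq> j" using pre_fillingD(4)[OF pre yD(1)] j(1) by blast
  then have "y < j" using pre_fillingD(6)[OF pre yD(1)] by simp
  have "(y, j) \<in> F"
  proof (cases "x = y")
    case False
    then show ?thesis
      using filling_corner[OF pre_filling_filling[OF pre], of y j x "j + 1"] xD(1) yD(1) \<open>x \<le> y\<close> \<open>y < j\<close> by simp
  qed (use xD in simp)
  note step = cover_step_cols[OF pre j x y \<open>x \<le> y\<close> this]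
  have ne: "\<exists>r. (r, c) \<in> replace_cols j x y F" if "c \<in> C" "c \<noteq> j" for c
    using filled that step(2) by (auto simp: pt_filling_def)
  have "operation n T C (replace_cols j x y F)"
  proof (cases "x = y")
    case False
    then show ?thesis using operation.rectangle_cols[OF j(1,2) x y] \<open>x \<le> y\<close> by simp
  next
    case True
    have "replace_cols j x x F = F - {(x, j)}"
      using yD(1) True by (simp add: replace_cols_single)
    moreover have "(x, j + 1) \<in> F" "(r, j + 1) \<notin> F" if "r < x" for r
      using yD(1) yD(2)[of r] True that by simp_all
    then have "trail F (horizon n) (col_in n j) (x - j) div 2 = x"
      "trail F (horizon n) (col_in n (j + 1)) (x - j) div 2 = x"
      using first_meeting_cols[OF pre_filling_filling[OF pre], of x j] yD(1) xD(2) \<open>y < j\<close> True by blast+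
    then have "meets_one T (col_start n j) (x, j)" "meets_one T (col_start n (j + 1)) (x, j)"
      using j xD(1) by (simp_all add: meets_col_iff)
    ultimately show ?thesis using operation.meeting_cols[OF j(1,2)] True by simp
  qed
  then show ?thesis using that step(1) ne by blast
qed

text \<open>Here z is the row -(i + 1) itself: the column replacement shrinks to this row and merely
  drops the 1 in column i.\<close>

lemma imaginary_left_one:
  assumes i: "i \<in> C" "i + 1 \<in> C" "(- (i + 1), i + 1) \<notin> F" "(- i, i) \<in> F"
    and y: "leftmost_one F (- i) y" and one: "(- i, i + 1) \<in> F"
    and F2: "F2 = replace_rows (- (i + 1)) i y (insert (- (i + 1), i) F)"
  shows "cover_step n C F C (F2 - {(- (i + 1), i)}) (nat i)"
    and "c \<in> C \<Longrightarrow> c \<noteq> i \<Longrightarrow> \<exists>r. (r, c) \<in> F2 - {(- (i + 1), i)}"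
proof -
  note mem = mem_replace_imaginary_rows[OF pre i(1,3,4) y, folded F2]
  have F2i: "(- (i + 1), i) \<in> F2" "(- (i + 1), i + 1) \<in> F2" using i(4) one by (simp_all add: mem)
  have top: "(r, i + 1) \<notin> F2" if "r < - (i + 1)" for r
    using pre_fillingD(2)[OF pre, of r "i + 1"] that by (auto simp: mem)
  note step = cover_step_imaginary[OF pre i y F2 F2i top, unfolded replace_cols_single[OF F2i(2)]]
  show "cover_step n C F C (F2 - {(- (i + 1), i)}) (nat i)" by (rule step(1))
  show "\<exists>r. (r, c) \<in> F2 - {(- (i + 1), i)}" if "c \<in> C" "c \<noteq> i"
    using filled that step(2) unfolding pt_filling_def by blast
qed

lemma imaginary_no_left_one:
  assumes i: "i \<in> C" "i + 1 \<in> C" "(- (i + 1), i + 1) \<notin> F" "(- i, i) \<in> F"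
    and y: "leftmost_one F (- i) y" and zero: "(- i, i + 1) \<notin> F"
    and z: "topmost_one F (i + 1) z"
    and F2: "F2 = replace_rows (- (i + 1)) i y (insert (- (i + 1), i) F)"
  shows "cover_step n C F C (replace_cols i (- (i + 1)) z F2) (nat i)"
    and "c \<in> C \<Longrightarrow> c \<noteq> i \<Longrightarrow> \<exists>r. (r, c) \<in> replace_cols i (- (i + 1)) z F2"
proof -
  note mem = mem_replace_imaginary_rows[OF pre i(1,3,4) y, folded F2]
  note zD = topmost_oneD[OF z]
  have z1: "z \<noteq> - (i + 1)" "z \<noteq> - i" "- i \<le> z" "z < i"
  proof -
    show z': "z \<noteq> - (i + 1)" "z \<noteq> - i" using zD(1) i(3) zero by auto
    then show "- i \<le> z" using pre_fillingD(2)[OF pre zD(1)] by linarith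
    have "z \<noteq> i" using pre_fillingD(4)[OF pre zD(1)] i(1) by blast
    then show "z < i" using pre_fillingD(6)[OF pre zD(1)] by simp
  qed
  have "(z, i) \<in> F"
    using filling_corner[OF pre_filling_filling[OF pre], of z i "- i" "i + 1"] i(4) zD(1) z1 by simp
  then have F2z: "(z, i) \<in> F2" "(z, i + 1) \<in> F2" using z1 zD(1) by (simp_all add: mem)
  have top: "(r, i + 1) \<notin> F2" if "r < z" for r using that zD(2)[of r] zero by (simp add: mem)
  note step = cover_step_imaginary[OF pre i y F2 F2z top]
  show "cover_step n C F C (replace_cols i (- (i + 1)) z F2) (nat i)" by (rule step(1))
  show "\<exists>r. (r, c) \<in> replace_cols i (- (i + 1)) z F2" if "c \<in> C" "c \<noteq> i"
    using filled that step(2) unfolding pt_filling_def by blast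
qed

lemma imaginary_operation_exists:
  assumes i: "i \<in> C" "i + 1 \<in> C" "(- (i + 1), i + 1) \<notin> F" "(- i, i) \<in> F"
  obtains F' where "operation n T C F'" "cover_step n C F C F' (nat i)"
    "\<And>c. c \<in> C \<Longrightarrow> c \<noteq> i \<Longrightarrow> \<exists>r. (r, c) \<in> F'"
proof -
  obtain y where y: "leftmost_one F (- i) y" using leftmost_exists[OF pre i(4)] .
  show ?thesis
  proof (cases "(- i, i + 1) \<in> F")
    case True
    then have "i < y" using leftmost_oneD(2)[OF y, of "i + 1"] by fastforce
    then show ?thesis
      using that operation.rectangle_imaginary[OF i y] imaginary_left_one[OF i y True refl] by blast
  next
    case False
    obtain r where "(r, i + 1) \<in> F" using filled i(2) unfolding pt_filling_def by blast
    then obtain z where z: "topmost_one F (i + 1) z" using topmost_exists[OF pre] by metis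
    show ?thesis
      using that operation.rectangle_imaginary_cols[OF i False y z] imaginary_no_left_one[OF i y False z refl] by blast
  qed
qed

lemma empty_row_if_col: "i \<in> C \<Longrightarrow> (i, c) \<notin> F"
  using pre_fillingD(4)[OF pre] by blast

text \<open>For k > 0 the kinds of k and k + 1 decide. Two rows allow the zero-row rule or a rule
  for rows; a column followed by a row allows a new box; two columns lead to a rule for columns, for
  negative rows, or to an imaginary one, according to the diagonals. A row k followed by a column k
  + 1 is a descent, since row values are at least, column values less than, their labels.\<close>

lemma obtained_if_ascent:
  assumes T': "T' \<in> PT n" "zeta n T' = zeta n T \<circ> gen k" and k: "k < n" and "ascent (zeta n T) k"
  shows "obtained n T T'"
proof -
  have asc: "zeta_ascent n C F k" using assms by (simp add: ascent_zeta_iff)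
  note target = obtained_if_cover_step[OF _ _ _ T']
  have less: "i \<in> C \<Longrightarrow> zeta_val n C F i < i" for i
    using filled zeta_val_col_less[OF pre, of i] by (auto simp: pt_filling_def)
  show ?thesis
  proof (cases "k = 0")
    case True
    then have n: "1 \<le> n" using k by simp
    have C1: "1 \<notin> C" using less[of 1] asc True by (auto simp: zeta_ascent_def)
    have "operation n T (insert 1 C) (stair_ones F)"
      unfolding stair_ones_def[OF filled n C1]
      by (rule operation.add_staircase_box) (use C1 n in \<open>simp add: pos_mem_rows_iff\<close>)
    moreover have "cover_step n C F (insert 1 C) (stair_ones F) k"
      using True cover_step_stair[OF filled n C1] by simp
    ultimately show ?thesis
      using target pt_filling_nonempty[OF stair_pt_filling[OF filled n C1]] by blast
  next
    case False
    define i where "i = int k"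
    have i: "1 \<le> i" "i + 1 \<le> int n" "nat i = k" using k False by (simp_all add: i_def)
    have asc': "zeta_val n C F i < zeta_val n C F (i + 1)"
      using asc False by (simp add: zeta_ascent_def i_def)
    have relabel: ?thesis if "i + 1 \<notin> C" "\<And>c. (i, c) \<notin> F"
      "operation n T (insert (i + 1) (C - {i})) (insert (i, i + 1) (map_prod (gen k) (gen k) ` F))"
    proof -
      have a: "1 \<le> k" "int k + 1 \<le> int n" "int k + 1 \<notin> C" "\<And>c. (int k, c) \<notin> F"
        using that i by (auto simp: i_def)
      have "operation n T (relabel_cols C k) (relabel_ones F k)"
        using that(3) by (simp only: relabel_cols_def[OF filled a] relabel_ones_def[OF filled a] i_def)
      then show ?thesis
        using target cover_step_relabel[OF filled a] pt_filling_nonempty[OF relabel_pt_filling[OF filled a]] by blast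
    qed
    have by_rows: ?thesis if a: "a \<in> rows n T" "a + 1 \<in> rows n T" "\<exists>c. (a, c) \<in> F" "\<exists>c. (a + 1, c) \<in> F"
      and "row_pair_index a = k" for a
      using rows_operation_exists[OF a] asc target that(5) by metis
    consider "i \<notin> C" | "i \<in> C" "i + 1 \<notin> C" | "i \<in> C" "i + 1 \<in> C" by blast
    then show ?thesis
    proof cases
      case 1
      have ge: "i \<le> zeta_val n C F i" using zeta_val_row_ge[OF pre 1 i(1)] .
      have C1: "i + 1 \<notin> C" using less[of "i + 1"] ge asc' by auto
      have rows: "i \<in> rows n T" "i + 1 \<in> rows n T"
        using 1 C1 i by (simp_all add: pos_mem_rows_iff)
      show ?thesis
      proof (cases "\<exists>c. (i, c) \<in> F")
        case False
        then show ?thesis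
          using relabel[OF C1] operation.zero_row[of k n T] rows i 1 by (simp add: i_def)
      next
        case True
        \<comment> \<open>A 1 in row i pushes the value at i above i, the ascent pushes the next
          value above i + 1, and an empty row i + 1 would have the value i + 1.\<close>
        then have "i + 1 < zeta_val n C F (i + 1)" using zeta_val_row_gt[OF pre _ i(1)] asc' by force
        then have "\<exists>c. (i + 1, c) \<in> F" using zeta_val_empty_row[OF pre, of "i + 1"] C1 by force
        then show ?thesis using by_rows[OF rows True] i by (simp add: row_pair_index_def)
      qed
    next
      case 2
      have "gen k ` C = insert (i + 1) (C - {i})"
        unfolding i_def by (rule gen_image_cols) (use 2 i pre_filling_cols[OF pre] in \<open>auto simp: i_def\<close>)
      moreover have "operation n T (gen k ` C) (insert (int k, int k + 1) (map_prod (gen k) (gen k) ` F))"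
        by (rule operation.add_box) (use 2 i in \<open>simp_all add: i_def pos_mem_rows_iff\<close>)
      ultimately show ?thesis using relabel[OF 2(2) empty_row_if_col[OF 2(1)]] by (simp add: i_def)
    next
      case 3
      have not_neg: "(- (i + 1), i + 1) \<notin> F" if "(- i, i) \<notin> F"
        using out_state_zeta_val(4)[OF pre, of i] out_state_zeta_val(4)[OF pre, of "i + 1"] i asc' that 3
        by auto
      consider "(- i, i) \<notin> F" "(- (i + 1), i + 1) \<notin> F" | "(- i, i) \<in> F" "(- (i + 1), i + 1) \<in> F"
        | "(- i, i) \<in> F" "(- (i + 1), i + 1) \<notin> F" using not_neg by blast
      then show ?thesis
      proof cases
        case d: 1
        then show ?thesis
          using cols_operation_exists[OF 3 d] asc target i(3) by metis
      next
        case d: 2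
        have a1: "- (i + 1) + 1 = - i" by simp
        have "- (i + 1) \<in> rows n T" "- (i + 1) + 1 \<in> rows n T"
          unfolding a1 mem_rows_iff row_label_of_def minus_minus using 3 by blast+
        moreover have "row_pair_index (- (i + 1)) = k" using i by (simp add: row_pair_index_def)
        ultimately show ?thesis using by_rows[of "- (i + 1)"] d unfolding a1 by blast
      next
        case d: 3
        then show ?thesis
          using imaginary_operation_exists[OF 3 d(2,1)] target i(3) by metis
      qed
    qed
  qed
qed

text \<open>Each rule is brought into the form of a \<open>cover_step\<close>. Where the rule alone
  is too permissive, the tableau conditions for \<open>T'\<close> narrow it down: the corner rule
  for meeting points, the diagonal condition \<open>diag'\<close> for columns and the imaginary
  1.\<close>

lemma ascent_if_obtained:
  assumes T': "T' \<in> PT n" and "obtained n T T'"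
  shows "\<exists>k<n. zeta n T' = zeta n T \<circ> gen k \<and> ascent (zeta n T) k"
proof -
  let ?F' = "ones T'"
  note fill = pre_filling_filling[OF pre]
  have P': "pre_filling n (cols n T') ?F'" by (rule PT_pre_filling[OF T'])
  note diag' = pre_filling_diagonal[OF P']
  obtain C' where op: "operation n T C' ?F'" and C': "cols n T' = C' \<or>
      (\<exists>i\<in>C'. (\<forall>r. (r, i) \<notin> ?F') \<and> (\<forall>c. (- i, c) \<notin> ?F') \<and> cols n T' = C' - {i})"
    using assms(2) unfolding obtained_def by blast
  have covered: ?thesis if "cover_step n C F C' ?F' k" for k
    using zeta_cover_step[OF T' that C'] by blast
  have relabel: ?thesis
    if "1 \<le> k" "int k + 1 \<le> int n" "int k + 1 \<notin> C" "\<And>c. (int k, c) \<notin> F"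
      "C' = insert (int k + 1) (C - {int k})" "?F' = insert (int k, int k + 1) (map_prod (gen k) (gen k) ` F)" for k
    using covered cover_step_relabel[OF filled that(1-4)] that(5,6)
    by (simp add: relabel_cols_def[OF filled that(1-4)] relabel_ones_def[OF filled that(1-4)])
  from op show ?thesis
  proof cases
    case add_staircase_box
    then have n: "1 \<le> n" "1 \<notin> C" using pos_mem_rows_iff[of 1] by auto
    then show ?thesis
      using covered cover_step_stair[OF filled n] add_staircase_box by (simp add: stair_ones_def[OF filled n])
  next
    case (add_box i)
    have "int i + 1 \<le> int n \<and> int i + 1 \<notin> C" using add_box pos_mem_rows_iff[of "int i + 1"] by simp
    moreover have "gen i ` C = insert (int i + 1) (C - {int i})"
      by (rule gen_image_cols) (use calculation add_box pre_filling_cols[OF pre] in auto)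
    ultimately show ?thesis using relabel[of i] add_box empty_row_if_col[of "int i"] by simp
  next
    case (zero_row i)
    have "int i + 1 \<le> int n \<and> int i + 1 \<notin> C" "int i \<notin> C"
      using zero_row pos_mem_rows_iff[of "int i + 1"] pos_mem_rows_iff[of "int i"] by simp_all
    then show ?thesis using relabel[of i] zero_row by simp
  next
    case (meeting_rows a b)
    obtain r c where b: "b = (r, c)" by (cases b)
    have m: "(r, c) \<in> F" "trail F (horizon n) (row_in a) (r - c) div 2 = r"
      "trail F (horizon n) (row_in (a + 1)) (r - c) div 2 = r"
      using meeting_rows by (simp_all add: b meets_row_iff)
    have "filling (horizon n) (F - {(r, c)})" using pre_filling_filling[OF P'] meeting_rows b by simp
    note first = meeting_rows_first[OF fill this m]
    have lm: "leftmost_one F a c" "leftmost_one F (a + 1) c"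
      using first m(1) by (force simp: leftmost_one_def not_less)+
    have "cover_step n C F C (replace_rows a c c F) (row_pair_index a)"
      by (rule cover_step_rows(1)[OF pre _ _ lm]) (use meeting_rows first m in \<open>simp_all add: mem_rows_iff\<close>)
    then show ?thesis
      using covered meeting_rows first by (simp add: replace_rows_single b)
  next
    case (meeting_cols j b)
    obtain r c where b: "b = (r, c)" by (cases b)
    have m: "(r, c) \<in> F" "trail F (horizon n) (col_in n j) (r - c) div 2 = r"
      "trail F (horizon n) (col_in n (j + 1)) (r - c) div 2 = r"
      using meeting_cols by (simp_all add: b meets_col_iff)
    have "filling (horizon n) (F - {(r, c)})" using pre_filling_filling[OF P'] meeting_cols b by simp
    note first = meeting_cols_first[OF fill this m]
    have tm: "topmost_one F j r" "topmost_one F (j + 1) r"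
      using first m(1) by (force simp: topmost_one_def not_less)+
    have rj: "(r, j) \<in> F" using first(1) m(1) by simp
    have j1: "1 \<le> j" using meeting_cols pre_filling_cols[OF pre, of j] by simp
    \<comment> \<open>Being topmost, a diagonal 1 in column j would be the deleted one, and row -j
      of \<open>T'\<close> would have a 0 in its diagonal but a 1 in column j + 1.\<close>
    have "(- j, j) \<notin> F"
    proof
      assume "(- j, j) \<in> F"
      then have "r = - j" using first(3)[of "- j"] pre_fillingD(2)[OF pre rj] by force
      then have "(- j, j + 1) \<in> ?F'" "(- j, j) \<notin> ?F'" using first(1,2) meeting_cols b by auto
      then show False using diag'[of j "j + 1"] j1 by simp
    qed
    moreover have "(- (j + 1), j + 1) \<notin> F"
      using first(4)[of "- (j + 1)"] pre_fillingD(2)[OF pre rj] by force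
    ultimately have "cover_step n C F C (replace_cols j r r F) (nat j)"
      by (intro cover_step_cols(1)[OF pre _ _ _ _ tm]) (use meeting_cols rj in simp_all)
    then show ?thesis
      using covered meeting_cols first by (simp add: replace_cols_single b)
  next
    case (rectangle_rows a x y)
    note xD = leftmost_oneD[OF rectangle_rows(5)] and yD = leftmost_oneD[OF rectangle_rows(6)]
    have lab: "row_label_of n C a" "row_label_of n C (a + 1)"
      using rectangle_rows by (simp_all add: mem_rows_iff)
    have "a + 1 \<noteq> x"
      using pre_fillingD(1,8)[OF pre xD(1)] row_pair_index(3,4)[OF pre lab] by (cases "0 < a") auto
    then have "(a + 1, x) \<in> F"
      using filling_corner[OF fill, of "a + 1" x a y] xD(1) yD(1) rectangle_rows
        pre_fillingD(6)[OF pre xD(1)] by simp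
    then show ?thesis
      using covered cover_step_rows(1)[OF pre lab rectangle_rows(5,6)] rectangle_rows by simp
  next
    case (rectangle_cols j x y)
    note xD = topmost_oneD[OF rectangle_cols(5)] and yD = topmost_oneD[OF rectangle_cols(6)]
    note bx = pre_fillingD[OF pre xD(1)]
    \<comment> \<open>As for meeting points: the replacement would clear the diagonal of row -j and
      put a 1 to its left.\<close>
    have "(- j, j) \<notin> F"
    proof
      assume "(- j, j) \<in> F"
      then have "x = - j" using xD(2)[of "- j"] bx(2) by force
      then have "(- j, j + 1) \<in> ?F'" "(- j, j) \<notin> ?F'"
        using xD(1) rectangle_cols by (simp_all add: mem_replace_cols)
      then show False using diag'[of j "j + 1"] bx(8) by simp
    qed
    moreover have "(- (j + 1), j + 1) \<notin> F"
      using yD(2)[of "- (j + 1)"] bx(2) rectangle_cols(7) by force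
    moreover have "(y, j) \<in> F"
    proof -
      have "y \<noteq> j" using empty_row_if_col yD(1) rectangle_cols(3) by metis
      then show ?thesis
        using filling_corner[OF fill, of y j x "j + 1"] xD(1) yD(1) rectangle_cols(7)
          pre_fillingD(6)[OF pre yD(1)] by simp
    qed
    ultimately have "cover_step n C F C (replace_cols j x y F) (nat j)"
      by (intro cover_step_cols(1)[OF pre _ _ _ _ rectangle_cols(5,6)]) (use rectangle_cols in simp_all)
    then show ?thesis using covered rectangle_cols by simp
  next
    case (rectangle_imaginary i y)
    note i = rectangle_imaginary(3-6) and y = rectangle_imaginary(7)
    note mem = mem_replace_imaginary_rows[OF pre i(1,3,4) y]
    \<comment> \<open>Row -(i + 1) receives the leftmost 1 of row -i, so its diagonal contains 1 in
      the tableau \<open>T'\<close>. This 1 can only stem from (-i, i + 1).\<close>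
    have "(- (i + 1), y) \<in> ?F'"
      using leftmost_oneD(1)[OF y] rectangle_imaginary(2,8) mem by simp
    then have "(- (i + 1), i + 1) \<in> ?F'"
      using diag'[of "i + 1" y] pre_filling_cols[OF pre i(1)] by simp
    then have "(- i, i + 1) \<in> F" using rectangle_imaginary(2) mem by simp
    then show ?thesis
      using covered imaginary_left_one(1)[OF i y _ refl] rectangle_imaginary by simp
  next
    case (rectangle_imaginary_cols i y z)
    note i = rectangle_imaginary_cols(3-6)
    have "cover_step n C F C' ?F' (nat i)"
      unfolding rectangle_imaginary_cols(1,2)
      by (rule imaginary_no_left_one(1)[OF i rectangle_imaginary_cols(8,7,9) refl])
    then show ?thesis by (rule covered)
  qed
qed

end

theorem theorem4p5:
  fixes n :: nat and T T' :: tableau and \<sigma> \<sigma>' :: "int \<Rightarrow> int"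
  assumes "n \<ge> 1"
    and "T \<in> PT n" and "T' \<in> PT n"
    and "\<sigma> = zeta n T" and "\<sigma>' = zeta n T'"
  shows "weak_covers n \<sigma>' \<sigma> \<longleftrightarrow> obtained n T T'"
  using zeta_signed_perm[OF assms(2)] obtained_if_ascent[OF assms(2,3)] ascent_if_obtained[OF assms(2,3)]
  unfolding weak_covers_iff_ascent assms(4,5) by blast

end
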